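(* Let $(R,\mathfrak m,k)$ be a commutative Noetherian local ring with $\mathfrak m\neq 0$. If $\operatorname{Ext}_R(k,k)$ is generated as a right $R^!$-module by its elements of degree at most $2$, then $\operatorname{Ext}_R(k,k)=R^!$.
   Context: $\operatorname{Ext}_R(k,k)=\bigoplus_{i\ge0}\operatorname{Ext}_R^i(k,k)$ is the graded $k$-algebra with Yoneda product, $R^!$ is its $k$-subalgebra generated by $\operatorname{Ext}^1_R(k,k)$, and $\operatorname{Ext}_R(k,k)$ is regarded as a right $R^!$-module via the Yoneda product. *)

theory Defs
  imports "HOL-Algebra.Algebra" "HOL.Hull"
begin

section \<open>Local rings, free modules and free resolutions\<close>

definition local_ring :: "('a, 'r) ring_scheme \<Rightarrow> 'a set \<Rightarrow> bool" where
  "local_ring R m \<longleftrightarrow>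
     cring R \<and> maximalideal m R \<and> (\<forall>J. maximalideal J R \<longrightarrow> J = m)"

definition module_hom ::
  "('a, 'r) ring_scheme \<Rightarrow> ('a, 'b, 'm) module_scheme \<Rightarrow> ('a, 'c, 'n) module_scheme \<Rightarrow> ('b \<Rightarrow> 'c) set"
where
  "module_hom R M N = {f \<in> carrier M \<rightarrow> carrier N.
     (\<forall>x\<in>carrier M. \<forall>y\<in>carrier M. f (x \<oplus>\<^bsub>M\<^esub> y) = f x \<oplus>\<^bsub>N\<^esub> f y) \<and>
     (\<forall>r\<in>carrier R. \<forall>x\<in>carrier M. f (r \<odot>\<^bsub>M\<^esub> x) = r \<odot>\<^bsub>N\<^esub> f x)}"

definition free_module :: "('a, 'r) ring_scheme \<Rightarrow> ('a, 'b, 'm) module_scheme \<Rightarrow> bool" where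
  "free_module R M \<longleftrightarrow> module R M \<and>
     (\<exists>B\<subseteq>carrier M. \<forall>x\<in>carrier M. \<exists>!c. c \<in> B \<rightarrow>\<^sub>E carrier R \<and>
        finite {b\<in>B. c b \<noteq> \<zero>\<^bsub>R\<^esub>} \<and>
        x = (\<Oplus>\<^bsub>M\<^esub>b\<in>{b\<in>B. c b \<noteq> \<zero>\<^bsub>R\<^esub>}. c b \<odot>\<^bsub>M\<^esub> b))"

text \<open>The residue field \<open>R Quot m\<close>, regarded as an \<open>R\<close>-module.\<close>

definition residue_module :: "('a, 'r) ring_scheme \<Rightarrow> 'a set \<Rightarrow> ('a, 'a set) module" where
  "residue_module R m =
     ring.extend (R Quot m) (module.fields
       (\<lambda>r x. (m +>\<^bsub>R\<^esub> r) \<otimes>\<^bsub>R Quot m\<^esub> x))"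

text \<open>
  Complexes are indexed by all integers, so that maps of arbitrary degree need no case
  distinction; a resolution vanishes in negative degrees. The map \<open>d i\<close> goes from \<open>P i\<close> to
  \<open>P (i - 1)\<close>.
\<close>

definition free_resolution ::
  "('a, 'r) ring_scheme \<Rightarrow> ('a, 'c, 'n) module_scheme \<Rightarrow> (int \<Rightarrow> ('a, 'b, 'm) module_scheme)
    \<Rightarrow> (int \<Rightarrow> 'b \<Rightarrow> 'b) \<Rightarrow> ('b \<Rightarrow> 'c) \<Rightarrow> bool"
where
  "free_resolution R M P d \<epsilon> \<longleftrightarrow>
     (\<forall>i. free_module R (P i)) \<and>
     (\<forall>i<0. carrier (P i) = {\<zero>\<^bsub>P i\<^esub>}) \<and>
     (\<forall>i. d i \<in> module_hom R (P i) (P (i - 1))) \<and>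
     (\<forall>i\<ge>1. {x \<in> carrier (P i). d i x = \<zero>\<^bsub>P (i - 1)\<^esub>} = d (i + 1) ` carrier (P (i + 1))) \<and>
     \<epsilon> \<in> module_hom R (P 0) M \<and>
     {x \<in> carrier (P 0). \<epsilon> x = \<zero>\<^bsub>M\<^esub>} = d 1 ` carrier (P 1) \<and>
     \<epsilon> ` carrier (P 0) = carrier M"


section \<open>The endomorphism complex of a complex\<close>

text \<open>
  An element \<open>f\<close> of the direct sum over all integers \<open>n\<close> of
  \<open>Hom\<^sup>n(P, P) = (\<Prod>i. Hom(P i, P (i - n)))\<close> is a family in which \<open>f n i\<close> is the component
  from \<open>P i\<close> to \<open>P (i - n)\<close> of the part of degree \<open>n\<close>. Multiplication is composition:
  in degree \<open>n\<close>, the product of \<open>f\<close> and \<open>g\<close> is the sum over \<open>q\<close> of \<open>f (n - q) \<circ> g q\<close>.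
  The values of the maps outside the carriers are fixed (\<^const>\<open>extensional\<close>) so that equality
  of elements is equality of HOL functions.
\<close>

definition end_complex ::
  "('a, 'r) ring_scheme \<Rightarrow> (int \<Rightarrow> ('a, 'b, 'm) module_scheme) \<Rightarrow> ('a, int \<Rightarrow> int \<Rightarrow> 'b \<Rightarrow> 'b) module"
where
  "end_complex R P =
     \<lparr>carrier = {f. (\<forall>n i. f n i \<in> module_hom R (P i) (P (i - n)) \<inter> extensional (carrier (P i))) \<and>
                    finite {n. \<exists>i. \<exists>x\<in>carrier (P i). f n i x \<noteq> \<zero>\<^bsub>P (i - n)\<^esub>}},
      monoid.mult = (\<lambda>f g n i. \<lambda>x\<in>carrier (P i).
                \<Oplus>\<^bsub>P (i - n)\<^esub>q\<in>{q. f (n - q) (i - q) (g q i x) \<noteq> \<zero>\<^bsub>P (i - n)\<^esub>}.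
                  f (n - q) (i - q) (g q i x)),
      monoid.one = (\<lambda>n i. \<lambda>x\<in>carrier (P i). if n = 0 then x else \<zero>\<^bsub>P (i - n)\<^esub>),
      ring.zero = (\<lambda>n i. \<lambda>x\<in>carrier (P i). \<zero>\<^bsub>P (i - n)\<^esub>),
      ring.add = (\<lambda>f g n i. \<lambda>x\<in>carrier (P i). f n i x \<oplus>\<^bsub>P (i - n)\<^esub> g n i x),
      smult = (\<lambda>r f n i. \<lambda>x\<in>carrier (P i). r \<odot>\<^bsub>P (i - n)\<^esub> f n i x)\<rparr>"

text \<open>
  On a homogeneous map \<open>f\<close> of degree \<open>p\<close> the differential is \<open>d \<circ> f - (-1)\<^sup>p f \<circ> d\<close>, of degree
  \<open>p + 1\<close>. In the following formula \<open>n = p + 1\<close>.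
\<close>

definition end_diff ::
  "(int \<Rightarrow> ('a, 'b, 'm) module_scheme) \<Rightarrow> (int \<Rightarrow> 'b \<Rightarrow> 'b)
    \<Rightarrow> (int \<Rightarrow> int \<Rightarrow> 'b \<Rightarrow> 'b) \<Rightarrow> int \<Rightarrow> int \<Rightarrow> 'b \<Rightarrow> 'b"
where
  "end_diff P d f = (\<lambda>n i. \<lambda>x\<in>carrier (P i).
     if even n
     then d (i - n + 1) (f (n - 1) i x) \<oplus>\<^bsub>P (i - n)\<^esub> f (n - 1) (i - 1) (d i x)
     else d (i - n + 1) (f (n - 1) i x) \<ominus>\<^bsub>P (i - n)\<^esub> f (n - 1) (i - 1) (d i x))"

definition end_cycles ::
  "('a, 'r) ring_scheme \<Rightarrow> (int \<Rightarrow> ('a, 'b, 'm) module_scheme) \<Rightarrow> (int \<Rightarrow> 'b \<Rightarrow> 'b)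
    \<Rightarrow> (int \<Rightarrow> int \<Rightarrow> 'b \<Rightarrow> 'b) set"
where
  "end_cycles R P d =
     {f \<in> carrier (end_complex R P). end_diff P d f = \<zero>\<^bsub>end_complex R P\<^esub>}"

definition end_boundaries ::
  "('a, 'r) ring_scheme \<Rightarrow> (int \<Rightarrow> ('a, 'b, 'm) module_scheme) \<Rightarrow> (int \<Rightarrow> 'b \<Rightarrow> 'b)
    \<Rightarrow> (int \<Rightarrow> int \<Rightarrow> 'b \<Rightarrow> 'b) set"
where
  "end_boundaries R P d = end_diff P d ` carrier (end_complex R P)"


section \<open>The Ext-algebra of the residue field\<close>

text \<open>
  For a free resolution \<open>P\<close> of \<open>k = R Quot m\<close>, the algebra \<open>Ext\<^sub>R(k, k)\<close> is the homology of the
  endomorphism complex of \<open>P\<close>; the Yoneda product is composition of (signed) chain maps up to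
  homotopy. It does not depend on the resolution, up to isomorphism of graded \<open>k\<close>-algebras, and
  vanishes in negative degrees. The scalars are the elements of \<open>k\<close>, that is, cosets of \<open>m\<close>; they
  act through representatives, as in \<^const>\<open>rcoset_mult\<close>.
\<close>

definition ext_algebra ::
  "('a, 'r) ring_scheme \<Rightarrow> (int \<Rightarrow> ('a, 'b, 'm) module_scheme) \<Rightarrow> (int \<Rightarrow> 'b \<Rightarrow> 'b)
    \<Rightarrow> ('a set, (int \<Rightarrow> int \<Rightarrow> 'b \<Rightarrow> 'b) set) module"
where
  "ext_algebra R P d =
    (let E = end_complex R P; Z = E\<lparr>carrier := end_cycles R P d\<rparr>; B = end_boundaries R P d
     in ring.extend (Z Quot B) (module.fields
          (\<lambda>c x. \<Union>r\<in>c. \<Union>f\<in>x. B +>\<^bsub>Z\<^esub> (r \<odot>\<^bsub>E\<^esub> f))))"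

definition ext_component ::
  "('a, 'r) ring_scheme \<Rightarrow> (int \<Rightarrow> ('a, 'b, 'm) module_scheme) \<Rightarrow> (int \<Rightarrow> 'b \<Rightarrow> 'b)
    \<Rightarrow> int \<Rightarrow> (int \<Rightarrow> int \<Rightarrow> 'b \<Rightarrow> 'b) set set"
where
  "ext_component R P d n =
     {end_boundaries R P d +>\<^bsub>end_complex R P\<^esub> f | f. f \<in> end_cycles R P d \<and>
        (\<forall>p i. p \<noteq> n \<longrightarrow> (\<forall>x\<in>carrier (P i). f p i x = \<zero>\<^bsub>P (i - p)\<^esub>))}"

definition subalgebra_over ::
  "('k, 'r) ring_scheme \<Rightarrow> ('k, 'e, 'm) module_scheme \<Rightarrow> 'e set \<Rightarrow> bool"
where
  "subalgebra_over K E A \<longleftrightarrow> subring A E \<and> (\<forall>c\<in>carrier K. \<forall>x\<in>A. c \<odot>\<^bsub>E\<^esub> x \<in> A)"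

definition right_submodule :: "'e set \<Rightarrow> ('e, 'm) ring_scheme \<Rightarrow> 'e set \<Rightarrow> bool" where
  "right_submodule A E N \<longleftrightarrow> additive_subgroup N E \<and> (\<forall>x\<in>N. \<forall>a\<in>A. x \<otimes>\<^bsub>E\<^esub> a \<in> N)"

text \<open>\<open>R\<^sup>!\<close>, the \<open>k\<close>-subalgebra generated by the elements of degree one.\<close>

definition ext_shriek ::
  "('a, 'r) ring_scheme \<Rightarrow> 'a set \<Rightarrow> (int \<Rightarrow> ('a, 'b, 'm) module_scheme) \<Rightarrow> (int \<Rightarrow> 'b \<Rightarrow> 'b)
    \<Rightarrow> (int \<Rightarrow> int \<Rightarrow> 'b \<Rightarrow> 'b) set set"
where
  "ext_shriek R m P d =
     subalgebra_over (R Quot m) (ext_algebra R P d) hull ext_component R P d 1"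

end

theory Submission
  imports Defs
begin

text \<open>
  Let \<open>t\<close> denote lifts to \<open>P\<^sub>1\<close> of a minimal system of generators \<open>x\<^sub>i\<close> of \<open>m\<close>, and let
  \<open>s \<in> P\<^sub>2\<close> satisfy \<open>d s = \<Sum> a\<^sub>i t\<^sub>i\<close> with all \<open>a\<^sub>i\<close> in \<open>m\<^sup>2\<close>. In a resolution with divided
  powers one could form \<open>t\<^sub>i s\<close> and the divided square of \<open>s\<close>; in an arbitrary free resolution,
  exactness provides substitutes \<open>u\<^sub>i \<in> P\<^sub>3\<close> and \<open>v \<in> P\<^sub>4\<close> with \<open>d v = \<Sum> a\<^sub>i u\<^sub>i\<close>.
  A chain map of degree one sends \<open>v\<close> into \<open>m P\<^sub>3 + d P\<^sub>4\<close>. Therefore the elements of \<open>R\<^sup>!\<close> act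
  on \<open>v\<close>, modulo such terms, through their components of degree zero, and a class of degree four
  that is generated over \<open>R\<^sup>!\<close> by classes of degree at most two vanishes on \<open>v\<close>. On the other hand,
  the square of a class \<open>\<chi>\<close> of degree two takes the value \<open>\<chi>(s)\<^sup>2\<close> at \<open>v\<close>. Hence under the
  hypothesis all classes of degree two vanish on all such \<open>s\<close>.

  If \<open>h\<^sub>1, \<dots>, h\<^sub>n\<close> are the classes of degree one dual to the \<open>x\<^sub>i\<close>, then the values of
  the products \<open>h\<^sub>i h\<^sub>j\<close> at an element \<open>s\<close> with \<open>d s = \<Sum> a\<^sub>i t\<^sub>i\<close> determine the \<open>a\<^sub>i\<close>
  modulo \<open>m\<^sup>2\<close>. So every functional given by a class of degree two is a linear combination of
  those of the \<open>h\<^sub>i h\<^sub>j\<close>, and a class of degree two whose functional vanishes is a coboundary.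
\<close>

section \<open>Modules\<close>

text \<open>The resolution is neither assumed minimal nor multiplicative. The first defect is met by
  replacing m P_i with \<open>rad i\<close>, that is m P_i + d P_(i+1), which every chain map
  preserves. The second is met by choosing all comparison maps linear, or alternating, in a tuple
  argument: a linear map sends a tuple with entries in m into \<open>rad\<close>, and an alternating
  one vanishes at (a, a), so that the unknown error terms become harmless when evaluated at a. The
  exponent in m^2 comes from classes of degree one: if c is the functional of such a class, c(a) has
  to be \<open>\<delta> b\<close> for a tuple b with entries in m, because h(v) turns out to be -
  u(b) up to harmless terms. Degree four is chosen because generators of degree at most two have no
  component that could map v to P_0, while the square of a class of degree two does. Its value at v
  has coefficient 1, as for a divided square; the ordinary square of s would give 2 and fail in
  residue characteristic two. For the same reason alternating is never weakened to
  antisymmetric.\<close>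

context module
begin

lemma neg_zero: "\<ominus>\<^bsub>M\<^esub> \<zero>\<^bsub>M\<^esub> = \<zero>\<^bsub>M\<^esub>"
  using M.add.inv_one by (simp add: a_inv_def)

text \<open>Lets the method \<open>algebra\<close> decide linear identities between module elements.\<close>

lemmas module_normalize
  [algebra add: cring "ring.zero R" "ring.add R" "a_inv R" "a_minus R" "monoid.one R" "monoid.mult R"] =
  M.a_closed M.zero_closed M.a_inv_closed M.minus_closed M.a_assoc M.l_zero M.r_zero
  M.l_neg M.r_neg M.r_neg1 M.r_neg2 M.minus_add M.minus_minus neg_zero M.a_comm M.a_lcomm
  M.minus_eq smult_closed smult_l_distr smult_r_distr smult_l_minus smult_r_minus
  smult_l_null smult_r_null smult_assoc1[symmetric] smult_one

lemma sub_eq_zero_iff: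
  assumes "x \<in> carrier M" "y \<in> carrier M"
  shows "x \<ominus>\<^bsub>M\<^esub> y = \<zero>\<^bsub>M\<^esub> \<longleftrightarrow> x = y"
proof
  assume *: "x \<ominus>\<^bsub>M\<^esub> y = \<zero>\<^bsub>M\<^esub>"
  have "x = (x \<ominus>\<^bsub>M\<^esub> y) \<oplus>\<^bsub>M\<^esub> y" using assms by algebra
  thus "x = y" using * assms by simp
next
  assume "x = y" thus "x \<ominus>\<^bsub>M\<^esub> y = \<zero>\<^bsub>M\<^esub>" using assms by algebra
qed

end

section \<open>Linear maps, finite sums and projectivity of free modules\<close>

lemma module_homI:
  assumes "\<And>x. x \<in> carrier M \<Longrightarrow> f x \<in> carrier N"
    and "\<And>x y. \<lbrakk>x \<in> carrier M; y \<in> carrier M\<rbrakk> \<Longrightarrow> f (x \<oplus>\<^bsub>M\<^esub> y) = f x \<oplus>\<^bsub>N\<^esub> f y"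
    and "\<And>r x. \<lbrakk>r \<in> carrier R; x \<in> carrier M\<rbrakk> \<Longrightarrow> f (r \<odot>\<^bsub>M\<^esub> x) = r \<odot>\<^bsub>N\<^esub> f x"
  shows "f \<in> module_hom R M N"
  using assms by (auto simp: module_hom_def)

lemma hom_closed: "\<lbrakk>f \<in> module_hom R M N; x \<in> carrier M\<rbrakk> \<Longrightarrow> f x \<in> carrier N"
  and hom_add: "\<lbrakk>f \<in> module_hom R M N; x \<in> carrier M; y \<in> carrier M\<rbrakk>
    \<Longrightarrow> f (x \<oplus>\<^bsub>M\<^esub> y) = f x \<oplus>\<^bsub>N\<^esub> f y"
  and hom_smult: "\<lbrakk>f \<in> module_hom R M N; r \<in> carrier R; x \<in> carrier M\<rbrakk>
    \<Longrightarrow> f (r \<odot>\<^bsub>M\<^esub> x) = r \<odot>\<^bsub>N\<^esub> f x"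
  by (auto simp: module_hom_def)

lemma hom_zero:
  assumes "module R M" "module R N" "f \<in> module_hom R M N"
  shows "f \<zero>\<^bsub>M\<^esub> = \<zero>\<^bsub>N\<^esub>"
proof -
  interpret M: module R M by fact
  interpret N: module R N by fact
  have "f (\<zero>\<^bsub>R\<^esub> \<odot>\<^bsub>M\<^esub> \<zero>\<^bsub>M\<^esub>) = \<zero>\<^bsub>R\<^esub> \<odot>\<^bsub>N\<^esub> f \<zero>\<^bsub>M\<^esub>"
    using assms(3) by (intro hom_smult) auto
  thus ?thesis using hom_closed[OF assms(3) M.M.zero_closed] by simp
qed

lemma hom_neg:
  assumes "module R M" "module R N" "f \<in> module_hom R M N" "x \<in> carrier M"
  shows "f (\<ominus>\<^bsub>M\<^esub> x) = \<ominus>\<^bsub>N\<^esub> f x"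
proof -
  interpret M: module R M by fact
  interpret N: module R N by fact
  have "f ((\<ominus>\<^bsub>R\<^esub> \<one>\<^bsub>R\<^esub>) \<odot>\<^bsub>M\<^esub> x) = (\<ominus>\<^bsub>R\<^esub> \<one>\<^bsub>R\<^esub>) \<odot>\<^bsub>N\<^esub> f x"
    using assms(3,4) by (intro hom_smult) auto
  thus ?thesis using assms(4) hom_closed[OF assms(3,4)]
    by (simp add: M.smult_l_minus N.smult_l_minus)
qed

lemma hom_minus:
  assumes "module R M" "module R N" "f \<in> module_hom R M N" "x \<in> carrier M" "y \<in> carrier M"
  shows "f (x \<ominus>\<^bsub>M\<^esub> y) = f x \<ominus>\<^bsub>N\<^esub> f y"
proof -
  interpret M: module R M by fact
  interpret N: module R N by fact
  show ?thesis
    using assms by (simp add: a_minus_def hom_add hom_neg[OF assms(1-3)])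
qed

lemma hom_comp:
  assumes "f \<in> module_hom R M N" "g \<in> module_hom R N K"
  shows "(\<lambda>x. g (f x)) \<in> module_hom R M K"
  using assms by (auto simp: module_hom_def Pi_iff)

lemma hom_cong:
  assumes "f \<in> module_hom R M N" "module R M" "\<And>x. x \<in> carrier M \<Longrightarrow> f x = g x"
  shows "g \<in> module_hom R M N"
proof -
  interpret M: module R M by fact
  show ?thesis
    using hom_closed[OF assms(1)] hom_add[OF assms(1)] hom_smult[OF assms(1)]
    by (intro module_homI) (auto simp: assms(3)[symmetric])
qed

lemma hom_finsum:
  assumes N: "module R N" and "finite Q" "\<And>q. q \<in> Q \<Longrightarrow> f q \<in> module_hom R M N"
  shows "(\<lambda>x. \<Oplus>\<^bsub>N\<^esub>q\<in>Q. f q x) \<in> module_hom R M N" and "x \<in> carrier M \<Longrightarrow> (\<Oplus>\<^bsub>N\<^esub>q\<in>Q. f q x) \<in> carrier N"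
proof -
  interpret N: module R N by fact
  have cl: "(\<lambda>q. f q x) \<in> Q \<rightarrow> carrier N" if "x \<in> carrier M" for x
    by (rule Pi_I) (rule hom_closed[OF assms(3) that])
  show c: "(\<Oplus>\<^bsub>N\<^esub>q\<in>Q. f q x) \<in> carrier N" if "x \<in> carrier M" for x
    by (rule N.M.finsum_closed[OF cl[OF that]])
  show "(\<lambda>x. \<Oplus>\<^bsub>N\<^esub>q\<in>Q. f q x) \<in> module_hom R M N"
  proof (rule module_homI)
    fix x y assume x: "x \<in> carrier M" and y: "y \<in> carrier M"
    have "(\<Oplus>\<^bsub>N\<^esub>q\<in>Q. f q (x \<oplus>\<^bsub>M\<^esub> y)) = (\<Oplus>\<^bsub>N\<^esub>q\<in>Q. f q x \<oplus>\<^bsub>N\<^esub> f q y)"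
      using cl[OF x] cl[OF y] hom_add[OF assms(3) x y]
      by (intro N.M.finsum_cong' refl) (auto simp: Pi_iff)
    thus "(\<Oplus>\<^bsub>N\<^esub>q\<in>Q. f q (x \<oplus>\<^bsub>M\<^esub> y)) = (\<Oplus>\<^bsub>N\<^esub>q\<in>Q. f q x) \<oplus>\<^bsub>N\<^esub> (\<Oplus>\<^bsub>N\<^esub>q\<in>Q. f q y)"
      using N.M.finsum_addf[OF cl[OF x] cl[OF y]] by simp
  next
    fix r x assume r: "r \<in> carrier R" and x: "x \<in> carrier M"
    have "(\<Oplus>\<^bsub>N\<^esub>q\<in>Q. f q (r \<odot>\<^bsub>M\<^esub> x)) = (\<Oplus>\<^bsub>N\<^esub>q\<in>Q. r \<odot>\<^bsub>N\<^esub> f q x)"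
      using cl[OF x] hom_smult[OF assms(3) r x] r by (intro N.M.finsum_cong' refl) (auto simp: Pi_iff)
    thus "(\<Oplus>\<^bsub>N\<^esub>q\<in>Q. f q (r \<odot>\<^bsub>M\<^esub> x)) = r \<odot>\<^bsub>N\<^esub> (\<Oplus>\<^bsub>N\<^esub>q\<in>Q. f q x)"
      using N.finsum_smult_ldistr[OF assms(2) r cl[OF x]] by simp
  qed (rule c)
qed

lemma finsum_hom:
  assumes M: "module R M" and N: "module R N" and h: "h \<in> module_hom R M N"
    and Q: "finite Q" "f \<in> Q \<rightarrow> carrier M"
  shows "h (\<Oplus>\<^bsub>M\<^esub>q\<in>Q. f q) = (\<Oplus>\<^bsub>N\<^esub>q\<in>Q. h (f q))"
  using Q
proof induction
  case empty
  interpret M: module R M by fact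
  interpret N: module R N by fact
  show ?case using hom_zero[OF M N h] by simp
next
  case (insert q Q)
  interpret M: module R M by fact
  interpret N: module R N by fact
  have "f \<in> Q \<rightarrow> carrier M" "f q \<in> carrier M" "(\<lambda>q. h (f q)) \<in> Q \<rightarrow> carrier N" "h (f q) \<in> carrier N"
    using insert.prems hom_closed[OF h] by (auto simp: Pi_iff)
  thus ?case using insert hom_add[OF h] by (simp add: M.M.finsum_closed)
qed

text \<open>\<open>free_module\<close> sums over the support of the coefficients, which changes with
  the element. Passing to a common finite index set makes two such sums comparable.\<close>

lemma (in module) finsum_support:
  assumes "finite T" "T \<subseteq> B" "{b\<in>B. c b \<noteq> \<zero>} \<subseteq> T"
    and "c \<in> B \<rightarrow> carrier R" "g \<in> B \<rightarrow> carrier M"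
  shows "(\<Oplus>\<^bsub>M\<^esub>b\<in>{b\<in>B. c b \<noteq> \<zero>}. c b \<odot>\<^bsub>M\<^esub> g b) = (\<Oplus>\<^bsub>M\<^esub>b\<in>T. c b \<odot>\<^bsub>M\<^esub> g b)"
proof (rule M.add.finprod_mono_neutral_cong_left)
  show "(\<lambda>b. c b \<odot>\<^bsub>M\<^esub> g b) \<in> T \<rightarrow> carrier M"
    using assms by (auto simp: Pi_iff)
  fix i assume "i \<in> T - {b\<in>B. c b \<noteq> \<zero>}"
  thus "c i \<odot>\<^bsub>M\<^esub> g i = \<zero>\<^bsub>M\<^esub>" using assms by (auto simp: Pi_iff)
qed (use assms in auto)

lemma (in module) finsum_support_add:
  assumes "finite {b\<in>B. c b \<noteq> \<zero>}" "finite {b\<in>B. c' b \<noteq> \<zero>}"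
    and "c \<in> B \<rightarrow> carrier R" "c' \<in> B \<rightarrow> carrier R" "g \<in> B \<rightarrow> carrier M"
    and e: "\<And>b. b \<in> B \<Longrightarrow> e b = c b \<oplus> c' b"
  shows "(\<Oplus>\<^bsub>M\<^esub>b\<in>{b\<in>B. e b \<noteq> \<zero>}. e b \<odot>\<^bsub>M\<^esub> g b) =
    (\<Oplus>\<^bsub>M\<^esub>b\<in>{b\<in>B. c b \<noteq> \<zero>}. c b \<odot>\<^bsub>M\<^esub> g b) \<oplus>\<^bsub>M\<^esub> (\<Oplus>\<^bsub>M\<^esub>b\<in>{b\<in>B. c' b \<noteq> \<zero>}. c' b \<odot>\<^bsub>M\<^esub> g b)"
proof -
  \<comment> \<open>Cancellation can make the support of \<open>e\<close> smaller than this union,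
    so all three sums are taken over the union.\<close>
  define T where "T = {b\<in>B. c b \<noteq> \<zero>} \<union> {b\<in>B. c' b \<noteq> \<zero>}"
  have T: "finite T" "T \<subseteq> B" "{b\<in>B. c b \<noteq> \<zero>} \<subseteq> T" "{b\<in>B. c' b \<noteq> \<zero>} \<subseteq> T"
    using assms by (auto simp: T_def)
  have eT: "{b\<in>B. e b \<noteq> \<zero>} \<subseteq> T"
    using e assms by (auto simp: T_def)
  have eB: "e \<in> B \<rightarrow> carrier R" using e assms by (auto simp: Pi_iff)
  have "(\<Oplus>\<^bsub>M\<^esub>b\<in>T. e b \<odot>\<^bsub>M\<^esub> g b) = (\<Oplus>\<^bsub>M\<^esub>b\<in>T. c b \<odot>\<^bsub>M\<^esub> g b \<oplus>\<^bsub>M\<^esub> c' b \<odot>\<^bsub>M\<^esub> g b)"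
    using T(2) e assms(3-5)
    by (intro M.finsum_cong' refl) (auto simp: Pi_iff subset_iff smult_l_distr)
  also have "\<dots> = (\<Oplus>\<^bsub>M\<^esub>b\<in>T. c b \<odot>\<^bsub>M\<^esub> g b) \<oplus>\<^bsub>M\<^esub> (\<Oplus>\<^bsub>M\<^esub>b\<in>T. c' b \<odot>\<^bsub>M\<^esub> g b)"
    using T(2) assms(3-5) by (intro M.finsum_addf) (auto simp: Pi_iff subset_iff)
  finally show ?thesis
    using finsum_support[OF T(1,2) eT eB assms(5)] finsum_support[OF T(1,2,3) assms(3,5)]
      finsum_support[OF T(1,2,4) assms(4,5)] by simp
qed

lemma (in module) finsum_support_smult:
  assumes fin: "finite {b\<in>B. c b \<noteq> \<zero>}" and r: "r \<in> carrier R"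
    and c: "c \<in> B \<rightarrow> carrier R" and g: "g \<in> B \<rightarrow> carrier M"
    and e: "\<And>b. b \<in> B \<Longrightarrow> e b = r \<otimes> c b"
  shows "(\<Oplus>\<^bsub>M\<^esub>b\<in>{b\<in>B. e b \<noteq> \<zero>}. e b \<odot>\<^bsub>M\<^esub> g b) =
    r \<odot>\<^bsub>M\<^esub> (\<Oplus>\<^bsub>M\<^esub>b\<in>{b\<in>B. c b \<noteq> \<zero>}. c b \<odot>\<^bsub>M\<^esub> g b)"
proof -
  let ?T = "{b\<in>B. c b \<noteq> \<zero>}"
  have eT: "{b\<in>B. e b \<noteq> \<zero>} \<subseteq> ?T" using e r by auto
  have eB: "e \<in> B \<rightarrow> carrier R" using e r c by (auto simp: Pi_iff)
  have "(\<Oplus>\<^bsub>M\<^esub>b\<in>{b\<in>B. e b \<noteq> \<zero>}. e b \<odot>\<^bsub>M\<^esub> g b) = (\<Oplus>\<^bsub>M\<^esub>b\<in>?T. e b \<odot>\<^bsub>M\<^esub> g b)"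
    using fin by (rule finsum_support) (use eT eB g in auto)
  also have "\<dots> = (\<Oplus>\<^bsub>M\<^esub>b\<in>?T. r \<odot>\<^bsub>M\<^esub> (c b \<odot>\<^bsub>M\<^esub> g b))"
    using e r c g by (intro M.finsum_cong' refl) (auto simp: Pi_iff smult_assoc1)
  also have "\<dots> = r \<odot>\<^bsub>M\<^esub> (\<Oplus>\<^bsub>M\<^esub>b\<in>?T. c b \<odot>\<^bsub>M\<^esub> g b)"
    using fin r c g by (intro finsum_smult_ldistr[symmetric]) (auto simp: Pi_iff)
  finally show ?thesis .
qed

text \<open>
  Projectivity of free modules in the form of a choice principle: a total linear relation
  \<open>S\<close> contains the graph of a linear map.
\<close>

lemma free_selection:
  assumes free: "free_module R F" and M: "module R M"
    and total: "\<And>x. x \<in> carrier F \<Longrightarrow> \<exists>y\<in>carrier M. S x y"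
    and S_add: "\<And>x x' y y'. \<lbrakk>x \<in> carrier F; x' \<in> carrier F; y \<in> carrier M; y' \<in> carrier M;
      S x y; S x' y'\<rbrakk> \<Longrightarrow> S (x \<oplus>\<^bsub>F\<^esub> x') (y \<oplus>\<^bsub>M\<^esub> y')"
    and S_smult: "\<And>r x y. \<lbrakk>r \<in> carrier R; x \<in> carrier F; y \<in> carrier M; S x y\<rbrakk>
      \<Longrightarrow> S (r \<odot>\<^bsub>F\<^esub> x) (r \<odot>\<^bsub>M\<^esub> y)"
  obtains f where "f \<in> module_hom R F M" "\<And>x. x \<in> carrier F \<Longrightarrow> S x (f x)"
proof -
  interpret M: module R M by fact
  interpret F: module R F using free unfolding free_module_def by (rule conjunct1)
  let ?supp = "\<lambda>B c. {b\<in>B. c b \<noteq> \<zero>\<^bsub>R\<^esub>}"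
  let ?rep = "\<lambda>B x c. c \<in> B \<rightarrow>\<^sub>E carrier R \<and> finite (?supp B c) \<and>
        x = (\<Oplus>\<^bsub>F\<^esub>b\<in>?supp B c. c b \<odot>\<^bsub>F\<^esub> b)"
  have "\<exists>B. B \<subseteq> carrier F \<and> (\<forall>x\<in>carrier F. \<exists>!c. ?rep B x c)"
    using free unfolding free_module_def by (elim conjE)
  then obtain B where B: "B \<subseteq> carrier F" and ex1': "\<forall>x\<in>carrier F. \<exists>!c. ?rep B x c"
    by (elim exE conjE)
  define rep where "rep x c \<longleftrightarrow> ?rep B x c" for x c
  have ex1: "\<exists>!c. rep x c" if "x \<in> carrier F" for x
    using bspec[OF ex1' that] by (simp only: rep_def)
  define C where "C x = (THE c. rep x c)" for x
  have C: "C x \<in> B \<rightarrow>\<^sub>E carrier R \<and> finite (?supp B (C x)) \<and>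
        x = (\<Oplus>\<^bsub>F\<^esub>b\<in>?supp B (C x). C x b \<odot>\<^bsub>F\<^esub> b)" if "x \<in> carrier F" for x
    using theI'[OF ex1[OF that]] by (simp only: C_def[symmetric]) (simp only: rep_def)
  have C_eq: "C x = c" if "x \<in> carrier F" "c \<in> B \<rightarrow>\<^sub>E carrier R" "finite (?supp B c)"
      "x = (\<Oplus>\<^bsub>F\<^esub>b\<in>?supp B c. c b \<odot>\<^bsub>F\<^esub> b)" for x c
  proof -
    have "rep x c" unfolding rep_def using that by (intro conjI)
    thus ?thesis unfolding C_def by (rule the1_equality[OF ex1[OF that(1)]])
  qed
  have CB: "C x \<in> B \<rightarrow> carrier R" if "x \<in> carrier F" for x
    using C[OF that] by (auto simp: PiE_iff Pi_iff)
  have idB: "(\<lambda>b. b) \<in> B \<rightarrow> carrier F" using B by auto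
  have "\<forall>b\<in>B. \<exists>y. y \<in> carrier M \<and> S b y" using B total by blast
  then obtain g where g: "\<And>b. b \<in> B \<Longrightarrow> g b \<in> carrier M \<and> S b (g b)" by metis
  have gB: "g \<in> B \<rightarrow> carrier M" using g by auto
  \<comment> \<open>A partner \<open>g b\<close> of each basis element is chosen by totality;
    \<open>f\<close> is its linear extension. That \<open>S\<close> contains the graph of
    \<open>f\<close> then follows by adding up along the support.\<close>
  define f where "f x = (\<Oplus>\<^bsub>M\<^esub>b\<in>?supp B (C x). C x b \<odot>\<^bsub>M\<^esub> g b)" for x
  have f_closed: "f x \<in> carrier M" if "x \<in> carrier F" for x
    unfolding f_def using CB[OF that] gB by (intro M.M.finsum_closed) (auto simp: Pi_iff)
  have C_add: "C (x \<oplus>\<^bsub>F\<^esub> y) b = C x b \<oplus>\<^bsub>R\<^esub> C y b"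
    if x: "x \<in> carrier F" and y: "y \<in> carrier F" and b: "b \<in> B" for x y b
  proof -
    define e where "e = (\<lambda>b\<in>B. C x b \<oplus>\<^bsub>R\<^esub> C y b)"
    have "C (x \<oplus>\<^bsub>F\<^esub> y) = e"
    proof (rule C_eq)
      show "e \<in> B \<rightarrow>\<^sub>E carrier R" using CB[OF x] CB[OF y] by (auto simp: e_def Pi_iff)
      have "?supp B e \<subseteq> ?supp B (C x) \<union> ?supp B (C y)"
        using CB[OF x] CB[OF y] by (auto simp: e_def Pi_iff)
      thus "finite (?supp B e)" using C[OF x] C[OF y] by (meson finite_UnI finite_subset)
      have "(\<Oplus>\<^bsub>F\<^esub>b\<in>?supp B e. e b \<odot>\<^bsub>F\<^esub> b) =
        (\<Oplus>\<^bsub>F\<^esub>b\<in>?supp B (C x). C x b \<odot>\<^bsub>F\<^esub> b) \<oplus>\<^bsub>F\<^esub> (\<Oplus>\<^bsub>F\<^esub>b\<in>?supp B (C y). C y b \<odot>\<^bsub>F\<^esub> b)"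
        using C[OF x] C[OF y] CB[OF x] CB[OF y] idB
        by (intro F.finsum_support_add) (auto simp: e_def)
      thus "x \<oplus>\<^bsub>F\<^esub> y = (\<Oplus>\<^bsub>F\<^esub>b\<in>?supp B e. e b \<odot>\<^bsub>F\<^esub> b)" using C[OF x] C[OF y] by simp
    qed (use x y in auto)
    thus ?thesis using b by (simp add: e_def)
  qed
  have C_smult: "C (r \<odot>\<^bsub>F\<^esub> x) b = r \<otimes>\<^bsub>R\<^esub> C x b"
    if r: "r \<in> carrier R" and x: "x \<in> carrier F" and b: "b \<in> B" for r x b
  proof -
    define e where "e = (\<lambda>b\<in>B. r \<otimes>\<^bsub>R\<^esub> C x b)"
    have "C (r \<odot>\<^bsub>F\<^esub> x) = e"
    proof (rule C_eq)
      show "e \<in> B \<rightarrow>\<^sub>E carrier R" using CB[OF x] r by (auto simp: e_def Pi_iff)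
      have "?supp B e \<subseteq> ?supp B (C x)"
        using r by (auto simp: e_def Pi_iff)
      thus "finite (?supp B e)" using C[OF x] by (meson finite_subset)
      have "(\<Oplus>\<^bsub>F\<^esub>b\<in>?supp B e. e b \<odot>\<^bsub>F\<^esub> b) = r \<odot>\<^bsub>F\<^esub> (\<Oplus>\<^bsub>F\<^esub>b\<in>?supp B (C x). C x b \<odot>\<^bsub>F\<^esub> b)"
        using C[OF x] CB[OF x] idB r
        by (intro F.finsum_support_smult) (auto simp: e_def)
      thus "r \<odot>\<^bsub>F\<^esub> x = (\<Oplus>\<^bsub>F\<^esub>b\<in>?supp B e. e b \<odot>\<^bsub>F\<^esub> b)" using C[OF x] by simp
    qed (use x r in auto)
    thus ?thesis using b by (simp add: e_def)
  qed
  have hom: "f \<in> module_hom R F M"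
  proof (rule module_homI)
    fix x y assume x: "x \<in> carrier F" and y: "y \<in> carrier F"
    show "f (x \<oplus>\<^bsub>F\<^esub> y) = f x \<oplus>\<^bsub>M\<^esub> f y"
      unfolding f_def using C[OF x] C[OF y] CB[OF x] CB[OF y] gB C_add[OF x y]
      by (intro M.finsum_support_add) auto
  next
    fix r x assume r: "r \<in> carrier R" and x: "x \<in> carrier F"
    show "f (r \<odot>\<^bsub>F\<^esub> x) = r \<odot>\<^bsub>M\<^esub> f x"
      unfolding f_def using C[OF x] CB[OF x] gB r C_smult[OF r x]
      by (intro M.finsum_support_smult) auto
  qed (rule f_closed)
  \<comment> \<open>Needed for the empty sum; it comes from totality at zero and the scalar
    zero.\<close>
  have S0: "S \<zero>\<^bsub>F\<^esub> \<zero>\<^bsub>M\<^esub>"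
  proof -
    obtain y where "y \<in> carrier M" "S \<zero>\<^bsub>F\<^esub> y" using total[OF F.M.zero_closed] by blast
    with S_smult[of "\<zero>\<^bsub>R\<^esub>" "\<zero>\<^bsub>F\<^esub>" y] show ?thesis by simp
  qed
  have sums: "S (\<Oplus>\<^bsub>F\<^esub>b\<in>T. c b \<odot>\<^bsub>F\<^esub> b) (\<Oplus>\<^bsub>M\<^esub>b\<in>T. c b \<odot>\<^bsub>M\<^esub> g b)"
    if "finite T" "T \<subseteq> B" "c \<in> B \<rightarrow> carrier R" for T c
    using that(1,2)
  proof induction
    case empty
    show ?case using S0 by simp
  next
    case (insert b T)
    have b: "b \<in> B" "b \<in> carrier F" "c b \<in> carrier R" "g b \<in> carrier M" "S b (g b)"
      using insert that(3) B g by auto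
    have 1: "(\<lambda>b. c b \<odot>\<^bsub>F\<^esub> b) \<in> T \<rightarrow> carrier F" "(\<lambda>b. c b \<odot>\<^bsub>M\<^esub> g b) \<in> T \<rightarrow> carrier M"
      using insert that(3) B g by (auto simp: Pi_iff subset_iff)
    show ?case
      using insert b 1 by (auto intro!: S_add S_smult F.M.finsum_closed M.M.finsum_closed)
  qed
  have "S x (f x)" if "x \<in> carrier F" for x
    using sums[of "?supp B (C x)" "C x"] C[OF that] CB[OF that] unfolding f_def by auto
  with hom show thesis using that by blast
qed

lemma hom_plus:
  assumes "module R N" and f: "f \<in> module_hom R M N" and g: "g \<in> module_hom R M N"
  shows "(\<lambda>x. f x \<oplus>\<^bsub>N\<^esub> g x) \<in> module_hom R M N"
proof (rule module_homI)
  interpret N: module R N by fact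
  fix x assume x: "x \<in> carrier M"
  note cx = hom_closed[OF f x] hom_closed[OF g x]
  show "f x \<oplus>\<^bsub>N\<^esub> g x \<in> carrier N" using cx by simp
  {
    fix y assume y: "y \<in> carrier M"
    show "f (x \<oplus>\<^bsub>M\<^esub> y) \<oplus>\<^bsub>N\<^esub> g (x \<oplus>\<^bsub>M\<^esub> y) = f x \<oplus>\<^bsub>N\<^esub> g x \<oplus>\<^bsub>N\<^esub> (f y \<oplus>\<^bsub>N\<^esub> g y)"
      unfolding hom_add[OF f x y] hom_add[OF g x y]
      using cx hom_closed[OF f y] hom_closed[OF g y] by algebra
  }
  fix r assume r: "r \<in> carrier R"
  show "f (r \<odot>\<^bsub>M\<^esub> x) \<oplus>\<^bsub>N\<^esub> g (r \<odot>\<^bsub>M\<^esub> x) = r \<odot>\<^bsub>N\<^esub> (f x \<oplus>\<^bsub>N\<^esub> g x)"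
    unfolding hom_smult[OF f r x] hom_smult[OF g r x] using cx r by algebra
qed

lemma hom_scale:
  assumes "module R N" and f: "f \<in> module_hom R M N" and r: "r \<in> carrier R"
  shows "(\<lambda>x. r \<odot>\<^bsub>N\<^esub> f x) \<in> module_hom R M N"
proof (rule module_homI)
  interpret N: module R N by fact
  fix x assume x: "x \<in> carrier M"
  show "r \<odot>\<^bsub>N\<^esub> f x \<in> carrier N" using hom_closed[OF f x] r by simp
  {
    fix y assume y: "y \<in> carrier M"
    show "r \<odot>\<^bsub>N\<^esub> f (x \<oplus>\<^bsub>M\<^esub> y) = r \<odot>\<^bsub>N\<^esub> f x \<oplus>\<^bsub>N\<^esub> r \<odot>\<^bsub>N\<^esub> f y"
      unfolding hom_add[OF f x y] using hom_closed[OF f x] hom_closed[OF f y] r by algebra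
  }
  fix q assume q: "q \<in> carrier R"
  show "r \<odot>\<^bsub>N\<^esub> f (q \<odot>\<^bsub>M\<^esub> x) = q \<odot>\<^bsub>N\<^esub> (r \<odot>\<^bsub>N\<^esub> f x)"
    unfolding hom_smult[OF f q x] using hom_closed[OF f x] r q by algebra
qed

lemma hom_negate:
  assumes "module R N" and f: "f \<in> module_hom R M N"
  shows "(\<lambda>x. \<ominus>\<^bsub>N\<^esub> f x) \<in> module_hom R M N"
proof -
  interpret N: module R N by fact
  have "(\<lambda>x. \<ominus>\<^bsub>N\<^esub> x) \<in> module_hom R N N"
    by (rule module_homI) (auto simp: N.M.minus_add N.smult_r_minus)
  thus ?thesis by (rule hom_comp[OF f])
qed

lemma hom_diff:
  assumes "module R N" and "f \<in> module_hom R M N" and "g \<in> module_hom R M N"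
  shows "(\<lambda>x. f x \<ominus>\<^bsub>N\<^esub> g x) \<in> module_hom R M N"
  unfolding a_minus_def by (intro hom_plus hom_negate assms)

text \<open>Projectivity in its usual form: \<open>free_selection\<close> for the relation
  \<open>\<delta> y = \<phi> x\<close>.\<close>

corollary free_lift:
  assumes "free_module R F" "module R M" "module R N"
    and "\<delta> \<in> module_hom R M N" "\<phi> \<in> module_hom R F N"
    and "\<And>x. x \<in> carrier F \<Longrightarrow> \<phi> x \<in> \<delta> ` carrier M"
  obtains f where "f \<in> module_hom R F M" "\<And>x. x \<in> carrier F \<Longrightarrow> \<delta> (f x) = \<phi> x"
proof -
  have total: "\<exists>y\<in>carrier M. \<delta> y = \<phi> x" if "x \<in> carrier F" for x
    using assms(6)[OF that] by (metis imageE)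
  obtain f where "f \<in> module_hom R F M" "\<And>x. x \<in> carrier F \<Longrightarrow> \<delta> (f x) = \<phi> x"
    by (rule free_selection[OF assms(1,2) total])
       (use assms(4,5) in \<open>auto simp: hom_add hom_smult\<close>)
  thus thesis using that by blast
qed

section \<open>The ring as a module over itself, and the free modules R^n\<close>

definition self_module :: "('a, 'r) ring_scheme \<Rightarrow> ('a, 'a) module" where
  "self_module R = \<lparr>carrier = carrier R, monoid.mult = monoid.mult R, monoid.one = \<one>\<^bsub>R\<^esub>,
     ring.zero = \<zero>\<^bsub>R\<^esub>, ring.add = ring.add R, smult = monoid.mult R\<rparr>"

lemma self_module_simps [simp]:
  "carrier (self_module R) = carrier R" "x \<oplus>\<^bsub>self_module R\<^esub> y = x \<oplus>\<^bsub>R\<^esub> y"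
  "\<zero>\<^bsub>self_module R\<^esub> = \<zero>\<^bsub>R\<^esub>" "r \<odot>\<^bsub>self_module R\<^esub> x = r \<otimes>\<^bsub>R\<^esub> x"
  by (simp_all add: self_module_def)

lemma (in cring) self_module_abelian_group: "abelian_group (self_module R)"
proof (rule abelian_groupI)
  fix x assume "x \<in> carrier (self_module R)"
  thus "\<exists>y\<in>carrier (self_module R). y \<oplus>\<^bsub>self_module R\<^esub> x = \<zero>\<^bsub>self_module R\<^esub>"
    by (auto intro!: bexI[of _ "\<ominus> x"] simp: l_neg)
qed (auto simp: a_ac)

lemma (in cring) self_module: "module R (self_module R)"
  by (rule moduleI[OF is_cring self_module_abelian_group]) (auto simp: l_distr r_distr m_assoc)

lemma (in cring) self_module_neg:
  assumes "x \<in> carrier R" shows "\<ominus>\<^bsub>self_module R\<^esub> x = \<ominus> x"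
proof -
  interpret S: module R "self_module R" by (rule self_module)
  have "\<ominus> x \<oplus>\<^bsub>self_module R\<^esub> x = \<zero>\<^bsub>self_module R\<^esub>" using assms by (simp add: l_neg)
  thus ?thesis using assms by (intro S.M.minus_equality) simp_all
qed

lemma hom_smult_vec:
  assumes "module R N" and f: "c \<in> module_hom R M (self_module R)" and x: "x \<in> carrier N"
  shows "(\<lambda>y. c y \<odot>\<^bsub>N\<^esub> x) \<in> module_hom R M N"
proof -
  interpret N: module R N by fact
  have "(\<lambda>r. r \<odot>\<^bsub>N\<^esub> x) \<in> module_hom R (self_module R) N"
    by (rule module_homI) (use x in \<open>auto simp: N.smult_l_distr N.smult_assoc1\<close>)
  thus ?thesis by (rule hom_comp[OF f])
qed


text \<open>The free module \<open>R\<^sup>n\<close>, realised by sequences that vanish from index \<open>n\<close> on.\<close>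

definition tuples :: "('a, 'r) ring_scheme \<Rightarrow> nat \<Rightarrow> ('a, nat \<Rightarrow> 'a) module" where
  "tuples R n = \<lparr>carrier = {y. (\<forall>i. y i \<in> carrier R) \<and> (\<forall>i\<ge>n. y i = \<zero>\<^bsub>R\<^esub>)},
     monoid.mult = (\<lambda>y z i. y i \<otimes>\<^bsub>R\<^esub> z i), monoid.one = (\<lambda>i. \<one>\<^bsub>R\<^esub>),
     ring.zero = (\<lambda>i. \<zero>\<^bsub>R\<^esub>), ring.add = (\<lambda>y z i. y i \<oplus>\<^bsub>R\<^esub> z i), smult = (\<lambda>r y i. r \<otimes>\<^bsub>R\<^esub> y i)\<rparr>"

definition unit_tuple :: "('a, 'r) ring_scheme \<Rightarrow> nat \<Rightarrow> nat \<Rightarrow> 'a" where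
  "unit_tuple R n = (\<lambda>i. if i = n then \<one>\<^bsub>R\<^esub> else \<zero>\<^bsub>R\<^esub>)"

definition truncate :: "('a, 'r) ring_scheme \<Rightarrow> nat \<Rightarrow> (nat \<Rightarrow> 'a) \<Rightarrow> nat \<Rightarrow> 'a" where
  "truncate R n y = y(n := \<zero>\<^bsub>R\<^esub>)"

lemma tuples_ops [simp]:
  "y \<oplus>\<^bsub>tuples R n\<^esub> z = (\<lambda>i. y i \<oplus>\<^bsub>R\<^esub> z i)"
  "\<zero>\<^bsub>tuples R n\<^esub> = (\<lambda>i. \<zero>\<^bsub>R\<^esub>)"
  "r \<odot>\<^bsub>tuples R n\<^esub> y = (\<lambda>i. r \<otimes>\<^bsub>R\<^esub> y i)"
  by (simp_all add: tuples_def)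

lemma in_tuples:
  "y \<in> carrier (tuples R n) \<longleftrightarrow> (\<forall>i. y i \<in> carrier R) \<and> (\<forall>i\<ge>n. y i = \<zero>\<^bsub>R\<^esub>)"
  by (simp add: tuples_def)

lemma tuples_nth: "y \<in> carrier (tuples R n) \<Longrightarrow> y i \<in> carrier R"
  by (simp add: in_tuples)

context cring
begin

lemma tuples_abelian_group: "abelian_group (tuples R n)"
proof (rule abelian_groupI)
  fix x assume "x \<in> carrier (tuples R n)"
  thus "\<exists>y\<in>carrier (tuples R n). y \<oplus>\<^bsub>tuples R n\<^esub> x = \<zero>\<^bsub>tuples R n\<^esub>"
    by (auto intro!: bexI[of _ "\<lambda>i. \<ominus> x i"] simp: l_neg in_tuples)
qed (auto simp: a_ac in_tuples)

lemma tuples_module: "module R (tuples R n)"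
  by (rule moduleI[OF is_cring tuples_abelian_group])
     (auto simp: l_distr r_distr m_assoc in_tuples)

lemma unit_tuple_closed: "i < n \<Longrightarrow> unit_tuple R i \<in> carrier (tuples R n)"
  by (auto simp: in_tuples unit_tuple_def)

lemma truncate_closed: "y \<in> carrier (tuples R (Suc n)) \<Longrightarrow> truncate R n y \<in> carrier (tuples R n)"
  by (auto simp: in_tuples truncate_def)

text \<open>This is the gain of encoding tuples as infinite sequences: R^n is literally a subset of
  R^(n+1), and linear maps restrict without an inclusion map.\<close>

lemma tuples_mono: "n \<le> k \<Longrightarrow> carrier (tuples R n) \<subseteq> carrier (tuples R k)"
  by (auto simp: in_tuples)

lemma truncate_decompose:
  "y \<in> carrier (tuples R (Suc n)) \<Longrightarrow>
    y = truncate R n y \<oplus>\<^bsub>tuples R (Suc n)\<^esub> (y n \<odot>\<^bsub>tuples R (Suc n)\<^esub> unit_tuple R n)"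
  by (auto simp: in_tuples truncate_def unit_tuple_def fun_eq_iff)

lemma truncate_add: "truncate R n (\<lambda>i. y i \<oplus> z i) = (\<lambda>i. truncate R n y i \<oplus> truncate R n z i)"
  by (auto simp: truncate_def)

lemma truncate_smult: "r \<in> carrier R \<Longrightarrow> truncate R n (\<lambda>i. r \<otimes> y i) = (\<lambda>i. r \<otimes> truncate R n y i)"
  by (auto simp: truncate_def)

lemma tuples_zero: "carrier (tuples R 0) = {\<lambda>i. \<zero>}"
  by (auto simp: in_tuples)

lemma hom_restrict_tuples:
  "\<lbrakk>f \<in> module_hom R (tuples R k) N; n \<le> k\<rbrakk> \<Longrightarrow> f \<in> module_hom R (tuples R n) N"
  using tuples_mono[of n k] by (auto simp: module_hom_def Pi_iff subset_iff)

text \<open>Splits off the last coordinate. The inductions on the rank of R^n below go through this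
  formula or its alternating analogue \<open>alternating_truncate\<close>.\<close>

lemma hom_truncate:
  assumes "f \<in> module_hom R (tuples R (Suc n)) N" "y \<in> carrier (tuples R (Suc n))"
  shows "f y = f (truncate R n y) \<oplus>\<^bsub>N\<^esub> (y n \<odot>\<^bsub>N\<^esub> f (unit_tuple R n))"
proof -
  interpret T: module R "tuples R (Suc n)" by (rule tuples_module)
  have t: "truncate R n y \<in> carrier (tuples R (Suc n))" "y n \<in> carrier R"
      "unit_tuple R n \<in> carrier (tuples R (Suc n))"
    using truncate_closed[OF assms(2)] tuples_mono[of n "Suc n"] assms(2) unit_tuple_closed[of n "Suc n"]
    by (auto simp: in_tuples)
  show ?thesis
    by (subst truncate_decompose[OF assms(2)])
       (use t assms(1) T.smult_closed in \<open>auto simp: hom_add hom_smult simp del: tuples_ops\<close>)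
qed

text \<open>\<open>H\<close> need only be closed under addition. The terms may lie in
  \<open>H\<close> because of the coefficients alone, or, as at the end of
  \<open>products_detect\<close>, because of coefficients and values together.\<close>

lemma hom_tuples_in:
  assumes "module R N" and f: "f \<in> module_hom R (tuples R n) N"
    and H0: "\<zero>\<^bsub>N\<^esub> \<in> H"
    and H_add: "\<And>x y. \<lbrakk>x \<in> H; y \<in> H\<rbrakk> \<Longrightarrow> x \<oplus>\<^bsub>N\<^esub> y \<in> H"
    and H_smult: "\<And>i. i < n \<Longrightarrow> a i \<odot>\<^bsub>N\<^esub> f (unit_tuple R i) \<in> H"
    and a: "a \<in> carrier (tuples R n)"
  shows "f a \<in> H"
  using f H_smult a
proof (induction n arbitrary: a)
  case 0
  interpret N: module R N by fact
  interpret T: module R "tuples R 0" by (rule tuples_module)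
  have "f \<zero>\<^bsub>tuples R 0\<^esub> = \<zero>\<^bsub>N\<^esub>" by (rule hom_zero[OF T.module_axioms assms(1) 0(1)])
  moreover have "a = \<zero>\<^bsub>tuples R 0\<^esub>" using 0(3) by (auto simp: tuples_zero)
  ultimately show ?case using H0 by simp
next
  case (Suc n)
  have "f (truncate R n a) \<in> H"
  proof (rule Suc.IH)
    show "f \<in> module_hom R (tuples R n) N" by (rule hom_restrict_tuples[OF Suc.prems(1)]) simp
    show "truncate R n a \<in> carrier (tuples R n)" by (rule truncate_closed) fact
    show "truncate R n a i \<odot>\<^bsub>N\<^esub> f (unit_tuple R i) \<in> H" if "i < n" for i
      using Suc.prems(2)[of i] that by (simp add: truncate_def)
  qed
  thus ?case
    unfolding hom_truncate[OF Suc.prems(1,3)] using Suc.prems(2)[of n] H_add by simp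
qed

lemma hom_extend_tuples:
  assumes "module R N" and f: "f \<in> module_hom R (tuples R n) N" and g: "g \<in> carrier N"
  shows "(\<lambda>y. f (truncate R n y) \<oplus>\<^bsub>N\<^esub> (y n \<odot>\<^bsub>N\<^esub> g)) \<in> module_hom R (tuples R (Suc n)) N"
proof (rule module_homI)
  interpret N: module R N by fact
  fix x assume x: "x \<in> carrier (tuples R (Suc n))"
  note tx = truncate_closed[OF x] tuples_nth[OF x, of n]
  show "f (truncate R n x) \<oplus>\<^bsub>N\<^esub> (x n \<odot>\<^bsub>N\<^esub> g) \<in> carrier N"
    using tx f g by (auto simp: hom_closed)
  {
    fix y assume y: "y \<in> carrier (tuples R (Suc n))"
    note ty = truncate_closed[OF y] tuples_nth[OF y, of n]
    have 1: "f (truncate R n (x \<oplus>\<^bsub>tuples R (Suc n)\<^esub> y)) = f (truncate R n x) \<oplus>\<^bsub>N\<^esub> f (truncate R n y)"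
      using hom_add[OF f tx(1) ty(1)] by (simp add: truncate_add)
    show "f (truncate R n (x \<oplus>\<^bsub>tuples R (Suc n)\<^esub> y)) \<oplus>\<^bsub>N\<^esub> ((x \<oplus>\<^bsub>tuples R (Suc n)\<^esub> y) n \<odot>\<^bsub>N\<^esub> g) =
      f (truncate R n x) \<oplus>\<^bsub>N\<^esub> (x n \<odot>\<^bsub>N\<^esub> g) \<oplus>\<^bsub>N\<^esub> (f (truncate R n y) \<oplus>\<^bsub>N\<^esub> (y n \<odot>\<^bsub>N\<^esub> g))"
      unfolding 1 unfolding tuples_ops using hom_closed[OF f tx(1)] hom_closed[OF f ty(1)] tx(2) ty(2) g by algebra
  }
  fix r assume r: "r \<in> carrier R"
  have 2: "f (truncate R n (r \<odot>\<^bsub>tuples R (Suc n)\<^esub> x)) = r \<odot>\<^bsub>N\<^esub> f (truncate R n x)"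
    using hom_smult[OF f r tx(1)] r by (simp add: truncate_smult)
  show "f (truncate R n (r \<odot>\<^bsub>tuples R (Suc n)\<^esub> x)) \<oplus>\<^bsub>N\<^esub> ((r \<odot>\<^bsub>tuples R (Suc n)\<^esub> x) n \<odot>\<^bsub>N\<^esub> g) =
      r \<odot>\<^bsub>N\<^esub> (f (truncate R n x) \<oplus>\<^bsub>N\<^esub> (x n \<odot>\<^bsub>N\<^esub> g))"
    unfolding 2 unfolding tuples_ops using hom_closed[OF f tx(1)] tx(2) g r by algebra
qed

text \<open>Freeness of R^n by induction: each step adds a preimage of the value at one more unit
  tuple. This avoids exhibiting the unit tuples as a basis in the sense of
  \<open>free_module\<close>.\<close>

lemma tuples_lift:
  assumes M: "module R M" and N: "module R N"
    and \<delta>: "\<delta> \<in> module_hom R M N" and "\<phi> \<in> module_hom R (tuples R n) N"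
    and "\<And>y. y \<in> carrier (tuples R n) \<Longrightarrow> \<phi> y \<in> \<delta> ` carrier M"
  shows "\<exists>\<psi>. \<psi> \<in> module_hom R (tuples R n) M \<and> (\<forall>y\<in>carrier (tuples R n). \<delta> (\<psi> y) = \<phi> y)"
  using assms(4,5)
proof (induction n)
  case 0
  interpret M: module R M by fact
  interpret N: module R N by fact
  interpret T: module R "tuples R 0" by (rule tuples_module)
  have "\<phi> (\<lambda>i. \<zero>) = \<zero>\<^bsub>N\<^esub>" using hom_zero[OF T.module_axioms N 0(1)] by simp
  moreover have "\<delta> \<zero>\<^bsub>M\<^esub> = \<zero>\<^bsub>N\<^esub>" by (rule hom_zero[OF M N \<delta>])
  ultimately show ?case
    by (intro exI[of _ "\<lambda>_. \<zero>\<^bsub>M\<^esub>"]) (auto simp: tuples_zero module_hom_def)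
next
  case (Suc n)
  have u: "unit_tuple R n \<in> carrier (tuples R (Suc n))" by (simp add: unit_tuple_closed)
  have \<phi>: "\<phi> \<in> module_hom R (tuples R n) N" by (rule hom_restrict_tuples[OF Suc.prems(1)]) simp
  note mono = subsetD[OF tuples_mono[of n "Suc n"], simplified]
  have "\<exists>\<psi>. \<psi> \<in> module_hom R (tuples R n) M \<and> (\<forall>y\<in>carrier (tuples R n). \<delta> (\<psi> y) = \<phi> y)"
    by (rule Suc.IH[OF \<phi>]) (rule Suc.prems(2)[OF mono])
  then obtain \<psi> where \<psi>: "\<psi> \<in> module_hom R (tuples R n) M" "\<And>y. y \<in> carrier (tuples R n) \<Longrightarrow> \<delta> (\<psi> y) = \<phi> y"
    by (elim exE conjE) blast
  obtain g where g: "g \<in> carrier M" "\<delta> g = \<phi> (unit_tuple R n)"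
    using Suc.prems(2)[OF u] by force
  interpret M: module R M by fact
  show ?case
  proof (intro exI conjI ballI)
    show "(\<lambda>y. \<psi> (truncate R n y) \<oplus>\<^bsub>M\<^esub> (y n \<odot>\<^bsub>M\<^esub> g)) \<in> module_hom R (tuples R (Suc n)) M"
      by (rule hom_extend_tuples[OF M \<psi>(1) g(1)])
    fix y assume y: "y \<in> carrier (tuples R (Suc n))"
    show "\<delta> (\<psi> (truncate R n y) \<oplus>\<^bsub>M\<^esub> (y n \<odot>\<^bsub>M\<^esub> g)) = \<phi> y"
      using truncate_closed[OF y] tuples_nth[OF y, of n] \<psi> g \<delta>
      by (subst hom_truncate[OF Suc.prems(1) y]) (auto simp: hom_add hom_smult hom_closed)
  qed
qed

text \<open>These stand for linear maps on the second exterior power of \<open>F\<close>, which is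
  not constructed. Linearity in the second argument follows from antisymmetry; vanishing on the
  diagonal is a separate condition because 2 may be a zero divisor.\<close>

definition alternating :: "('a, 'x, 'y) module_scheme \<Rightarrow> ('a, 'z, 'w) module_scheme \<Rightarrow> ('x \<Rightarrow> 'x \<Rightarrow> 'z) \<Rightarrow> bool" where
  "alternating F N \<phi> \<longleftrightarrow> (\<forall>z\<in>carrier F. (\<lambda>y. \<phi> y z) \<in> module_hom R F N) \<and>
     (\<forall>y\<in>carrier F. \<forall>z\<in>carrier F. \<phi> y z = \<ominus>\<^bsub>N\<^esub> \<phi> z y) \<and> (\<forall>y\<in>carrier F. \<phi> y y = \<zero>\<^bsub>N\<^esub>)"

lemma alternatingI:
  assumes "\<And>y z. \<lbrakk>y \<in> carrier F; z \<in> carrier F\<rbrakk> \<Longrightarrow> \<phi> y z \<in> carrier N"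
    and "\<And>y y' z. \<lbrakk>y \<in> carrier F; y' \<in> carrier F; z \<in> carrier F\<rbrakk> \<Longrightarrow> \<phi> (y \<oplus>\<^bsub>F\<^esub> y') z = \<phi> y z \<oplus>\<^bsub>N\<^esub> \<phi> y' z"
    and "\<And>r y z. \<lbrakk>r \<in> carrier R; y \<in> carrier F; z \<in> carrier F\<rbrakk> \<Longrightarrow> \<phi> (r \<odot>\<^bsub>F\<^esub> y) z = r \<odot>\<^bsub>N\<^esub> \<phi> y z"
    and "\<And>y z. \<lbrakk>y \<in> carrier F; z \<in> carrier F\<rbrakk> \<Longrightarrow> \<phi> y z = \<ominus>\<^bsub>N\<^esub> \<phi> z y"
    and "\<And>y. y \<in> carrier F \<Longrightarrow> \<phi> y y = \<zero>\<^bsub>N\<^esub>"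
  shows "alternating F N \<phi>"
  unfolding alternating_def
  by (intro conjI ballI module_homI assms)

lemma alternating_hom:
  "\<lbrakk>alternating F N \<phi>; z \<in> carrier F\<rbrakk> \<Longrightarrow> (\<lambda>y. \<phi> y z) \<in> module_hom R F N"
  unfolding alternating_def by (elim conjE bspec)

lemma alternating_anti:
  "\<lbrakk>alternating F N \<phi>; y \<in> carrier F; z \<in> carrier F\<rbrakk> \<Longrightarrow> \<phi> y z = \<ominus>\<^bsub>N\<^esub> \<phi> z y"
  unfolding alternating_def by (elim conjE) (drule (1) bspec, erule (1) bspec)

lemma alternating_diag: "\<lbrakk>alternating F N \<phi>; y \<in> carrier F\<rbrakk> \<Longrightarrow> \<phi> y y = \<zero>\<^bsub>N\<^esub>"
  unfolding alternating_def by (elim conjE bspec)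

lemma alternating_closed:
  "\<lbrakk>alternating F N \<phi>; y \<in> carrier F; z \<in> carrier F\<rbrakk> \<Longrightarrow> \<phi> y z \<in> carrier N"
  using hom_closed[OF alternating_hom] .

lemma alternating_comp:
  assumes N: "module R N" and K: "module R K" and \<phi>: "alternating F N \<phi>" and f: "f \<in> module_hom R N K"
  shows "alternating F K (\<lambda>y z. f (\<phi> y z))"
  unfolding alternating_def
proof (intro conjI ballI)
  fix y z assume y: "y \<in> carrier F" and z: "z \<in> carrier F"
  show "f (\<phi> y z) = \<ominus>\<^bsub>K\<^esub> f (\<phi> z y)"
    using hom_neg[OF N K f alternating_closed[OF \<phi> z y]] alternating_anti[OF \<phi> y z] by simp
next
  fix z assume z: "z \<in> carrier F"
  show "f (\<phi> z z) = \<zero>\<^bsub>K\<^esub>" using hom_zero[OF N K f] alternating_diag[OF \<phi> z] by simp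
  show "(\<lambda>y. f (\<phi> y z)) \<in> module_hom R F K" by (rule hom_comp[OF alternating_hom[OF \<phi> z] f])
qed

lemma alternating_add:
  assumes N: "module R N" and \<phi>: "alternating F N \<phi>" and \<psi>: "alternating F N \<psi>"
  shows "alternating F N (\<lambda>y z. \<phi> y z \<oplus>\<^bsub>N\<^esub> \<psi> y z)"
proof (rule alternatingI)
  interpret N: module R N by fact
  note cl = alternating_closed[OF \<phi>] alternating_closed[OF \<psi>]
  fix y z assume y: "y \<in> carrier F" and z: "z \<in> carrier F"
  note h = alternating_hom[OF \<phi> z] alternating_hom[OF \<psi> z]
  show "\<phi> y z \<oplus>\<^bsub>N\<^esub> \<psi> y z \<in> carrier N" using cl y z by auto
  show "\<phi> y z \<oplus>\<^bsub>N\<^esub> \<psi> y z = \<ominus>\<^bsub>N\<^esub> (\<phi> z y \<oplus>\<^bsub>N\<^esub> \<psi> z y)"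
    unfolding alternating_anti[OF \<phi> y z] alternating_anti[OF \<psi> y z] using cl(1)[OF z y] cl(2)[OF z y] by algebra
  {
    fix y' assume y': "y' \<in> carrier F"
    show "\<phi> (y \<oplus>\<^bsub>F\<^esub> y') z \<oplus>\<^bsub>N\<^esub> \<psi> (y \<oplus>\<^bsub>F\<^esub> y') z = \<phi> y z \<oplus>\<^bsub>N\<^esub> \<psi> y z \<oplus>\<^bsub>N\<^esub> (\<phi> y' z \<oplus>\<^bsub>N\<^esub> \<psi> y' z)"
      unfolding hom_add[OF h(1) y y'] hom_add[OF h(2) y y']
      using cl(1)[OF y z] cl(2)[OF y z] cl(1)[OF y' z] cl(2)[OF y' z] by algebra
  }
  fix r assume r: "r \<in> carrier R"
  show "\<phi> (r \<odot>\<^bsub>F\<^esub> y) z \<oplus>\<^bsub>N\<^esub> \<psi> (r \<odot>\<^bsub>F\<^esub> y) z = r \<odot>\<^bsub>N\<^esub> (\<phi> y z \<oplus>\<^bsub>N\<^esub> \<psi> y z)"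
    unfolding hom_smult[OF h(1) r y] hom_smult[OF h(2) r y]
    using cl(1)[OF y z] cl(2)[OF y z] r by algebra
next
  interpret N: module R N by fact
  fix y assume y: "y \<in> carrier F"
  show "\<phi> y y \<oplus>\<^bsub>N\<^esub> \<psi> y y = \<zero>\<^bsub>N\<^esub>"
    using alternating_diag[OF \<phi> y] alternating_diag[OF \<psi> y] by simp
qed

lemma alternating_neg:
  assumes N: "module R N" and \<phi>: "alternating F N \<phi>"
  shows "alternating F N (\<lambda>y z. \<ominus>\<^bsub>N\<^esub> \<phi> y z)"
proof -
  interpret N: module R N by fact
  have "(\<lambda>x. \<ominus>\<^bsub>N\<^esub> x) \<in> module_hom R N N"
    by (rule module_homI) (auto simp: N.M.minus_add N.smult_r_minus)
  thus ?thesis by (rule alternating_comp[OF N N \<phi>])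
qed

text \<open>The wedge product of a functional and a linear map. For \<open>\<delta>\<close> and
  \<open>t\<close> it is the Koszul differential in degree two.\<close>

lemma alternating_wedge:
  assumes F: "module R F" and N: "module R N"
    and c: "c \<in> module_hom R F (self_module R)" and f: "f \<in> module_hom R F N"
  shows "alternating F N (\<lambda>y z. (c y \<odot>\<^bsub>N\<^esub> f z) \<ominus>\<^bsub>N\<^esub> (c z \<odot>\<^bsub>N\<^esub> f y))"
proof (rule alternatingI)
  interpret N: module R N by fact
  note cc = hom_closed[OF c, simplified] and fc = hom_closed[OF f]
  fix y z assume y: "y \<in> carrier F" and z: "z \<in> carrier F"
  note yz = cc[OF y] cc[OF z] fc[OF y] fc[OF z]
  show "(c y \<odot>\<^bsub>N\<^esub> f z) \<ominus>\<^bsub>N\<^esub> (c z \<odot>\<^bsub>N\<^esub> f y) \<in> carrier N" using yz by simp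
  show "(c y \<odot>\<^bsub>N\<^esub> f z) \<ominus>\<^bsub>N\<^esub> (c z \<odot>\<^bsub>N\<^esub> f y) = \<ominus>\<^bsub>N\<^esub> ((c z \<odot>\<^bsub>N\<^esub> f y) \<ominus>\<^bsub>N\<^esub> (c y \<odot>\<^bsub>N\<^esub> f z))"
    using yz by algebra
  show "(c y \<odot>\<^bsub>N\<^esub> f y) \<ominus>\<^bsub>N\<^esub> (c y \<odot>\<^bsub>N\<^esub> f y) = \<zero>\<^bsub>N\<^esub>" using yz by algebra
  {
    fix y' assume y': "y' \<in> carrier F"
    show "(c (y \<oplus>\<^bsub>F\<^esub> y') \<odot>\<^bsub>N\<^esub> f z) \<ominus>\<^bsub>N\<^esub> (c z \<odot>\<^bsub>N\<^esub> f (y \<oplus>\<^bsub>F\<^esub> y')) =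
      (c y \<odot>\<^bsub>N\<^esub> f z) \<ominus>\<^bsub>N\<^esub> (c z \<odot>\<^bsub>N\<^esub> f y) \<oplus>\<^bsub>N\<^esub> ((c y' \<odot>\<^bsub>N\<^esub> f z) \<ominus>\<^bsub>N\<^esub> (c z \<odot>\<^bsub>N\<^esub> f y'))"
      unfolding hom_add[OF f y y'] hom_add[OF c y y', simplified] using yz cc[OF y'] fc[OF y'] by algebra
  }
  fix r assume r: "r \<in> carrier R"
  show "(c (r \<odot>\<^bsub>F\<^esub> y) \<odot>\<^bsub>N\<^esub> f z) \<ominus>\<^bsub>N\<^esub> (c z \<odot>\<^bsub>N\<^esub> f (r \<odot>\<^bsub>F\<^esub> y)) =
      r \<odot>\<^bsub>N\<^esub> ((c y \<odot>\<^bsub>N\<^esub> f z) \<ominus>\<^bsub>N\<^esub> (c z \<odot>\<^bsub>N\<^esub> f y))"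
    unfolding hom_smult[OF f r y] hom_smult[OF c r y, simplified] using yz r by algebra
qed

text \<open>The splitting of the exterior square of R^(n+1) into that of R^n and the products with
  the last unit tuple. The term in which that unit tuple meets itself drops out by vanishing on the
  diagonal.\<close>

lemma alternating_truncate:
  assumes N: "module R N" and \<phi>: "alternating (tuples R (Suc n)) N \<phi>"
    and y: "y \<in> carrier (tuples R (Suc n))" and z: "z \<in> carrier (tuples R (Suc n))"
  shows "\<phi> y z = \<phi> (truncate R n y) (truncate R n z) \<oplus>\<^bsub>N\<^esub> (z n \<odot>\<^bsub>N\<^esub> \<phi> (truncate R n y) (unit_tuple R n))
     \<ominus>\<^bsub>N\<^esub> (y n \<odot>\<^bsub>N\<^esub> \<phi> (truncate R n z) (unit_tuple R n))"
proof -
  interpret N: module R N by fact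
  let ?u = "unit_tuple R n" and ?y = "truncate R n y" and ?z = "truncate R n z"
  have u: "?u \<in> carrier (tuples R (Suc n))" by (simp add: unit_tuple_closed)
  have y': "?y \<in> carrier (tuples R (Suc n))" and z': "?z \<in> carrier (tuples R (Suc n))"
    using truncate_closed y z tuples_mono[of n "Suc n"] by auto
  have yn: "y n \<in> carrier R" "z n \<in> carrier R" using y z by (auto simp: in_tuples)
  note cl = alternating_closed[OF \<phi>]
  have "\<phi> y z = \<phi> ?y z \<oplus>\<^bsub>N\<^esub> (y n \<odot>\<^bsub>N\<^esub> \<phi> ?u z)"
    using hom_truncate[OF alternating_hom[OF \<phi> z] y] .
  also have "\<phi> ?y z = \<ominus>\<^bsub>N\<^esub> (\<phi> ?z ?y \<oplus>\<^bsub>N\<^esub> (z n \<odot>\<^bsub>N\<^esub> \<phi> ?u ?y))"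
    using alternating_anti[OF \<phi> y' z] hom_truncate[OF alternating_hom[OF \<phi> y'] z] by simp
  also have "\<phi> ?u z = \<ominus>\<^bsub>N\<^esub> (\<phi> ?z ?u \<oplus>\<^bsub>N\<^esub> (z n \<odot>\<^bsub>N\<^esub> \<phi> ?u ?u))"
    using alternating_anti[OF \<phi> u z] hom_truncate[OF alternating_hom[OF \<phi> u] z] by simp
  also have "\<phi> ?u ?u = \<zero>\<^bsub>N\<^esub>" by (rule alternating_diag[OF \<phi> u])
  also have "\<phi> ?u ?y = \<ominus>\<^bsub>N\<^esub> \<phi> ?y ?u" by (rule alternating_anti[OF \<phi> u y'])
  also have "\<phi> ?z ?y = \<ominus>\<^bsub>N\<^esub> \<phi> ?y ?z" by (rule alternating_anti[OF \<phi> z' y'])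
  finally have "\<phi> y z = \<ominus>\<^bsub>N\<^esub> (\<ominus>\<^bsub>N\<^esub> \<phi> ?y ?z \<oplus>\<^bsub>N\<^esub> (z n \<odot>\<^bsub>N\<^esub> (\<ominus>\<^bsub>N\<^esub> \<phi> ?y ?u))) \<oplus>\<^bsub>N\<^esub>
    (y n \<odot>\<^bsub>N\<^esub> (\<ominus>\<^bsub>N\<^esub> (\<phi> ?z ?u \<oplus>\<^bsub>N\<^esub> (z n \<odot>\<^bsub>N\<^esub> \<zero>\<^bsub>N\<^esub>))))" .
  thus ?thesis using cl[OF y' z'] cl[OF y' u] cl[OF z' u] yn by algebra
qed

lemma alternating_restrict:
  assumes \<phi>: "alternating (tuples R (Suc n)) N \<phi>"
  shows "alternating (tuples R n) N \<phi>"
  unfolding alternating_def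
proof (intro conjI ballI)
  note mono = subsetD[OF tuples_mono[of n "Suc n"]]
  fix y z assume y: "y \<in> carrier (tuples R n)" and z: "z \<in> carrier (tuples R n)"
  show "\<phi> y z = \<ominus>\<^bsub>N\<^esub> \<phi> z y" by (rule alternating_anti[OF \<phi>]) (use mono y z in auto)
next
  note mono = subsetD[OF tuples_mono[of n "Suc n"]]
  fix z assume z: "z \<in> carrier (tuples R n)"
  show "\<phi> z z = \<zero>\<^bsub>N\<^esub>" by (rule alternating_diag[OF \<phi>]) (use mono z in auto)
  show "(\<lambda>y. \<phi> y z) \<in> module_hom R (tuples R n) N"
    by (rule hom_restrict_tuples[OF alternating_hom[OF \<phi>]]) (use mono z in auto)
qed

text \<open>Freeness of the exterior square of R^n: by \<open>alternating_truncate\<close> it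
  suffices to lift the restricted form, by induction, and one linear map, by
  \<open>tuples_lift\<close>.\<close>

lemma alternating_lift:
  assumes M: "module R M" and N: "module R N"
    and \<delta>: "\<delta> \<in> module_hom R M N" and "alternating (tuples R n) N \<phi>"
    and "\<And>y z. \<lbrakk>y \<in> carrier (tuples R n); z \<in> carrier (tuples R n)\<rbrakk> \<Longrightarrow> \<phi> y z \<in> \<delta> ` carrier M"
  shows "\<exists>\<psi>. alternating (tuples R n) M \<psi> \<and>
    (\<forall>y\<in>carrier (tuples R n). \<forall>z\<in>carrier (tuples R n). \<delta> (\<psi> y z) = \<phi> y z)"
  using assms(4,5)
proof (induction n)
  case 0
  interpret M: module R M by fact
  interpret N: module R N by fact
  have "\<delta> \<zero>\<^bsub>M\<^esub> = \<zero>\<^bsub>N\<^esub>" by (rule hom_zero[OF M N \<delta>])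
  moreover have "\<phi> (\<lambda>i. \<zero>) (\<lambda>i. \<zero>) = \<zero>\<^bsub>N\<^esub>"
    using alternating_diag[OF 0(1)] by (simp add: tuples_zero)
  ultimately show ?case
    by (intro exI[of _ "\<lambda>_ _. \<zero>\<^bsub>M\<^esub>"]) (auto simp: tuples_zero M.neg_zero intro!: alternatingI)
next
  case (Suc n)
  interpret M: module R M by fact
  interpret N: module R N by fact
  let ?T = "\<lambda>n. carrier (tuples R n)" and ?t = "truncate R n"
  have u: "unit_tuple R n \<in> ?T (Suc n)" by (simp add: unit_tuple_closed)
  note mono = subsetD[OF tuples_mono[of n "Suc n"], simplified]
  have \<phi>: "alternating (tuples R n) N \<phi>" by (rule alternating_restrict[OF Suc.prems(1)])
  have "\<exists>\<psi>. alternating (tuples R n) M \<psi> \<and> (\<forall>y\<in>?T n. \<forall>z\<in>?T n. \<delta> (\<psi> y z) = \<phi> y z)"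
    by (rule Suc.IH[OF \<phi>]) (rule Suc.prems(2)[OF mono mono])
  then obtain \<psi> where \<psi>: "alternating (tuples R n) M \<psi>" "\<And>y z. \<lbrakk>y \<in> ?T n; z \<in> ?T n\<rbrakk> \<Longrightarrow> \<delta> (\<psi> y z) = \<phi> y z"
    by (elim exE conjE) blast
  have "\<exists>l. l \<in> module_hom R (tuples R n) M \<and> (\<forall>y\<in>?T n. \<delta> (l y) = \<phi> y (unit_tuple R n))"
    using hom_restrict_tuples[OF alternating_hom[OF Suc.prems(1) u], of n] Suc.prems(2)[OF mono u]
    by (intro tuples_lift[OF M N \<delta>]) simp_all
  then obtain l where l: "l \<in> module_hom R (tuples R n) M"
      "\<And>y. y \<in> ?T n \<Longrightarrow> \<delta> (l y) = \<phi> y (unit_tuple R n)"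
    by (elim exE conjE) blast
  \<comment> \<open>The right-hand side of \<open>alternating_truncate\<close> with both ingredients
    replaced by their lifts.\<close>
  define \<tau> where "\<tau> y z = \<psi> (?t y) (?t z) \<oplus>\<^bsub>M\<^esub> (z n \<odot>\<^bsub>M\<^esub> l (?t y)) \<ominus>\<^bsub>M\<^esub> (y n \<odot>\<^bsub>M\<^esub> l (?t z))" for y z
  note tc = truncate_closed[of _ n] and nth = tuples_nth[of _ R "Suc n" n]
  note cl = alternating_closed[OF \<psi>(1) tc tc] hom_closed[OF l(1) tc] nth
  show ?case
  proof (intro exI[of _ \<tau>] conjI ballI alternatingI)
    fix y z assume y: "y \<in> ?T (Suc n)" and z: "z \<in> ?T (Suc n)"
    show "\<tau> y z \<in> carrier M" unfolding \<tau>_def using cl y z by auto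
    show "\<tau> y z = \<ominus>\<^bsub>M\<^esub> \<tau> z y"
      unfolding \<tau>_def alternating_anti[OF \<psi>(1) tc[OF y] tc[OF z]]
      using cl(1)[OF z y] cl(2)[OF y] cl(2)[OF z] cl(3)[OF y] cl(3)[OF z] by algebra
    have "\<delta> (\<tau> y z) = \<delta> (\<psi> (?t y) (?t z)) \<oplus>\<^bsub>N\<^esub> (z n \<odot>\<^bsub>N\<^esub> \<delta> (l (?t y))) \<ominus>\<^bsub>N\<^esub> (y n \<odot>\<^bsub>N\<^esub> \<delta> (l (?t z)))"
      unfolding \<tau>_def using cl y z \<delta> by (simp add: hom_minus[OF M N \<delta>] hom_add[OF \<delta>] hom_smult[OF \<delta>])
    also have "\<dots> = \<phi> y z"
      unfolding \<psi>(2)[OF tc[OF y] tc[OF z]] l(2)[OF tc[OF y]] l(2)[OF tc[OF z]]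
      by (rule alternating_truncate[OF N Suc.prems(1) y z, symmetric])
    finally show "\<delta> (\<tau> y z) = \<phi> y z" .
    {
      fix y' assume y': "y' \<in> ?T (Suc n)"
      have "\<psi> (?t (y \<oplus>\<^bsub>tuples R (Suc n)\<^esub> y')) (?t z) = \<psi> (?t y) (?t z) \<oplus>\<^bsub>M\<^esub> \<psi> (?t y') (?t z)"
        using hom_add[OF alternating_hom[OF \<psi>(1) tc[OF z]] tc[OF y] tc[OF y']] by (simp add: truncate_add)
      moreover have "l (?t (y \<oplus>\<^bsub>tuples R (Suc n)\<^esub> y')) = l (?t y) \<oplus>\<^bsub>M\<^esub> l (?t y')"
        using hom_add[OF l(1) tc[OF y] tc[OF y']] by (simp add: truncate_add)
      ultimately show "\<tau> (y \<oplus>\<^bsub>tuples R (Suc n)\<^esub> y') z = \<tau> y z \<oplus>\<^bsub>M\<^esub> \<tau> y' z"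
        unfolding \<tau>_def
        using cl(1)[OF y z] cl(1)[OF y' z] cl(2)[OF y] cl(2)[OF y'] cl(2)[OF z] cl(3)[OF y] cl(3)[OF y'] cl(3)[OF z]
        apply (simp only: tuples_ops) by algebra
    }
    fix r assume r: "r \<in> carrier R"
    have "\<psi> (?t (r \<odot>\<^bsub>tuples R (Suc n)\<^esub> y)) (?t z) = r \<odot>\<^bsub>M\<^esub> \<psi> (?t y) (?t z)"
      using hom_smult[OF alternating_hom[OF \<psi>(1) tc[OF z]] r tc[OF y]] r by (simp add: truncate_smult)
    moreover have "l (?t (r \<odot>\<^bsub>tuples R (Suc n)\<^esub> y)) = r \<odot>\<^bsub>M\<^esub> l (?t y)"
      using hom_smult[OF l(1) r tc[OF y]] r by (simp add: truncate_smult)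
    ultimately show "\<tau> (r \<odot>\<^bsub>tuples R (Suc n)\<^esub> y) z = r \<odot>\<^bsub>M\<^esub> \<tau> y z"
      unfolding \<tau>_def
      using cl(1)[OF y z] cl(2)[OF y] cl(2)[OF z] cl(3)[OF y] cl(3)[OF z] r
      apply (simp only: tuples_ops) by algebra
  next
    fix y assume y: "y \<in> ?T (Suc n)"
    show "\<tau> y y = \<zero>\<^bsub>M\<^esub>" unfolding \<tau>_def alternating_diag[OF \<psi>(1) tc[OF y]]
      using cl(2)[OF y] cl(3)[OF y] by algebra
  qed
qed

end

declare tuples_ops [simp del]

section \<open>A Tate variable in a free resolution\<close>

locale module_complex = cring R for R :: "('a, 'r) ring_scheme" (structure) +
  fixes P :: "int \<Rightarrow> ('a, 'b, 'm) module_scheme" and d :: "int \<Rightarrow> 'b \<Rightarrow> 'b"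
  assumes P_module: "module R (P i)"
    and d_hom: "d i \<in> module_hom R (P i) (P (i - 1))"
    and d_d: "x \<in> carrier (P i) \<Longrightarrow> d (i - 1) (d i x) = \<zero>\<^bsub>P (i - 2)\<^esub>"
begin

sublocale P: module R "P i" for i by (rule P_module)

sublocale S: module R "self_module R" by (rule self_module)

lemma d_closed: "x \<in> carrier (P i) \<Longrightarrow> d i x \<in> carrier (P (i - 1))"
  by (rule hom_closed[OF d_hom])

lemma d_zero: "d i \<zero>\<^bsub>P i\<^esub> = \<zero>\<^bsub>P (i - 1)\<^esub>"
  by (rule hom_zero[OF P_module P_module d_hom])

lemmas hom_P_neg = hom_neg[OF P_module P_module]
  and hom_P_minus = hom_minus[OF P_module P_module]
  and hom_P_zero = hom_zero[OF P_module P_module]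

end

text \<open>
  A resolution of the residue field, with the augmentation lifted to a functional \<open>\<rho>\<close>
  that takes the value \<open>1\<close> at \<open>\<omega>\<close>.
\<close>

locale residue_resolution = module_complex R P d
  for R :: "('a, 'r) ring_scheme" (structure) and P :: "int \<Rightarrow> ('a, 'b, 'm) module_scheme" and d +
  fixes m :: "'a set" and \<rho> :: "'b \<Rightarrow> 'a" and \<omega> :: 'b
  assumes m_ideal: "ideal m R" and one_notin: "\<one> \<notin> m"
    and unit: "\<lbrakk>r \<in> carrier R; r \<notin> m\<rbrakk> \<Longrightarrow> \<exists>s\<in>carrier R. s \<otimes> r = \<one>"
    and \<rho>_hom: "\<rho> \<in> module_hom R (P 0) (self_module R)"
    and \<omega>_closed: "\<omega> \<in> carrier (P 0)" and \<rho>_\<omega>: "\<rho> \<omega> = \<one>"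
    and P_free: "free_module R (P i)"
    and P_neg: "i < 0 \<Longrightarrow> carrier (P i) = {\<zero>\<^bsub>P i\<^esub>}"
    and exact: "\<lbrakk>1 \<le> i; x \<in> carrier (P i); d i x = \<zero>\<^bsub>P (i - 1)\<^esub>\<rbrakk> \<Longrightarrow> \<exists>y\<in>carrier (P (i + 1)). d (i + 1) y = x"
    and exact0: "\<lbrakk>x \<in> carrier (P 0); \<rho> x \<in> m\<rbrakk> \<Longrightarrow> \<exists>y\<in>carrier (P 1). d 1 y = x"
    and \<rho>_d: "y \<in> carrier (P 1) \<Longrightarrow> \<rho> (d 1 y) \<in> m"
begin

sublocale m: ideal m R by (rule m_ideal)

lemmas m_closed' = m.Icarr

lemma \<rho>_closed: "x \<in> carrier (P 0) \<Longrightarrow> \<rho> x \<in> carrier R"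
  using hom_closed[OF \<rho>_hom] by simp

text \<open>An element outside \<open>m\<close> is invertible and can be cancelled. It serves to
  pass from the square of a scalar to the scalar in \<open>f_v\<close>.\<close>

lemma m_prime: "\<lbrakk>r \<in> carrier R; s \<in> carrier R; r \<otimes> s \<in> m\<rbrakk> \<Longrightarrow> r \<in> m \<or> s \<in> m"
proof (rule disjCI)
  assume r: "r \<in> carrier R" and s: "s \<in> carrier R" and rs: "r \<otimes> s \<in> m" and "s \<notin> m"
  then obtain q where q: "q \<in> carrier R" "q \<otimes> s = \<one>" using unit by blast
  have "r = r \<otimes> (q \<otimes> s)" using q r by simp
  also have "\<dots> = (r \<otimes> s) \<otimes> q" using q(1) r s by algebra
  finally have "r = (r \<otimes> s) \<otimes> q" .
  thus "r \<in> m" using m.I_r_closed[OF rs q(1)] by simp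
qed

lemma m_minus: "\<lbrakk>a \<in> m; b \<in> m\<rbrakk> \<Longrightarrow> a \<ominus> b \<in> m"
  unfolding a_minus_def by simp

text \<open>The submodule m P_i + d P_(i+1). For a minimal resolution it is m P_i, but here
  boundaries need not lie in m P_i; with them included, the submodule is stable under chain
  maps.\<close>

inductive_set rad :: "int \<Rightarrow> 'b set" for i where
  rad_smult: "\<lbrakk>r \<in> m; x \<in> carrier (P i)\<rbrakk> \<Longrightarrow> r \<odot>\<^bsub>P i\<^esub> x \<in> rad i"
| rad_d: "z \<in> carrier (P (i + 1)) \<Longrightarrow> d (i + 1) z \<in> rad i"
| rad_add: "\<lbrakk>x \<in> rad i; y \<in> rad i\<rbrakk> \<Longrightarrow> x \<oplus>\<^bsub>P i\<^esub> y \<in> rad i"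

lemma rad_closed: "x \<in> rad i \<Longrightarrow> x \<in> carrier (P i)"
  by (induction rule: rad.induct) (use d_closed[of _ "i + 1"] in auto)

lemma rad_map:
  assumes f: "f \<in> module_hom R (P i) (P j)"
    and fd: "\<And>z. z \<in> carrier (P (i + 1)) \<Longrightarrow> f (d (i + 1) z) \<in> rad j"
    and x: "x \<in> rad i"
  shows "f x \<in> rad j"
  using x
proof (induction rule: rad.induct)
  case (rad_smult r x)
  thus ?case using hom_smult[OF f] hom_closed[OF f] by (simp add: rad.rad_smult)
next
  case (rad_d z)
  thus ?case by (rule fd)
next
  case (rad_add x y)
  thus ?case using hom_add[OF f rad_closed rad_closed] by (simp add: rad.rad_add)
qed

lemma rad_smult_closed: "\<lbrakk>r \<in> carrier R; x \<in> rad i\<rbrakk> \<Longrightarrow> r \<odot>\<^bsub>P i\<^esub> x \<in> rad i"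
proof (rule rad_map[of "\<lambda>x. r \<odot>\<^bsub>P i\<^esub> x" i])
  assume r: "r \<in> carrier R"
  show "(\<lambda>x. r \<odot>\<^bsub>P i\<^esub> x) \<in> module_hom R (P i) (P i)"
    by (rule hom_scale[OF P_module _ r]) (simp add: module_hom_def)
  fix z assume "z \<in> carrier (P (i + 1))"
  thus "r \<odot>\<^bsub>P i\<^esub> d (i + 1) z \<in> rad i"
    using hom_smult[OF d_hom r, of z "i + 1"] rad_d[of "r \<odot>\<^bsub>P (i + 1)\<^esub> z" i] r by simp
qed

lemma rad_zero: "\<zero>\<^bsub>P i\<^esub> \<in> rad i"
  using rad_smult[OF m.zero_closed P.M.zero_closed] by simp

lemma rad_neg: "x \<in> rad i \<Longrightarrow> \<ominus>\<^bsub>P i\<^esub> x \<in> rad i"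
  using rad_smult_closed[of "\<ominus> \<one>" x i] rad_closed[of x i] by (simp add: P.smult_l_minus)

lemma rad_minus: "\<lbrakk>x \<in> rad i; y \<in> rad i\<rbrakk> \<Longrightarrow> x \<ominus>\<^bsub>P i\<^esub> y \<in> rad i"
  unfolding a_minus_def by (intro rad_add rad_neg)

lemma \<rho>_rad: "x \<in> rad 0 \<Longrightarrow> \<rho> x \<in> m"
proof (induction rule: rad.induct)
  case (rad_smult r x)
  thus ?case using hom_smult[OF \<rho>_hom m_closed', of r x] by (simp add: \<rho>_closed m.I_r_closed)
next
  case (rad_d z)
  thus ?case using \<rho>_d by simp
next
  case (rad_add x y)
  thus ?case using hom_add[OF \<rho>_hom rad_closed rad_closed] by simp
qed

text \<open>In degree zero exactness makes m P_0 part of the boundaries, so \<open>rad 0\<close> is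
  the kernel of the augmentation and can be tested with \<open>\<rho>\<close>.\<close>

lemma rad0_iff: "x \<in> carrier (P 0) \<Longrightarrow> x \<in> rad 0 \<longleftrightarrow> \<rho> x \<in> m"
  using exact0[of x] rad_d[of _ 0] \<rho>_rad[of x] by auto

text \<open>The beginning of a contracting homotopy. It splits each element of P_0 linearly into a
  scalar multiple of \<open>\<omega>\<close> and a boundary with a chosen preimage; being linear, it
  can be composed with linear and alternating maps.\<close>

definition \<kappa> :: "'b \<Rightarrow> 'b" where
  "\<kappa> = (SOME \<kappa>. \<kappa> \<in> module_hom R (P 0) (P 1) \<and>
     (\<forall>x\<in>carrier (P 0). d 1 (\<kappa> x) = x \<ominus>\<^bsub>P 0\<^esub> (\<rho> x \<odot>\<^bsub>P 0\<^esub> \<omega>)))"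

text \<open>As \<open>\<rho> \<omega>\<close> is one, x minus its scalar part lies in the kernel of
  \<open>\<rho>\<close> and is a boundary. Since P_0 is free, the preimages can be chosen
  linearly.\<close>

lemma \<kappa>_hom: "\<kappa> \<in> module_hom R (P 0) (P 1)"
  and d_\<kappa>: "x \<in> carrier (P 0) \<Longrightarrow> d 1 (\<kappa> x) = x \<ominus>\<^bsub>P 0\<^esub> (\<rho> x \<odot>\<^bsub>P 0\<^esub> \<omega>)"
proof -
  let ?\<phi> = "\<lambda>x. x \<ominus>\<^bsub>P 0\<^esub> (\<rho> x \<odot>\<^bsub>P 0\<^esub> \<omega>)"
  have \<phi>: "?\<phi> \<in> module_hom R (P 0) (P 0)"
    by (intro hom_diff hom_smult_vec P_module \<rho>_hom \<omega>_closed) (simp add: module_hom_def)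
  have "?\<phi> x \<in> d 1 ` carrier (P 1)" if x: "x \<in> carrier (P 0)" for x
  proof -
    have "\<rho> (?\<phi> x) = \<rho> x \<ominus>\<^bsub>self_module R\<^esub> (\<rho> x \<otimes> \<one>)"
      using x \<rho>_closed[OF x] \<omega>_closed \<rho>_\<omega>
      by (simp add: hom_minus[OF P_module self_module \<rho>_hom] hom_smult[OF \<rho>_hom])
    also have "\<dots> = \<zero>" using \<rho>_closed[OF x] S.sub_eq_zero_iff[of "\<rho> x" "\<rho> x"] by simp
    finally show ?thesis using exact0[OF hom_closed[OF \<phi> x]] by force
  qed
  then obtain f where "f \<in> module_hom R (P 0) (P 1)" "\<And>x. x \<in> carrier (P 0) \<Longrightarrow> d 1 (f x) = ?\<phi> x"
    using free_lift[OF P_free P_module P_module d_hom[of 1, simplified] \<phi>] by metis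
  hence "\<exists>f. f \<in> module_hom R (P 0) (P 1) \<and> (\<forall>x\<in>carrier (P 0). d 1 (f x) = ?\<phi> x)" by blast
  hence *: "\<kappa> \<in> module_hom R (P 0) (P 1) \<and> (\<forall>x\<in>carrier (P 0). d 1 (\<kappa> x) = ?\<phi> x)"
    unfolding \<kappa>_def by (rule someI_ex)
  from * show "\<kappa> \<in> module_hom R (P 0) (P 1)" by blast
  from * show "x \<in> carrier (P 0) \<Longrightarrow> d 1 (\<kappa> x) = ?\<phi> x" by blast
qed

lemma d_\<kappa>': "x \<in> carrier (P 0) \<Longrightarrow> x = d 1 (\<kappa> x) \<oplus>\<^bsub>P 0\<^esub> (\<rho> x \<odot>\<^bsub>P 0\<^esub> \<omega>)"
  unfolding d_\<kappa> using \<rho>_closed[of x] \<omega>_closed by algebra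

end

text \<open>
  \<open>\<delta>\<close> maps \<open>R\<^sup>n\<close> onto \<open>m\<close>; together with \<open>t\<close> and \<open>\<tau>\<close> it maps the beginning of a Koszul complex
  to the resolution.
\<close>

locale koszul = residue_resolution R P d m \<rho> \<omega>
  for R :: "('a, 'r) ring_scheme" (structure) and P :: "int \<Rightarrow> ('a, 'b, 'm) module_scheme" and d m \<rho> \<omega> +
  fixes n :: nat and \<delta> :: "(nat \<Rightarrow> 'a) \<Rightarrow> 'a" and t :: "(nat \<Rightarrow> 'a) \<Rightarrow> 'b" and \<tau> :: "(nat \<Rightarrow> 'a) \<Rightarrow> (nat \<Rightarrow> 'a) \<Rightarrow> 'b"
  assumes \<delta>_hom: "\<delta> \<in> module_hom R (tuples R n) (self_module R)"
    and \<delta>_image: "\<delta> ` carrier (tuples R n) = m"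
    and \<delta>_minimal: "\<lbrakk>y \<in> carrier (tuples R n); \<delta> y = \<zero>\<rbrakk> \<Longrightarrow> y i \<in> m"
    and t_hom: "t \<in> module_hom R (tuples R n) (P 1)"
    and d_t: "y \<in> carrier (tuples R n) \<Longrightarrow> d 1 (t y) = \<delta> y \<odot>\<^bsub>P 0\<^esub> \<omega>"
    and \<tau>_alternating: "alternating (tuples R n) (P 2) \<tau>"
    and d_\<tau>: "\<lbrakk>y \<in> carrier (tuples R n); z \<in> carrier (tuples R n)\<rbrakk> \<Longrightarrow>
      d 2 (\<tau> y z) = (\<delta> y \<odot>\<^bsub>P 1\<^esub> t z) \<ominus>\<^bsub>P 1\<^esub> (\<delta> z \<odot>\<^bsub>P 1\<^esub> t y)"
begin

abbreviation F where "F \<equiv> tuples R n"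

sublocale F: module R F by (rule tuples_module)

lemma \<delta>_closed: "y \<in> carrier F \<Longrightarrow> \<delta> y \<in> carrier R"
  using hom_closed[OF \<delta>_hom] by simp

lemma \<delta>_in: "y \<in> carrier F \<Longrightarrow> \<delta> y \<in> m"
  using \<delta>_image by blast

lemma t_closed: "y \<in> carrier F \<Longrightarrow> t y \<in> carrier (P 1)"
  using hom_closed[OF t_hom] .

lemma \<tau>_closed: "\<lbrakk>y \<in> carrier F; z \<in> carrier F\<rbrakk> \<Longrightarrow> \<tau> y z \<in> carrier (P 2)"
  by (rule alternating_closed[OF \<tau>_alternating])

lemma F_nth: "y \<in> carrier F \<Longrightarrow> y i \<in> carrier R"
  by (rule tuples_nth)

lemma hom_in_rad:
  assumes "f \<in> module_hom R (tuples R k) (P j)" "a \<in> carrier (tuples R k)" "\<And>i. i < k \<Longrightarrow> a i \<in> m"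
  shows "f a \<in> rad j"
  by (rule hom_tuples_in[OF P_module assms(1) rad_zero rad_add _ assms(2)])
     (auto intro!: rad_smult assms hom_closed[OF assms(1)] unit_tuple_closed)

text \<open>The square of \<open>m\<close>, in the form in which it is used: a member comes with a
  coefficient tuple over the generators whose entries lie in \<open>m\<close>.\<close>

definition m2 :: "'a set" where
  "m2 = \<delta> ` {y \<in> carrier F. \<forall>i. y i \<in> m}"

lemma m2E: "r \<in> m2 \<Longrightarrow> (\<And>y. y \<in> carrier F \<Longrightarrow> (\<And>i. y i \<in> m) \<Longrightarrow> \<delta> y = r \<Longrightarrow> thesis) \<Longrightarrow> thesis"
  unfolding m2_def by blast

lemma m2I: "\<lbrakk>y \<in> carrier F; \<And>i. y i \<in> m\<rbrakk> \<Longrightarrow> \<delta> y \<in> m2"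
  unfolding m2_def by blast

lemma m2_subset: "r \<in> m2 \<Longrightarrow> r \<in> m"
  unfolding m2_def using \<delta>_in by blast

lemma m2_zero: "\<zero> \<in> m2"
  using m2I[OF F.M.zero_closed] hom_zero[OF tuples_module self_module \<delta>_hom] by (simp add: tuples_ops)

lemma m2_add: "\<lbrakk>r \<in> m2; s \<in> m2\<rbrakk> \<Longrightarrow> r \<oplus> s \<in> m2"
proof (elim m2E)
  fix y z assume y: "y \<in> carrier F" "\<And>i. y i \<in> m" "\<delta> y = r" and z: "z \<in> carrier F" "\<And>i. z i \<in> m" "\<delta> z = s"
  have "\<delta> (y \<oplus>\<^bsub>F\<^esub> z) \<in> m2" by (rule m2I) (use y z in \<open>auto simp: tuples_ops in_tuples\<close>)
  thus ?thesis using hom_add[OF \<delta>_hom y(1) z(1)] y z by simp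
qed

lemma m2_smult: "\<lbrakk>q \<in> carrier R; r \<in> m2\<rbrakk> \<Longrightarrow> q \<otimes> r \<in> m2"
proof (elim m2E)
  fix y assume q: "q \<in> carrier R" and y: "y \<in> carrier F" "\<And>i. y i \<in> m" "\<delta> y = r"
  have "\<delta> (q \<odot>\<^bsub>F\<^esub> y) \<in> m2" by (rule m2I) (use y q in \<open>auto simp: tuples_ops in_tuples m.I_l_closed\<close>)
  thus ?thesis using hom_smult[OF \<delta>_hom q y(1)] y by simp
qed

text \<open>Write r as \<open>\<delta> y\<close>; the tuple q y has entries in \<open>m\<close>
  whatever y is.\<close>

lemma m2_mult: "\<lbrakk>q \<in> m; r \<in> m\<rbrakk> \<Longrightarrow> q \<otimes> r \<in> m2"
proof -
  assume q: "q \<in> m" and "r \<in> m"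
  then obtain y where y: "y \<in> carrier F" "\<delta> y = r" using \<delta>_image by blast
  have "\<delta> (q \<odot>\<^bsub>F\<^esub> y) \<in> m2"
    by (rule m2I) (use y q m_closed'[OF q] in \<open>auto simp: tuples_ops in_tuples m.I_r_closed\<close>)
  thus ?thesis using hom_smult[OF \<delta>_hom m_closed'[OF q] y(1)] y by simp
qed

lemma hom_in_m2:
  assumes "f \<in> module_hom R (tuples R k) (self_module R)" "a \<in> carrier (tuples R k)" "\<And>i. i < k \<Longrightarrow> a i \<in> m2"
  shows "f a \<in> m2"
proof (rule hom_tuples_in[OF self_module assms(1) _ _ _ assms(2)])
  fix i assume i: "i < k"
  have "f (unit_tuple R i) \<in> carrier R" using hom_closed[OF assms(1) unit_tuple_closed[OF i]] by simp
  thus "a i \<odot>\<^bsub>self_module R\<^esub> f (unit_tuple R i) \<in> m2"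
    using m2_smult[OF _ assms(3)[OF i]] tuples_nth[OF assms(2), of i] m_comm by simp metis
qed (auto simp: m2_zero m2_add)

text \<open>The sum of \<open>C\<^sub>i\<^sub>j (\<delta>(A\<^sub>i) A\<^sub>j - \<delta>(A\<^sub>j) A\<^sub>i)\<close> over \<open>i < j\<close>, where \<open>\<delta>(A\<^sub>i) = a\<^sub>i\<close>, is a Koszul boundary.\<close>

lemma alternating_contraction:
  assumes "alternating (tuples R k) (self_module R) C" "a \<in> carrier (tuples R k)" "\<And>i. i < k \<Longrightarrow> a i \<in> m2"
  shows "\<exists>e w. e \<in> module_hom R (tuples R k) F \<and> w \<in> rad 2 \<and> d 2 w = t (e a) \<and>
     (\<forall>y\<in>carrier (tuples R k). \<delta> (e y) = C y a)"
  using assms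
proof (induction k arbitrary: a)
  case 0
  interpret T: module R "tuples R 0" by (rule tuples_module)
  have "C \<zero>\<^bsub>tuples R 0\<^esub> \<zero>\<^bsub>tuples R 0\<^esub> = \<zero>" using alternating_diag[OF 0(1) T.M.zero_closed] by simp
  moreover have "\<delta> \<zero>\<^bsub>F\<^esub> = \<zero>" using hom_zero[OF tuples_module self_module \<delta>_hom] by simp
  moreover have "t \<zero>\<^bsub>F\<^esub> = \<zero>\<^bsub>P 1\<^esub>" using hom_zero[OF tuples_module P_module t_hom] by simp
  moreover have "(\<lambda>_. \<zero>\<^bsub>F\<^esub>) \<in> module_hom R (tuples R 0) F" by (rule module_homI) auto
  ultimately show ?case
    using 0(2) rad_zero[of 2] d_zero[of 2]
    by (intro exI[of _ "\<lambda>_. \<zero>\<^bsub>F\<^esub>"] exI[of _ "\<zero>\<^bsub>P 2\<^esub>"]) (auto simp: tuples_zero tuples_ops)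
next
  case (Suc k)
  let ?u = "unit_tuple R k" and ?t = "truncate R k"
  have u: "?u \<in> carrier (tuples R (Suc k))" by (simp add: unit_tuple_closed)
  note ta = truncate_closed[OF Suc.prems(2)]
  have Ck: "alternating (tuples R k) (self_module R) C" by (rule alternating_restrict[OF Suc.prems(1)])
  have Cu: "(\<lambda>y. C y ?u) \<in> module_hom R (tuples R k) (self_module R)"
    by (rule hom_restrict_tuples[OF alternating_hom[OF Suc.prems(1) u]]) simp
  have tam2: "?t a i \<in> m2" if "i < k" for i
    using Suc.prems(3)[of i] that by (simp add: truncate_def)
  have IH: "\<exists>e w. e \<in> module_hom R (tuples R k) F \<and> w \<in> rad 2 \<and> d 2 w = t (e (?t a)) \<and>
     (\<forall>y\<in>carrier (tuples R k). \<delta> (e y) = C y (?t a))"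
    by (rule Suc.IH[OF Ck ta]) (rule tam2)
  from IH obtain e w where
    e: "e \<in> module_hom R (tuples R k) F" and w: "w \<in> rad 2" "d 2 w = t (e (?t a))"
    and \<delta>e: "\<And>y. y \<in> carrier (tuples R k) \<Longrightarrow> \<delta> (e y) = C y (?t a)"
    by (elim exE conjE) blast
  \<comment> \<open>Both preimages chosen here, \<open>B\<close> and \<open>A\<close>, have entries
    in \<open>m\<close>; this is what the assumption on \<open>m2\<close> provides.\<close>
  have "C (?t a) ?u \<in> m2" by (rule hom_in_m2[OF Cu ta]) (rule tam2)
  then obtain B where
    B: "B \<in> carrier F" "\<And>i. B i \<in> m" "\<delta> B = C (?t a) ?u" by (rule m2E) simp_all
  from Suc.prems(3)[of k] obtain A where
    A: "A \<in> carrier F" "\<And>i. A i \<in> m" "\<delta> A = a k" by (rule m2E) simp_all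
  have \<delta>B: "\<delta> B \<in> carrier R" and \<delta>A: "\<delta> A \<in> carrier R" by (rule \<delta>_closed[OF B(1)], rule \<delta>_closed[OF A(1)])
  \<comment> \<open>With primes for truncation, \<open>alternating_truncate\<close> gives C(y, a) =
    C(y', a') + a_k C(y', e_k) - y_k C(a', e_k). Replacing a_k by \<open>A\<close> and C(a', e_k) by
    \<open>B\<close> lifts this functional through \<open>\<delta>\<close>.\<close>
  define e' where "e' y = e (?t y) \<oplus>\<^bsub>F\<^esub> (C (?t y) ?u \<odot>\<^bsub>F\<^esub> A) \<oplus>\<^bsub>F\<^esub> (y k \<odot>\<^bsub>F\<^esub> (\<ominus>\<^bsub>F\<^esub> B))" for y
  have Cc: "C (?t y) ?u \<in> carrier R" if "y \<in> carrier (tuples R (Suc k))" for y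
    using hom_closed[OF Cu truncate_closed[OF that]] by simp
  have ec: "e (?t y) \<in> carrier F" if "y \<in> carrier (tuples R (Suc k))" for y
    using hom_closed[OF e truncate_closed[OF that]] .
  have e'_hom: "e' \<in> module_hom R (tuples R (Suc k)) F"
  proof -
    have "(\<lambda>y. e y \<oplus>\<^bsub>F\<^esub> (C y ?u \<odot>\<^bsub>F\<^esub> A)) \<in> module_hom R (tuples R k) F"
      by (intro hom_plus hom_smult_vec tuples_module e Cu A)
    from hom_extend_tuples[OF tuples_module this, of "\<ominus>\<^bsub>F\<^esub> B"] B(1)
    show ?thesis unfolding e'_def by simp
  qed
  have "\<delta> (e' y) = C y a" if y: "y \<in> carrier (tuples R (Suc k))" for y
  proof -
    have yk: "y k \<in> carrier R" by (rule tuples_nth[OF y])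
    have "\<delta> (e' y) = \<delta> (e (?t y)) \<oplus> C (?t y) ?u \<otimes> \<delta> A \<oplus> y k \<otimes> (\<ominus> \<delta> B)"
      unfolding e'_def using A(1) B(1) yk Cc[OF y] ec[OF y]
        hom_neg[OF tuples_module self_module \<delta>_hom B(1)] \<delta>B
      by (simp add: hom_add[OF \<delta>_hom] hom_smult[OF \<delta>_hom] self_module_neg)
    also have "\<delta> (e (?t y)) = C (?t y) (?t a)" by (rule \<delta>e[OF truncate_closed[OF y]])
    finally have 1: "\<delta> (e' y) = C (?t y) (?t a) \<oplus> C (?t y) ?u \<otimes> \<delta> A \<oplus> y k \<otimes> (\<ominus> \<delta> B)" .
    have Caa: "C (?t y) (?t a) \<in> carrier R"
      using alternating_closed[OF Ck truncate_closed[OF y] ta] by simp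
    have "C y a = C (?t y) (?t a) \<oplus> a k \<otimes> C (?t y) ?u \<oplus> \<ominus> (y k \<otimes> C (?t a) ?u)"
      using alternating_truncate[OF self_module Suc.prems(1) y Suc.prems(2)] yk Cc[OF Suc.prems(2)]
      by (simp add: a_minus_def self_module_neg)
    also have "\<dots> = \<delta> (e' y)"
      unfolding 1 A(3)[symmetric] B(3)[symmetric] using Caa Cc[OF y] \<delta>A \<delta>B yk by algebra
    finally show ?thesis ..
  qed
  \<comment> \<open>At y = a the two new terms of \<open>e'\<close> are \<open>\<delta>\<close>(B) A
    - \<open>\<delta>\<close>(A) B, so \<open>t\<close> maps them to the boundary of
    \<open>\<tau> B A\<close>. This element is in \<open>rad 2\<close> because \<open>B\<close> has
    entries in \<open>m\<close>.\<close>
  moreover have "w \<oplus>\<^bsub>P 2\<^esub> \<tau> B A \<in> rad 2"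
  proof (rule rad_add[OF w(1)])
    show "\<tau> B A \<in> rad 2" by (rule hom_in_rad[OF alternating_hom[OF \<tau>_alternating A(1)] B(1,2)])
  qed
  moreover have "d 2 (w \<oplus>\<^bsub>P 2\<^esub> \<tau> B A) = t (e' a)"
  proof -
    note tcs = t_closed[OF A(1)] t_closed[OF B(1)] t_closed[OF ec[OF Suc.prems(2)]]
    have "d 2 (w \<oplus>\<^bsub>P 2\<^esub> \<tau> B A) = t (e (?t a)) \<oplus>\<^bsub>P 1\<^esub> ((\<delta> B \<odot>\<^bsub>P 1\<^esub> t A) \<ominus>\<^bsub>P 1\<^esub> (\<delta> A \<odot>\<^bsub>P 1\<^esub> t B))"
      using w rad_closed[OF w(1)] \<tau>_closed A(1) B(1) d_\<tau> by (simp add: hom_add[OF d_hom[of 2]])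
    also have "\<dots> = t (e (?t a)) \<oplus>\<^bsub>P 1\<^esub> (\<delta> B \<odot>\<^bsub>P 1\<^esub> t A) \<oplus>\<^bsub>P 1\<^esub> (\<delta> A \<odot>\<^bsub>P 1\<^esub> (\<ominus>\<^bsub>P 1\<^esub> t B))"
      using tcs \<delta>A \<delta>B by algebra
    also have "\<dots> = t (e' a)"
      unfolding e'_def A(3)[symmetric] B(3)[symmetric] using A(1) B(1) ec[OF Suc.prems(2)] \<delta>A \<delta>B
      by (simp add: hom_add[OF t_hom] hom_smult[OF t_hom] hom_neg[OF tuples_module P_module t_hom])
    finally show ?thesis .
  qed
  ultimately show ?case using e'_hom by blast
qed

end

section \<open>Comparison of maps into the resolution up to boundaries\<close>

context residue_resolution
begin

lemma exact_diff:
  assumes "1 \<le> i" "x \<in> carrier (P i)" "y \<in> carrier (P i)" "d i x = d i y"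
  shows "\<exists>z\<in>carrier (P (i + 1)). x = y \<oplus>\<^bsub>P i\<^esub> d (i + 1) z"
proof -
  have "d i (x \<ominus>\<^bsub>P i\<^esub> y) = \<zero>\<^bsub>P (i - 1)\<^esub>"
    using assms d_closed[OF assms(2)] d_closed[OF assms(3)]
    by (simp add: hom_P_minus[OF d_hom] P.sub_eq_zero_iff)
  then obtain z where z: "z \<in> carrier (P (i + 1))" "d (i + 1) z = x \<ominus>\<^bsub>P i\<^esub> y"
    using exact[of i "x \<ominus>\<^bsub>P i\<^esub> y"] assms by auto
  have "x = y \<oplus>\<^bsub>P i\<^esub> (x \<ominus>\<^bsub>P i\<^esub> y)" using assms(2,3) by algebra
  thus ?thesis using z by metis
qed

text \<open>The point is that the correction \<open>r\<close> is linear in y: at a tuple with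
  entries in \<open>m\<close> it takes a value in \<open>rad\<close>.\<close>

lemma tuples_lift_diff:
  assumes i: "1 \<le> i" and f: "f \<in> module_hom R (tuples R k) (P i)" and g: "g \<in> module_hom R (tuples R k) (P i)"
    and eq: "\<And>y. y \<in> carrier (tuples R k) \<Longrightarrow> d i (f y) = d i (g y)"
  obtains r where "r \<in> module_hom R (tuples R k) (P (i + 1))"
    "\<And>y. y \<in> carrier (tuples R k) \<Longrightarrow> f y = g y \<oplus>\<^bsub>P i\<^esub> d (i + 1) (r y)"
proof -
  let ?\<phi> = "\<lambda>y. f y \<ominus>\<^bsub>P i\<^esub> g y"
  have \<phi>: "?\<phi> \<in> module_hom R (tuples R k) (P i)" by (intro hom_diff P_module f g)
  have im: "?\<phi> y \<in> d (i + 1) ` carrier (P (i + 1))" if y: "y \<in> carrier (tuples R k)" for y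
  proof -
    obtain z where z: "z \<in> carrier (P (i + 1))" "f y = g y \<oplus>\<^bsub>P i\<^esub> d (i + 1) z"
      using exact_diff[OF i hom_closed[OF f y] hom_closed[OF g y] eq[OF y]] by auto
    have "?\<phi> y = d (i + 1) z"
      unfolding z(2) using hom_closed[OF g y] d_closed[OF z(1), simplified] by algebra
    thus ?thesis using z(1) by blast
  qed
  have dh: "d (i + 1) \<in> module_hom R (P (i + 1)) (P i)" using d_hom[of "i + 1"] by simp
  have "\<exists>r. r \<in> module_hom R (tuples R k) (P (i + 1)) \<and> (\<forall>y\<in>carrier (tuples R k). d (i + 1) (r y) = ?\<phi> y)"
    by (rule tuples_lift[OF P_module P_module dh \<phi>]) (rule im)
  then obtain r where r: "r \<in> module_hom R (tuples R k) (P (i + 1))"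
      "\<And>y. y \<in> carrier (tuples R k) \<Longrightarrow> d (i + 1) (r y) = ?\<phi> y" by (elim exE conjE) blast
  have "f y = g y \<oplus>\<^bsub>P i\<^esub> d (i + 1) (r y)" if y: "y \<in> carrier (tuples R k)" for y
    unfolding r(2)[OF y] using hom_closed[OF f y] hom_closed[OF g y] by algebra
  with r(1) show thesis using that by blast
qed

text \<open>The correction \<open>r\<close> is again alternating, so it disappears when both
  arguments agree.\<close>

lemma alternating_lift_diff:
  assumes i: "1 \<le> i" and f: "alternating (tuples R k) (P i) f" and g: "alternating (tuples R k) (P i) g"
    and eq: "\<And>y z. \<lbrakk>y \<in> carrier (tuples R k); z \<in> carrier (tuples R k)\<rbrakk> \<Longrightarrow> d i (f y z) = d i (g y z)"
  obtains r where "alternating (tuples R k) (P (i + 1)) r"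
    "\<And>y z. \<lbrakk>y \<in> carrier (tuples R k); z \<in> carrier (tuples R k)\<rbrakk> \<Longrightarrow>
      f y z = g y z \<oplus>\<^bsub>P i\<^esub> d (i + 1) (r y z)"
proof -
  let ?\<phi> = "\<lambda>y z. f y z \<oplus>\<^bsub>P i\<^esub> \<ominus>\<^bsub>P i\<^esub> g y z" and ?T = "carrier (tuples R k)"
  have \<phi>: "alternating (tuples R k) (P i) ?\<phi>" by (intro alternating_add alternating_neg P_module f g)
  note fc = alternating_closed[OF f] and gc = alternating_closed[OF g]
  have im: "?\<phi> y y' \<in> d (i + 1) ` carrier (P (i + 1))" if y: "y \<in> ?T" "y' \<in> ?T" for y y'
  proof -
    obtain z where z: "z \<in> carrier (P (i + 1))" "f y y' = g y y' \<oplus>\<^bsub>P i\<^esub> d (i + 1) z"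
      using exact_diff[OF i fc[OF y] gc[OF y] eq[OF y]] by auto
    have "?\<phi> y y' = d (i + 1) z"
      unfolding z(2) using gc[OF y] d_closed[OF z(1), simplified] by algebra
    thus ?thesis using z(1) by blast
  qed
  have dh: "d (i + 1) \<in> module_hom R (P (i + 1)) (P i)" using d_hom[of "i + 1"] by simp
  have "\<exists>r. alternating (tuples R k) (P (i + 1)) r \<and> (\<forall>y\<in>?T. \<forall>z\<in>?T. d (i + 1) (r y z) = ?\<phi> y z)"
    by (rule alternating_lift[OF P_module P_module dh \<phi>]) (rule im)
  then obtain r where r: "alternating (tuples R k) (P (i + 1)) r"
      "\<And>y z. \<lbrakk>y \<in> ?T; z \<in> ?T\<rbrakk> \<Longrightarrow> d (i + 1) (r y z) = ?\<phi> y z" by (elim exE conjE) blast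
  have "f y z = g y z \<oplus>\<^bsub>P i\<^esub> d (i + 1) (r y z)" if y: "y \<in> ?T" "z \<in> ?T" for y z
    unfolding r(2)[OF y] using fc[OF y] gc[OF y] by algebra
  with r(1) show thesis using that by blast
qed

end

context koszul
begin

text \<open>Here entries in m^2 rather than in m pay off: \<open>b\<close> has entries in
  \<open>m\<close>, and linear maps into the resolution send it into \<open>rad\<close>.\<close>

lemma \<delta>_in_m2:
  assumes "f \<in> module_hom R F (self_module R)" "a \<in> carrier F" "\<And>i. a i \<in> m2"
  obtains b where "b \<in> carrier F" "\<And>i. b i \<in> m" "\<delta> b = f a"
proof -
  have "f a \<in> m2" by (rule hom_in_m2[OF assms(1,2)]) (rule assms(3))
  thus thesis using that by (rule m2E)
qed

end

text \<open>
  The elements \<open>u y\<close> and \<open>v\<close> play the roles of the products \<open>y s\<close> and of the divided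
  square of \<open>s\<close>.
\<close>

locale tate_variable = koszul R P d m \<rho> \<omega> n \<delta> t \<tau>
  for R :: "('a, 'r) ring_scheme" (structure) and P :: "int \<Rightarrow> ('a, 'b, 'm) module_scheme" and d m \<rho> \<omega> n \<delta> t \<tau> +
  fixes s :: 'b and a :: "nat \<Rightarrow> 'a" and u :: "(nat \<Rightarrow> 'a) \<Rightarrow> 'b" and v :: 'b
  assumes s_closed: "s \<in> carrier (P 2)" and a_closed: "a \<in> carrier F"
    and d_s: "d 2 s = t a" and a_in_m2: "a i \<in> m2"
    and u_hom: "u \<in> module_hom R F (P 3)"
    and d_u: "y \<in> carrier F \<Longrightarrow> d 3 (u y) = (\<delta> y \<odot>\<^bsub>P 2\<^esub> s) \<ominus>\<^bsub>P 2\<^esub> \<tau> y a"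
    and v_closed: "v \<in> carrier (P 4)" and d_v: "d 4 v = u a"
begin

lemma a_in_m: "a i \<in> m"
  using m2_subset[OF a_in_m2] .

text \<open>Apply \<open>\<rho>\<close> to d d s, which is \<open>\<delta>\<close>(a) times
  \<open>\<omega>\<close>.\<close>

lemma \<delta>_a: "\<delta> a = \<zero>"
proof -
  have "\<zero>\<^bsub>P 0\<^esub> = d 1 (d 2 s)" using d_d[OF s_closed] by simp
  also have "\<dots> = \<delta> a \<odot>\<^bsub>P 0\<^esub> \<omega>" unfolding d_s by (rule d_t[OF a_closed])
  finally have "\<rho> \<zero>\<^bsub>P 0\<^esub> = \<delta> a \<otimes> \<rho> \<omega>"
    using hom_smult[OF \<rho>_hom \<delta>_closed[OF a_closed] \<omega>_closed] by simp
  thus ?thesis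
    using hom_zero[OF P_module self_module \<rho>_hom] \<delta>_closed[OF a_closed] \<rho>_\<omega> by simp
qed

lemma u_closed: "y \<in> carrier F \<Longrightarrow> u y \<in> carrier (P 3)"
  by (rule hom_closed[OF u_hom])

end

section \<open>A chain map of degree one, evaluated at the divided square\<close>

locale degree_one = koszul R P d m \<rho> \<omega> n \<delta> t \<tau>
  for R :: "('a, 'r) ring_scheme" (structure) and P :: "int \<Rightarrow> ('a, 'b, 'm) module_scheme" and d m \<rho> \<omega> n \<delta> t \<tau> +
  fixes h :: "int \<Rightarrow> 'b \<Rightarrow> 'b"
  assumes h_hom: "h i \<in> module_hom R (P i) (P (i - 1))"
    and d_h: "x \<in> carrier (P i) \<Longrightarrow> d (i - 1) (h i x) = \<ominus>\<^bsub>P (i - 2)\<^esub> h (i - 1) (d i x)"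
begin

lemma h_closed: "x \<in> carrier (P i) \<Longrightarrow> h i x \<in> carrier (P (i - 1))"
  by (rule hom_closed[OF h_hom])

text \<open>The scalar part of \<open>h 1 (t y)\<close>, that is, the functional on tuples induced
  by the class of \<open>h\<close>; \<open>p\<close> records a preimage of the boundary
  part.\<close>

definition c where "c y = \<rho> (h 1 (t y))"
definition p where "p y = \<kappa> (h 1 (t y))"

lemma ht_hom: "(\<lambda>y. h 1 (t y)) \<in> module_hom R F (P 0)"
  using hom_comp[OF t_hom h_hom[of 1, simplified]] .

lemma c_hom: "c \<in> module_hom R F (self_module R)"
  unfolding c_def by (rule hom_comp[OF ht_hom \<rho>_hom])

lemma p_hom: "p \<in> module_hom R F (P 1)"
  unfolding p_def by (rule hom_comp[OF ht_hom \<kappa>_hom])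

lemma c_closed: "y \<in> carrier F \<Longrightarrow> c y \<in> carrier R"
  using hom_closed[OF c_hom] by simp

lemma p_closed: "y \<in> carrier F \<Longrightarrow> p y \<in> carrier (P 1)"
  by (rule hom_closed[OF p_hom])

lemma h_t: "y \<in> carrier F \<Longrightarrow> h 1 (t y) = d 1 (p y) \<oplus>\<^bsub>P 0\<^esub> (c y \<odot>\<^bsub>P 0\<^esub> \<omega>)"
  unfolding p_def c_def by (rule d_\<kappa>') (rule hom_closed[OF ht_hom])

text \<open>The boundary of \<open>h 2 s\<close> is - h(t a), whose scalar part - c(a)
  \<open>\<omega>\<close> is the boundary of - t(b) and whose remaining part is the boundary of -
  p(a).\<close>

lemma h2_lift:
  assumes s: "s \<in> carrier (P 2)" and a: "a \<in> carrier F" and ds: "d 2 s = t a"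
    and b: "b \<in> carrier F" and \<delta>b: "\<delta> b = c a"
  shows "\<exists>q\<in>carrier (P 2). h 2 s = (\<ominus>\<^bsub>P 1\<^esub> t b \<ominus>\<^bsub>P 1\<^esub> p a) \<oplus>\<^bsub>P 1\<^esub> d 2 q"
proof -
  note cl = t_closed[OF b] p_closed[OF a] h_closed[OF s, simplified] d_closed[OF p_closed[OF a], simplified]
    \<delta>_closed[OF b] \<omega>_closed
  have "d 1 (h 2 s) = \<ominus>\<^bsub>P 0\<^esub> h 1 (t a)" using d_h[OF s] ds by simp
  also have "\<dots> = \<ominus>\<^bsub>P 0\<^esub> (\<delta> b \<odot>\<^bsub>P 0\<^esub> \<omega>) \<ominus>\<^bsub>P 0\<^esub> d 1 (p a)"
    unfolding h_t[OF a] \<delta>b[symmetric] using cl by algebra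
  also have "\<dots> = d 1 (\<ominus>\<^bsub>P 1\<^esub> t b \<ominus>\<^bsub>P 1\<^esub> p a)"
    using cl d_t[OF b] hom_P_neg[OF d_hom[of 1]] hom_P_minus[OF d_hom[of 1]] by simp
  finally have "d 1 (h 2 s) = d 1 (\<ominus>\<^bsub>P 1\<^esub> t b \<ominus>\<^bsub>P 1\<^esub> p a)" .
  from exact_diff[OF _ _ _ this] cl show ?thesis by simp
qed

end

locale tate_degree_one = degree_one + tate_variable
begin

text \<open>In the presence of products \<open>h\<close> would be a derivation up to sign, with h(v)
  the product of s and h(s), hence essentially - u(b) with b in m F. The proof recovers this
  successively on \<open>\<tau>\<close>, on \<open>u\<close> and on \<open>v\<close>, up to
  corrections that are harmless at a.\<close>

lemma h_v: "h 4 v \<in> rad 3"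
proof -
  obtain b where b: "b \<in> carrier F" "\<And>i. b i \<in> m" "\<delta> b = c a"
    using \<delta>_in_m2[OF c_hom a_closed a_in_m2] by blast
  obtain q where q: "q \<in> carrier (P 2)" "h 2 s = (\<ominus>\<^bsub>P 1\<^esub> t b \<ominus>\<^bsub>P 1\<^esub> p a) \<oplus>\<^bsub>P 1\<^esub> d 2 q"
    using h2_lift[OF s_closed a_closed d_s b(1,3)] by blast
  note dq = d_closed[OF q(1), simplified]
  \<comment> \<open>The expected value of \<open>h\<close> on the product of y and z is c(y) z -
    c(z) y. The wedge of \<open>\<delta>\<close> and \<open>p\<close> corrects for h(t y) being c(y)
    \<open>\<omega>\<close> only up to the boundary of p(y).\<close>
  let ?W = "\<lambda>c f y z. (c y \<odot>\<^bsub>P 1\<^esub> f z) \<ominus>\<^bsub>P 1\<^esub> (c z \<odot>\<^bsub>P 1\<^esub> f y)"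
  let ?g = "\<lambda>y z. ?W c t y z \<oplus>\<^bsub>P 1\<^esub> \<ominus>\<^bsub>P 1\<^esub> ?W \<delta> p y z"
  have f: "alternating F (P 1) (\<lambda>y z. h 2 (\<tau> y z))"
    using alternating_comp[OF P_module P_module \<tau>_alternating h_hom[of 2]] by simp
  have g: "alternating F (P 1) ?g"
    by (intro alternating_add alternating_neg alternating_wedge P_module tuples_module c_hom t_hom \<delta>_hom p_hom)
  have "d 1 (h 2 (\<tau> y z)) = d 1 (?g y z)" if y: "y \<in> carrier F" and z: "z \<in> carrier F" for y z
  proof -
    note cl = t_closed[OF y] t_closed[OF z] p_closed[OF y] p_closed[OF z]
      d_closed[OF p_closed[OF y], simplified] d_closed[OF p_closed[OF z], simplified]
      \<delta>_closed[OF y] \<delta>_closed[OF z] c_closed[OF y] c_closed[OF z] \<omega>_closed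
    have "d 1 (h 2 (\<tau> y z)) = \<ominus>\<^bsub>P 0\<^esub> h 1 ((\<delta> y \<odot>\<^bsub>P 1\<^esub> t z) \<ominus>\<^bsub>P 1\<^esub> (\<delta> z \<odot>\<^bsub>P 1\<^esub> t y))"
      using d_h[OF \<tau>_closed[OF y z]] d_\<tau>[OF y z] by simp
    also have "\<dots> = \<ominus>\<^bsub>P 0\<^esub> ((\<delta> y \<odot>\<^bsub>P 0\<^esub> (d 1 (p z) \<oplus>\<^bsub>P 0\<^esub> (c z \<odot>\<^bsub>P 0\<^esub> \<omega>))) \<ominus>\<^bsub>P 0\<^esub>
        (\<delta> z \<odot>\<^bsub>P 0\<^esub> (d 1 (p y) \<oplus>\<^bsub>P 0\<^esub> (c y \<odot>\<^bsub>P 0\<^esub> \<omega>))))"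
      using cl hom_P_minus[OF h_hom[of 1]] hom_smult[OF h_hom[of 1]] h_t[OF y] h_t[OF z] by simp
    also have "\<dots> = (c y \<odot>\<^bsub>P 0\<^esub> (\<delta> z \<odot>\<^bsub>P 0\<^esub> \<omega>)) \<ominus>\<^bsub>P 0\<^esub> (c z \<odot>\<^bsub>P 0\<^esub> (\<delta> y \<odot>\<^bsub>P 0\<^esub> \<omega>)) \<oplus>\<^bsub>P 0\<^esub>
        \<ominus>\<^bsub>P 0\<^esub> ((\<delta> y \<odot>\<^bsub>P 0\<^esub> d 1 (p z)) \<ominus>\<^bsub>P 0\<^esub> (\<delta> z \<odot>\<^bsub>P 0\<^esub> d 1 (p y)))"
      using cl by algebra
    also have "\<dots> = d 1 (?g y z)"
      using cl hom_P_minus[OF d_hom[of 1]] hom_smult[OF d_hom[of 1]] hom_add[OF d_hom[of 1]]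
        hom_P_neg[OF d_hom[of 1]] d_t[OF y] d_t[OF z] by simp
    finally show ?thesis .
  qed
  then obtain q2 where q2: "alternating F (P 2) q2"
    "\<And>y z. \<lbrakk>y \<in> carrier F; z \<in> carrier F\<rbrakk> \<Longrightarrow> h 2 (\<tau> y z) = ?g y z \<oplus>\<^bsub>P 1\<^esub> d 2 (q2 y z)"
    using alternating_lift_diff[OF _ f g] by auto
  \<comment> \<open>The expected value of \<open>h\<close> on the product of y and s is c(y) s - y
    h(s); the part - t(b) of h(s) contributes \<open>\<tau> y b\<close>. The terms with
    \<open>q\<close> and \<open>q2\<close> account for the boundary terms in h(s) and in
    h(\<open>\<tau> y a\<close>).\<close>
  let ?k = "\<lambda>y. \<tau> y b \<oplus>\<^bsub>P 2\<^esub> (c y \<odot>\<^bsub>P 2\<^esub> s) \<ominus>\<^bsub>P 2\<^esub> (\<delta> y \<odot>\<^bsub>P 2\<^esub> q) \<oplus>\<^bsub>P 2\<^esub> q2 y a"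
  have k: "?k \<in> module_hom R F (P 2)"
    by (intro hom_plus hom_diff hom_smult_vec P_module alternating_hom[OF \<tau>_alternating b(1)]
        c_hom s_closed \<delta>_hom q(1) alternating_hom[OF q2(1) a_closed])
  have hu: "(\<lambda>y. h 3 (u y)) \<in> module_hom R F (P 2)"
    using hom_comp[OF u_hom h_hom[of 3]] by simp
  have "d 2 (h 3 (u y)) = d 2 (?k y)" if y: "y \<in> carrier F" for y
  proof -
    note q2c = alternating_closed[OF q2(1) y a_closed]
    note cl = t_closed[OF y] t_closed[OF b(1)] t_closed[OF a_closed] p_closed[OF y] p_closed[OF a_closed]
      \<delta>_closed[OF y] \<delta>_closed[OF b(1)] c_closed[OF y] s_closed dq q(1) \<tau>_closed[OF y b(1)] \<tau>_closed[OF y a_closed]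
      q2c d_closed[OF q2c, simplified]
    have "d 2 (h 3 (u y)) = \<ominus>\<^bsub>P 1\<^esub> h 2 ((\<delta> y \<odot>\<^bsub>P 2\<^esub> s) \<ominus>\<^bsub>P 2\<^esub> \<tau> y a)"
      using d_h[OF u_closed[OF y]] d_u[OF y] by simp
    also have "\<dots> = \<ominus>\<^bsub>P 1\<^esub> ((\<delta> y \<odot>\<^bsub>P 1\<^esub> ((\<ominus>\<^bsub>P 1\<^esub> t b \<ominus>\<^bsub>P 1\<^esub> p a) \<oplus>\<^bsub>P 1\<^esub> d 2 q)) \<ominus>\<^bsub>P 1\<^esub>
        (((c y \<odot>\<^bsub>P 1\<^esub> t a) \<ominus>\<^bsub>P 1\<^esub> (\<delta> b \<odot>\<^bsub>P 1\<^esub> t y)) \<oplus>\<^bsub>P 1\<^esub>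
          \<ominus>\<^bsub>P 1\<^esub> ((\<delta> y \<odot>\<^bsub>P 1\<^esub> p a) \<ominus>\<^bsub>P 1\<^esub> (\<zero> \<odot>\<^bsub>P 1\<^esub> p y)) \<oplus>\<^bsub>P 1\<^esub> d 2 (q2 y a)))"
      using cl hom_P_minus[OF h_hom[of 2]] hom_smult[OF h_hom[of 2]] q(2) q2(2)[OF y a_closed] \<delta>_a b(3) by simp
    also have "\<dots> = ((\<delta> y \<odot>\<^bsub>P 1\<^esub> t b) \<ominus>\<^bsub>P 1\<^esub> (\<delta> b \<odot>\<^bsub>P 1\<^esub> t y)) \<oplus>\<^bsub>P 1\<^esub> (c y \<odot>\<^bsub>P 1\<^esub> t a) \<ominus>\<^bsub>P 1\<^esub>
        (\<delta> y \<odot>\<^bsub>P 1\<^esub> d 2 q) \<oplus>\<^bsub>P 1\<^esub> d 2 (q2 y a)"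
      using cl by algebra
    also have "\<dots> = d 2 (?k y)"
      using cl hom_P_minus[OF d_hom[of 2]] hom_smult[OF d_hom[of 2]] hom_add[OF d_hom[of 2]]
        d_\<tau>[OF y b(1)] d_s by simp
    finally show ?thesis .
  qed
  then obtain r where r: "r \<in> module_hom R F (P 3)" "\<And>y. y \<in> carrier F \<Longrightarrow> h 3 (u y) = ?k y \<oplus>\<^bsub>P 2\<^esub> d 3 (r y)"
    using tuples_lift_diff[OF _ hu k] by auto
  note ra = hom_closed[OF r(1) a_closed]
  note cl = ra d_closed[OF ra, simplified] u_closed[OF b(1)] \<tau>_closed[OF b(1) a_closed] s_closed q(1)
    \<delta>_closed[OF b(1)] h_closed[OF v_closed, simplified]
  \<comment> \<open>At y = a the term with \<open>q\<close> vanishes because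
    \<open>\<delta>\<close>(a) = 0, and the one with \<open>q2\<close> because it is alternating. As
    c(a) = \<open>\<delta>\<close>(b), what remains is the boundary of u(b) + r(a).\<close>
  have "d 3 (h 4 v) = \<ominus>\<^bsub>P 2\<^esub> h 3 (u a)" using d_h[OF v_closed] d_v by simp
  also have "\<dots> = \<ominus>\<^bsub>P 2\<^esub> ((\<ominus>\<^bsub>P 2\<^esub> \<tau> b a) \<oplus>\<^bsub>P 2\<^esub> (\<delta> b \<odot>\<^bsub>P 2\<^esub> s) \<ominus>\<^bsub>P 2\<^esub> (\<zero> \<odot>\<^bsub>P 2\<^esub> q) \<oplus>\<^bsub>P 2\<^esub> \<zero>\<^bsub>P 2\<^esub> \<oplus>\<^bsub>P 2\<^esub> d 3 (r a))"
    unfolding r(2)[OF a_closed] b(3)[symmetric] \<delta>_a alternating_diag[OF q2(1) a_closed]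
    by (simp add: alternating_anti[OF \<tau>_alternating a_closed b(1)])
  also have "\<dots> = \<ominus>\<^bsub>P 2\<^esub> ((\<delta> b \<odot>\<^bsub>P 2\<^esub> s) \<ominus>\<^bsub>P 2\<^esub> \<tau> b a) \<ominus>\<^bsub>P 2\<^esub> d 3 (r a)"
    using cl by algebra
  also have "\<dots> = d 3 (\<ominus>\<^bsub>P 3\<^esub> u b \<ominus>\<^bsub>P 3\<^esub> r a)"
    using cl d_u[OF b(1)] hom_P_minus[OF d_hom[of 3]] hom_P_neg[OF d_hom[of 3]] by simp
  finally have "d 3 (h 4 v) = d 3 (\<ominus>\<^bsub>P 3\<^esub> u b \<ominus>\<^bsub>P 3\<^esub> r a)" .
  then obtain z where "z \<in> carrier (P 4)" "h 4 v = (\<ominus>\<^bsub>P 3\<^esub> u b \<ominus>\<^bsub>P 3\<^esub> r a) \<oplus>\<^bsub>P 3\<^esub> d 4 z"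
    using exact_diff[of 3 "h 4 v" "\<ominus>\<^bsub>P 3\<^esub> u b \<ominus>\<^bsub>P 3\<^esub> r a"] cl by auto
  moreover have "u b \<in> rad 3" by (rule hom_in_rad[OF u_hom b(1,2)])
  moreover have "r a \<in> rad 3" by (rule hom_in_rad[OF r(1) a_closed a_in_m])
  ultimately show ?thesis using rad_d[of z 3] by (auto intro!: rad_add rad_minus rad_neg)
qed

end

section \<open>A chain map of degree two, evaluated at the divided square\<close>

locale tate_degree_two = tate_variable +
  fixes f
  assumes f_hom: "f i \<in> module_hom R (P i) (P (i - 2))"
    and d_f: "x \<in> carrier (P i) \<Longrightarrow> d (i - 2) (f i x) = f (i - 1) (d i x)"
begin

lemma f_closed: "x \<in> carrier (P i) \<Longrightarrow> f i x \<in> carrier (P (i - 2))"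
  by (rule hom_closed[OF f_hom])

text \<open>With k = \<open>\<rho> (f 2 s)\<close>, the aim is f(v) = k s modulo
  \<open>rad 2\<close>. Applying \<open>f\<close> once more yields k^2 modulo m, and m is
  prime.\<close>

lemma f_v:
  assumes "\<rho> (f 2 (f 4 v)) \<in> m"
  shows "\<rho> (f 2 s) \<in> m"
proof -
  let ?k = "\<rho> (f 2 s)" and ?p = "\<kappa> (f 2 s)"
  note fs = f_closed[OF s_closed, simplified]
  have kp: "f 2 s = d 1 ?p \<oplus>\<^bsub>P 0\<^esub> (?k \<odot>\<^bsub>P 0\<^esub> \<omega>)" by (rule d_\<kappa>'[OF fs])
  have k: "?k \<in> carrier R" by (rule \<rho>_closed[OF fs])
  have p: "?p \<in> carrier (P 1)" by (rule hom_closed[OF \<kappa>_hom fs])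
  have f\<tau>: "alternating F (P 0) (\<lambda>y z. f 2 (\<tau> y z))"
    using alternating_comp[OF P_module P_module \<tau>_alternating f_hom[of 2]] by simp
  let ?C = "\<lambda>y z. \<rho> (f 2 (\<tau> y z))" and ?p2 = "\<lambda>y z. \<kappa> (f 2 (\<tau> y z))"
  have C: "alternating F (self_module R) ?C" by (rule alternating_comp[OF P_module self_module f\<tau> \<rho>_hom])
  have p2: "alternating F (P 1) ?p2" by (rule alternating_comp[OF P_module P_module f\<tau> \<kappa>_hom])
  \<comment> \<open>\<open>f\<close> need not vanish on the Koszul products \<open>\<tau>\<close>;
    its scalar part there is the alternating form \<open>?C\<close>. The contraction lifts C(y, a)
    through \<open>\<delta>\<close> in such a way that the contribution at y = a is the boundary of
    an element \<open>w\<close> of \<open>rad 2\<close>.\<close>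
  have "\<exists>e w. e \<in> module_hom R F F \<and> w \<in> rad 2 \<and> d 2 w = t (e a) \<and> (\<forall>y\<in>carrier F. \<delta> (e y) = ?C y a)"
    by (rule alternating_contraction[OF C a_closed a_in_m2])
  then obtain e w where e: "e \<in> module_hom R F F" and w: "w \<in> rad 2" "d 2 w = t (e a)"
      and \<delta>e: "\<And>y. y \<in> carrier F \<Longrightarrow> \<delta> (e y) = ?C y a"
    by (elim exE conjE) blast
  \<comment> \<open>The boundary of u(y) is \<open>\<delta>\<close>(y) s -
    \<open>\<tau> y a\<close>. The scalar parts of the two images under \<open>f\<close> are lifted
    by k t(y) and t(e(y)), the boundary parts by the terms with \<open>?p\<close> and
    \<open>?p2\<close>.\<close>
  let ?l = "\<lambda>y. (?k \<odot>\<^bsub>P 1\<^esub> t y) \<ominus>\<^bsub>P 1\<^esub> t (e y) \<oplus>\<^bsub>P 1\<^esub> (\<delta> y \<odot>\<^bsub>P 1\<^esub> ?p) \<ominus>\<^bsub>P 1\<^esub> ?p2 y a"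
  have l: "?l \<in> module_hom R F (P 1)"
    by (intro hom_plus hom_diff hom_scale hom_smult_vec P_module t_hom hom_comp[OF e t_hom] \<delta>_hom p k
        alternating_hom[OF p2 a_closed])
  have fu: "(\<lambda>y. f 3 (u y)) \<in> module_hom R F (P 1)" using hom_comp[OF u_hom f_hom[of 3]] by simp
  have "d 1 (f 3 (u y)) = d 1 (?l y)" if y: "y \<in> carrier F" for y
  proof -
    note p2c = alternating_closed[OF p2 y a_closed]
    note ey = hom_closed[OF e y]
    note cl = t_closed[OF y] t_closed[OF ey] p k p2c d_closed[OF p2c, simplified] d_closed[OF p, simplified]
      \<delta>_closed[OF y] \<delta>_closed[OF ey] \<omega>_closed \<tau>_closed[OF y a_closed] s_closed
    have "f 2 (\<tau> y a) = d 1 (?p2 y a) \<oplus>\<^bsub>P 0\<^esub> (\<delta> (e y) \<odot>\<^bsub>P 0\<^esub> \<omega>)"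
      unfolding \<delta>e[OF y] by (rule d_\<kappa>'[OF alternating_closed[OF f\<tau> y a_closed]])
    moreover have "d 1 (f 3 (u y)) = f 2 ((\<delta> y \<odot>\<^bsub>P 2\<^esub> s) \<ominus>\<^bsub>P 2\<^esub> \<tau> y a)"
      using d_f[OF u_closed[OF y]] d_u[OF y] by simp
    moreover have "\<dots> = (\<delta> y \<odot>\<^bsub>P 0\<^esub> f 2 s) \<ominus>\<^bsub>P 0\<^esub> f 2 (\<tau> y a)"
      using cl hom_P_minus[OF f_hom[of 2]] hom_smult[OF f_hom[of 2]] by simp
    ultimately have "d 1 (f 3 (u y)) = (\<delta> y \<odot>\<^bsub>P 0\<^esub> (d 1 ?p \<oplus>\<^bsub>P 0\<^esub> (?k \<odot>\<^bsub>P 0\<^esub> \<omega>))) \<ominus>\<^bsub>P 0\<^esub>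
        (d 1 (?p2 y a) \<oplus>\<^bsub>P 0\<^esub> (\<delta> (e y) \<odot>\<^bsub>P 0\<^esub> \<omega>))"
      using kp by simp
    also have "\<dots> = (?k \<odot>\<^bsub>P 0\<^esub> (\<delta> y \<odot>\<^bsub>P 0\<^esub> \<omega>)) \<ominus>\<^bsub>P 0\<^esub> (\<delta> (e y) \<odot>\<^bsub>P 0\<^esub> \<omega>) \<oplus>\<^bsub>P 0\<^esub> (\<delta> y \<odot>\<^bsub>P 0\<^esub> d 1 ?p) \<ominus>\<^bsub>P 0\<^esub> d 1 (?p2 y a)"
      using cl by algebra
    also have "\<dots> = d 1 (?l y)"
      using cl hom_P_minus[OF d_hom[of 1]] hom_smult[OF d_hom[of 1]] hom_add[OF d_hom[of 1]]
        d_t[OF y] d_t[OF ey] by simp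
    finally show ?thesis .
  qed
  then obtain q where q: "q \<in> module_hom R F (P 2)" "\<And>y. y \<in> carrier F \<Longrightarrow> f 3 (u y) = ?l y \<oplus>\<^bsub>P 1\<^esub> d 2 (q y)"
    using tuples_lift_diff[OF _ fu l] by auto
  note qa = hom_closed[OF q(1) a_closed] and wc = rad_closed[OF w(1)] and ea = hom_closed[OF e a_closed]
  note cl = qa d_closed[OF qa, simplified] t_closed[OF a_closed] t_closed[OF ea] p k s_closed wc
    f_closed[OF v_closed, simplified]
  \<comment> \<open>At y = a the terms with \<open>?p\<close> and \<open>?p2\<close> vanish, t(a) is
    the boundary of s and t(e(a)) that of \<open>w\<close>.\<close>
  have "d 2 (f 4 v) = f 3 (u a)" using d_f[OF v_closed] d_v by simp
  also have "\<dots> = (?k \<odot>\<^bsub>P 1\<^esub> t a) \<ominus>\<^bsub>P 1\<^esub> t (e a) \<oplus>\<^bsub>P 1\<^esub> (\<zero> \<odot>\<^bsub>P 1\<^esub> ?p) \<ominus>\<^bsub>P 1\<^esub> \<zero>\<^bsub>P 1\<^esub> \<oplus>\<^bsub>P 1\<^esub> d 2 (q a)"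
    unfolding q(2)[OF a_closed] \<delta>_a alternating_diag[OF p2 a_closed] ..
  also have "\<dots> = (?k \<odot>\<^bsub>P 1\<^esub> t a) \<ominus>\<^bsub>P 1\<^esub> t (e a) \<oplus>\<^bsub>P 1\<^esub> d 2 (q a)"
    using cl by algebra
  also have "\<dots> = d 2 ((?k \<odot>\<^bsub>P 2\<^esub> s) \<ominus>\<^bsub>P 2\<^esub> w \<oplus>\<^bsub>P 2\<^esub> q a)"
    using cl hom_P_minus[OF d_hom[of 2]] hom_smult[OF d_hom[of 2]] hom_add[OF d_hom[of 2]] d_s w(2) by simp
  finally have "d 2 (f 4 v) = d 2 ((?k \<odot>\<^bsub>P 2\<^esub> s) \<ominus>\<^bsub>P 2\<^esub> w \<oplus>\<^bsub>P 2\<^esub> q a)" .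
  then obtain z where z: "z \<in> carrier (P 3)" "f 4 v = ((?k \<odot>\<^bsub>P 2\<^esub> s) \<ominus>\<^bsub>P 2\<^esub> w \<oplus>\<^bsub>P 2\<^esub> q a) \<oplus>\<^bsub>P 2\<^esub> d 3 z"
    using exact_diff[of 2 "f 4 v" "(?k \<odot>\<^bsub>P 2\<^esub> s) \<ominus>\<^bsub>P 2\<^esub> w \<oplus>\<^bsub>P 2\<^esub> q a"] cl by auto
  note dz = d_closed[OF z(1), simplified]
  have "q a \<in> rad 2" by (rule hom_in_rad[OF q(1) a_closed a_in_m])
  hence x: "q a \<ominus>\<^bsub>P 2\<^esub> w \<oplus>\<^bsub>P 2\<^esub> d 3 z \<in> rad 2"
    using w(1) rad_d[of z 2] z(1) by (auto intro!: rad_add rad_minus)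
  have "f 4 v = (?k \<odot>\<^bsub>P 2\<^esub> s) \<oplus>\<^bsub>P 2\<^esub> (q a \<ominus>\<^bsub>P 2\<^esub> w \<oplus>\<^bsub>P 2\<^esub> d 3 z)"
    unfolding z(2) using cl dz by algebra
  hence "f 2 (f 4 v) = (?k \<odot>\<^bsub>P 0\<^esub> f 2 s) \<oplus>\<^bsub>P 0\<^esub> f 2 (q a \<ominus>\<^bsub>P 2\<^esub> w \<oplus>\<^bsub>P 2\<^esub> d 3 z)"
    using cl rad_closed[OF x] hom_smult[OF f_hom[of 2]] hom_add[OF f_hom[of 2]] by simp
  moreover have fx: "f 2 (q a \<ominus>\<^bsub>P 2\<^esub> w \<oplus>\<^bsub>P 2\<^esub> d 3 z) \<in> rad 0"
  proof (rule rad_map[OF _ _ x])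
    show "f 2 \<in> module_hom R (P 2) (P 0)" using f_hom[of 2] by simp
    fix z assume "z \<in> carrier (P (2 + 1))"
    thus "f 2 (d (2 + 1) z) \<in> rad 0"
      using d_f[of z 3] rad_d[of "f 3 z" 0] f_closed[of z 3] by simp
  qed
  ultimately have "\<rho> (f 2 (f 4 v)) = ?k \<otimes> ?k \<oplus> \<rho> (f 2 (q a \<ominus>\<^bsub>P 2\<^esub> w \<oplus>\<^bsub>P 2\<^esub> d 3 z))"
    using fs k rad_closed[OF fx] hom_smult[OF \<rho>_hom] hom_add[OF \<rho>_hom] by simp
  moreover have "\<rho> (f 2 (q a \<ominus>\<^bsub>P 2\<^esub> w \<oplus>\<^bsub>P 2\<^esub> d 3 z)) \<in> m" by (rule \<rho>_rad[OF fx])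
  ultimately have "?k \<otimes> ?k = \<rho> (f 2 (f 4 v)) \<ominus> \<rho> (f 2 (q a \<ominus>\<^bsub>P 2\<^esub> w \<oplus>\<^bsub>P 2\<^esub> d 3 z))"
      and "\<rho> (f 2 (q a \<ominus>\<^bsub>P 2\<^esub> w \<oplus>\<^bsub>P 2\<^esub> d 3 z)) \<in> m"
    using k m_closed' by (auto simp: a_minus_def a_assoc r_neg)
  hence "?k \<otimes> ?k \<in> m" using assms m_minus by simp
  thus ?thesis using m_prime[OF k k] by blast
qed

end

section \<open>The endomorphism complex\<close>

context module_complex
begin

abbreviation E where "E \<equiv> end_complex R P"

text \<open>The sign (-1)^n as a scalar: it merges the two cases of \<open>end_diff\<close> into one
  formula and lets \<open>algebra\<close> handle signs.\<close>

definition parity :: "int \<Rightarrow> 'a" where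
  "parity n = (if even n then \<one> else \<ominus> \<one>)"

lemma parity_closed [simp]: "parity n \<in> carrier R"
  by (simp add: parity_def)

lemma parity_pred: "parity (n - 1) = \<ominus> parity n"
  by (auto simp: parity_def)

lemma parity_sq: "parity n \<otimes> parity n = \<one>"
  by (auto simp: parity_def l_minus)

definition degrees :: "(int \<Rightarrow> int \<Rightarrow> 'b \<Rightarrow> 'b) \<Rightarrow> int set" where
  "degrees f = {n. \<exists>i. \<exists>x\<in>carrier (P i). f n i x \<noteq> \<zero>\<^bsub>P (i - n)\<^esub>}"

lemma in_E: "f \<in> carrier E \<longleftrightarrow>
    (\<forall>n i. f n i \<in> module_hom R (P i) (P (i - n)) \<and> f n i \<in> extensional (carrier (P i))) \<and> finite (degrees f)"
  by (simp add: end_complex_def degrees_def)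

lemma E_hom: "f \<in> carrier E \<Longrightarrow> j = i - n \<Longrightarrow> f n i \<in> module_hom R (P i) (P j)"
  by (simp add: in_E)

lemma E_closed: "\<lbrakk>f \<in> carrier E; x \<in> carrier (P i); j = i - n\<rbrakk> \<Longrightarrow> f n i x \<in> carrier (P j)"
  by (rule hom_closed[OF E_hom])

lemma E_closed' [simp]: "\<lbrakk>f \<in> carrier E; x \<in> carrier (P i)\<rbrakk> \<Longrightarrow> f n i x \<in> carrier (P (i - n))"
  by (rule E_closed) simp_all

lemma E_finite: "f \<in> carrier E \<Longrightarrow> finite (degrees f)"
  by (simp add: in_E)

lemma notin_degrees: "\<lbrakk>n \<notin> degrees f; x \<in> carrier (P i)\<rbrakk> \<Longrightarrow> f n i x = \<zero>\<^bsub>P (i - n)\<^esub>"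
  by (auto simp: degrees_def)

lemma E_I:
  assumes "\<And>n i. f n i \<in> module_hom R (P i) (P (i - n))"
    and "\<And>n i. f n i \<in> extensional (carrier (P i))"
    and "finite D" "\<And>n i x. \<lbrakk>n \<notin> D; x \<in> carrier (P i)\<rbrakk> \<Longrightarrow> f n i x = \<zero>\<^bsub>P (i - n)\<^esub>"
  shows "f \<in> carrier E"
proof -
  have "degrees f \<subseteq> D" using assms(4) by (auto simp: degrees_def)
  thus ?thesis using assms(1-3) finite_subset by (auto simp: in_E)
qed

lemma E_ext:
  assumes f: "f \<in> carrier E" and g: "g \<in> carrier E"
    and eq: "\<And>n i x. x \<in> carrier (P i) \<Longrightarrow> f n i x = g n i x"
  shows "f = g"
proof (intro ext)
  fix n i x
  show "f n i x = g n i x"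
  proof (cases "x \<in> carrier (P i)")
    case False
    hence "f n i x = undefined" "g n i x = undefined"
      using f g by (auto simp: in_E extensional_def)
    thus ?thesis by simp
  qed (rule eq)
qed

lemma hom_restrict:
  assumes "f \<in> module_hom R (P i) N"
  shows "(\<lambda>x\<in>carrier (P i). f x) \<in> module_hom R (P i) N"
  by (rule hom_cong[OF assms P_module]) simp

lemma E_add: "(f \<oplus>\<^bsub>E\<^esub> g) n i = (\<lambda>x\<in>carrier (P i). f n i x \<oplus>\<^bsub>P (i - n)\<^esub> g n i x)"
  and E_zero: "\<zero>\<^bsub>E\<^esub> n i = (\<lambda>x\<in>carrier (P i). \<zero>\<^bsub>P (i - n)\<^esub>)"
  and E_one: "\<one>\<^bsub>E\<^esub> n i = (\<lambda>x\<in>carrier (P i). if n = 0 then x else \<zero>\<^bsub>P (i - n)\<^esub>)"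
  and E_smult: "(r \<odot>\<^bsub>E\<^esub> f) n i = (\<lambda>x\<in>carrier (P i). r \<odot>\<^bsub>P (i - n)\<^esub> f n i x)"
  by (simp_all add: end_complex_def)

lemma E_add_app [simp]: "x \<in> carrier (P i) \<Longrightarrow> (f \<oplus>\<^bsub>E\<^esub> g) n i x = f n i x \<oplus>\<^bsub>P (i - n)\<^esub> g n i x"
  and E_zero_app [simp]: "x \<in> carrier (P i) \<Longrightarrow> \<zero>\<^bsub>E\<^esub> n i x = \<zero>\<^bsub>P (i - n)\<^esub>"
  and E_one_app: "x \<in> carrier (P i) \<Longrightarrow> \<one>\<^bsub>E\<^esub> n i x = (if n = 0 then x else \<zero>\<^bsub>P (i - n)\<^esub>)"
  and E_smult_app [simp]: "x \<in> carrier (P i) \<Longrightarrow> (r \<odot>\<^bsub>E\<^esub> f) n i x = r \<odot>\<^bsub>P (i - n)\<^esub> f n i x"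
  by (simp_all add: E_add E_zero E_one E_smult)

lemma zero_hom: "(\<lambda>_. \<zero>\<^bsub>P j\<^esub>) \<in> module_hom R (P i) (P j)"
  by (rule module_homI) simp_all

lemma E_zero_closed: "\<zero>\<^bsub>E\<^esub> \<in> carrier E"
  by (rule E_I[where D = "{}"]) (auto simp: E_zero intro!: hom_restrict zero_hom)

lemma E_one_closed: "\<one>\<^bsub>E\<^esub> \<in> carrier E"
proof (rule E_I[where D = "{0}"])
  fix n i
  have "(\<lambda>x. x) \<in> module_hom R (P i) (P i)" by (simp add: module_hom_def)
  thus "\<one>\<^bsub>E\<^esub> n i \<in> module_hom R (P i) (P (i - n))"
    unfolding E_one by (intro hom_restrict) (cases "n = 0"; simp add: zero_hom)
qed (auto simp: E_one)

lemma E_add_closed: "\<lbrakk>f \<in> carrier E; g \<in> carrier E\<rbrakk> \<Longrightarrow> f \<oplus>\<^bsub>E\<^esub> g \<in> carrier E"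
proof (rule E_I[where D = "degrees f \<union> degrees g"])
  fix n i assume f: "f \<in> carrier E" and g: "g \<in> carrier E"
  show "(f \<oplus>\<^bsub>E\<^esub> g) n i \<in> module_hom R (P i) (P (i - n))"
    unfolding E_add by (intro hom_restrict hom_plus P_module E_hom f g refl)
qed (auto simp: E_add E_finite notin_degrees)

lemma E_smult_closed: "\<lbrakk>r \<in> carrier R; f \<in> carrier E\<rbrakk> \<Longrightarrow> r \<odot>\<^bsub>E\<^esub> f \<in> carrier E"
proof (rule E_I[where D = "degrees f"])
  fix n i assume r: "r \<in> carrier R" and f: "f \<in> carrier E"
  show "(r \<odot>\<^bsub>E\<^esub> f) n i \<in> module_hom R (P i) (P (i - n))"
    unfolding E_smult by (intro hom_restrict hom_scale P_module E_hom f r refl)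
qed (auto simp: E_smult E_finite notin_degrees)

lemma E_abelian_group: "abelian_group E"
proof (rule abelian_groupI)
  fix f g h assume f: "f \<in> carrier E" and g: "g \<in> carrier E" and h: "h \<in> carrier E"
  show "f \<oplus>\<^bsub>E\<^esub> g \<oplus>\<^bsub>E\<^esub> h = f \<oplus>\<^bsub>E\<^esub> (g \<oplus>\<^bsub>E\<^esub> h)"
    by (rule E_ext) (use f g h in \<open>auto simp: P.M.a_assoc intro!: E_add_closed\<close>)
  show "f \<oplus>\<^bsub>E\<^esub> g = g \<oplus>\<^bsub>E\<^esub> f"
    by (rule E_ext) (use f g in \<open>auto simp: P.M.a_comm intro!: E_add_closed\<close>)
  show "\<zero>\<^bsub>E\<^esub> \<oplus>\<^bsub>E\<^esub> f = f"
    by (rule E_ext) (use f in \<open>auto intro!: E_add_closed E_zero_closed\<close>)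
  have "(\<ominus> \<one>) \<odot>\<^bsub>E\<^esub> f \<oplus>\<^bsub>E\<^esub> f = \<zero>\<^bsub>E\<^esub>"
    by (rule E_ext)
       (use f in \<open>auto simp: P.smult_l_minus P.M.l_neg intro!: E_add_closed E_zero_closed E_smult_closed\<close>)
  thus "\<exists>g\<in>carrier E. g \<oplus>\<^bsub>E\<^esub> f = \<zero>\<^bsub>E\<^esub>" using E_smult_closed[OF _ f, of "\<ominus> \<one>"] by auto
qed (auto intro: E_add_closed E_zero_closed)

lemma E_module: "module R E"
proof (rule moduleI[OF is_cring E_abelian_group])
  fix r s f g assume r: "r \<in> carrier R" and s: "s \<in> carrier R" and f: "f \<in> carrier E" and g: "g \<in> carrier E"
  show "r \<odot>\<^bsub>E\<^esub> f \<in> carrier E" using r f by (rule E_smult_closed)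
  show "(r \<oplus> s) \<odot>\<^bsub>E\<^esub> f = r \<odot>\<^bsub>E\<^esub> f \<oplus>\<^bsub>E\<^esub> s \<odot>\<^bsub>E\<^esub> f"
    by (rule E_ext) (use r s f in \<open>auto simp: P.smult_l_distr intro!: E_add_closed E_smult_closed\<close>)
  show "r \<odot>\<^bsub>E\<^esub> (f \<oplus>\<^bsub>E\<^esub> g) = r \<odot>\<^bsub>E\<^esub> f \<oplus>\<^bsub>E\<^esub> r \<odot>\<^bsub>E\<^esub> g"
    by (rule E_ext) (use r g f in \<open>auto simp: P.smult_r_distr intro!: E_add_closed E_smult_closed\<close>)
  show "(r \<otimes> s) \<odot>\<^bsub>E\<^esub> f = r \<odot>\<^bsub>E\<^esub> (s \<odot>\<^bsub>E\<^esub> f)"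
    by (rule E_ext) (use r s f in \<open>auto simp: P.smult_assoc1 intro!: E_add_closed E_smult_closed\<close>)
next
  fix f assume f: "f \<in> carrier E"
  show "\<one> \<odot>\<^bsub>E\<^esub> f = f"
    by (rule E_ext) (use f in \<open>auto intro!: E_smult_closed\<close>)
qed

sublocale EM: module R E by (rule E_module)

lemma E_neg_app [simp]:
  assumes "f \<in> carrier E" "x \<in> carrier (P i)"
  shows "(\<ominus>\<^bsub>E\<^esub> f) n i x = \<ominus>\<^bsub>P (i - n)\<^esub> f n i x"
proof -
  have "\<ominus>\<^bsub>E\<^esub> f = (\<ominus> \<one>) \<odot>\<^bsub>E\<^esub> f" using assms(1) by (simp add: EM.smult_l_minus)
  thus ?thesis using assms by (simp add: P.smult_l_minus)
qed

lemma E_minus_app [simp]: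
  "\<lbrakk>f \<in> carrier E; g \<in> carrier E; x \<in> carrier (P i)\<rbrakk> \<Longrightarrow> (f \<ominus>\<^bsub>E\<^esub> g) n i x = f n i x \<ominus>\<^bsub>P (i - n)\<^esub> g n i x"
  by (simp add: a_minus_def)


section \<open>The differential and the product of the endomorphism complex\<close>

abbreviation \<Delta> where "\<Delta> \<equiv> end_diff P d"

lemma d_hom': "j = i - 1 \<Longrightarrow> d i \<in> module_hom R (P i) (P j)"
  using d_hom by simp

lemma \<Delta>_app:
  assumes f: "f \<in> carrier E" and x: "x \<in> carrier (P i)"
  shows "\<Delta> f n i x = d (i - n + 1) (f (n - 1) i x) \<oplus>\<^bsub>P (i - n)\<^esub> (parity n \<odot>\<^bsub>P (i - n)\<^esub> f (n - 1) (i - 1) (d i x))"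
proof -
  have "f (n - 1) (i - 1) (d i x) \<in> carrier (P (i - n))" by (rule E_closed[OF f d_closed[OF x]]) simp
  thus ?thesis using x by (simp add: end_diff_def parity_def a_minus_def P.smult_l_minus)
qed

lemma \<Delta>_closed:
  assumes f: "f \<in> carrier E"
  shows "\<Delta> f \<in> carrier E"
proof (rule E_I[where D = "(\<lambda>n. n + 1) ` degrees f"])
  fix n i
  have "(\<lambda>x. d (i - n + 1) (f (n - 1) i x) \<oplus>\<^bsub>P (i - n)\<^esub> (parity n \<odot>\<^bsub>P (i - n)\<^esub> f (n - 1) (i - 1) (d i x)))
      \<in> module_hom R (P i) (P (i - n))"
  proof (intro hom_plus hom_scale P_module parity_closed)
    show "(\<lambda>x. d (i - n + 1) (f (n - 1) i x)) \<in> module_hom R (P i) (P (i - n))"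
      by (rule hom_comp[OF E_hom[OF f] d_hom']) simp_all
    show "(\<lambda>x. f (n - 1) (i - 1) (d i x)) \<in> module_hom R (P i) (P (i - n))"
      by (rule hom_comp[OF d_hom E_hom[OF f]]) simp
  qed
  from this P_module show "\<Delta> f n i \<in> module_hom R (P i) (P (i - n))"
    by (rule hom_cong) (simp add: \<Delta>_app[OF f])
  show "\<Delta> f n i \<in> extensional (carrier (P i))" by (simp add: end_diff_def)
next
  fix n i x assume n: "n \<notin> (\<lambda>n. n + 1) ` degrees f" and x: "x \<in> carrier (P i)"
  have n': "n - 1 \<notin> degrees f" using n by (rule contrapos_nn) (rule image_eqI[rotated], assumption, presburger)
  have "f (n - 1) i x = \<zero>\<^bsub>P (i - (n - 1))\<^esub>" "f (n - 1) (i - 1) (d i x) = \<zero>\<^bsub>P (i - 1 - (n - 1))\<^esub>"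
    by (rule notin_degrees[OF n' x], rule notin_degrees[OF n' d_closed[OF x]])
  thus "\<Delta> f n i x = \<zero>\<^bsub>P (i - n)\<^esub>"
    using d_zero[of "i - n + 1"] by (simp add: \<Delta>_app[OF f x] algebra_simps)
qed (simp add: E_finite[OF f])

lemma \<Delta>_hom: "\<Delta> \<in> module_hom R E E"
proof (rule module_homI)
  fix f g r assume f: "f \<in> carrier E"
  show "\<Delta> f \<in> carrier E" by (rule \<Delta>_closed[OF f])
  {
    assume g: "g \<in> carrier E"
    show "\<Delta> (f \<oplus>\<^bsub>E\<^esub> g) = \<Delta> f \<oplus>\<^bsub>E\<^esub> \<Delta> g"
    proof (rule E_ext)
      fix n i x assume x: "x \<in> carrier (P i)"
      have dh: "d (i - n + 1) \<in> module_hom R (P (i - (n - 1))) (P (i - n))"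
        using d_hom[of "i - n + 1"] by (simp add: algebra_simps)
      note cl = E_closed[OF f d_closed[OF x], of "i - n" "n - 1"] E_closed[OF g d_closed[OF x], of "i - n" "n - 1"]
        hom_closed[OF dh E_closed'[OF f x]] hom_closed[OF dh E_closed'[OF g x]]
      have "\<Delta> (f \<oplus>\<^bsub>E\<^esub> g) n i x =
        d (i - n + 1) (f (n - 1) i x) \<oplus>\<^bsub>P (i - n)\<^esub> d (i - n + 1) (g (n - 1) i x) \<oplus>\<^bsub>P (i - n)\<^esub>
        (parity n \<odot>\<^bsub>P (i - n)\<^esub> (f (n - 1) (i - 1) (d i x) \<oplus>\<^bsub>P (i - n)\<^esub> g (n - 1) (i - 1) (d i x)))"
        using x f g d_closed[OF x] hom_add[OF dh] by (simp add: \<Delta>_app E_add_closed)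
      also have "\<dots> = (\<Delta> f \<oplus>\<^bsub>E\<^esub> \<Delta> g) n i x"
        unfolding E_add_app[OF x] \<Delta>_app[OF f x] \<Delta>_app[OF g x]
        using cl[simplified] parity_closed[of n] by algebra
      finally show "\<Delta> (f \<oplus>\<^bsub>E\<^esub> g) n i x = (\<Delta> f \<oplus>\<^bsub>E\<^esub> \<Delta> g) n i x" .
    qed (use f g in \<open>auto intro!: \<Delta>_closed\<close>)
  }
  assume r: "r \<in> carrier R"
  show "\<Delta> (r \<odot>\<^bsub>E\<^esub> f) = r \<odot>\<^bsub>E\<^esub> \<Delta> f"
  proof (rule E_ext)
    fix n i x assume x: "x \<in> carrier (P i)"
    have dh: "d (i - n + 1) \<in> module_hom R (P (i - (n - 1))) (P (i - n))"
      using d_hom[of "i - n + 1"] by (simp add: algebra_simps)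
    note cl = E_closed[OF f d_closed[OF x], of "i - n" "n - 1"] hom_closed[OF dh E_closed'[OF f x]]
    have "\<Delta> (r \<odot>\<^bsub>E\<^esub> f) n i x =
        r \<odot>\<^bsub>P (i - n)\<^esub> d (i - n + 1) (f (n - 1) i x) \<oplus>\<^bsub>P (i - n)\<^esub>
        (parity n \<odot>\<^bsub>P (i - n)\<^esub> (r \<odot>\<^bsub>P (i - n)\<^esub> f (n - 1) (i - 1) (d i x)))"
      using x f r d_closed[OF x] hom_smult[OF dh] by (simp add: \<Delta>_app E_smult_closed)
    also have "\<dots> = (r \<odot>\<^bsub>E\<^esub> \<Delta> f) n i x"
      unfolding E_smult_app[OF x] \<Delta>_app[OF f x]
      using cl[simplified] parity_closed[of n] r by algebra
    finally show "\<Delta> (r \<odot>\<^bsub>E\<^esub> f) n i x = (r \<odot>\<^bsub>E\<^esub> \<Delta> f) n i x" .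
  qed (use f r in \<open>auto intro!: \<Delta>_closed\<close>)
qed

text \<open>The mixed terms d f d cancel because the sign changes from one degree to the
  next.\<close>

lemma \<Delta>_\<Delta>:
  assumes f: "f \<in> carrier E"
  shows "\<Delta> (\<Delta> f) = \<zero>\<^bsub>E\<^esub>"
proof (rule E_ext)
  fix n i x assume x: "x \<in> carrier (P i)"
  let ?N = "P (i - n)" and ?f = "f (n - 2)"
  have dx: "d i x \<in> carrier (P (i - 1))" by (rule d_closed[OF x])
  have dh: "d (i - n + 1) \<in> module_hom R (P (i - n + 1)) ?N" by (rule d_hom') simp
  have 1: "?f i x \<in> carrier (P (i - n + 2))" by (rule E_closed[OF f x]) simp
  have 2: "?f (i - 1) (d i x) \<in> carrier (P (i - n + 1))" by (rule E_closed[OF f dx]) simp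
  have 3: "d (i - n + 2) (?f i x) \<in> carrier (P (i - n + 1))"
    by (rule hom_closed[OF d_hom' 1]) presburger
  have 4: "d (i - n + 1) (?f (i - 1) (d i x)) \<in> carrier ?N" by (rule hom_closed[OF dh 2])
  have dd1: "d (i - n + 1) (d (i - n + 2) (?f i x)) = \<zero>\<^bsub>?N\<^esub>"
    using d_d[OF 1] by (simp add: algebra_simps)
  have dd2: "?f (i - 2) (d (i - 1) (d i x)) = \<zero>\<^bsub>?N\<^esub>"
    using d_d[OF x] hom_P_zero[OF E_hom[OF f, of "i - n" "i - 2" "n - 2"]] by simp
  have A: "\<Delta> f (n - 1) i x = d (i - n + 2) (?f i x) \<oplus>\<^bsub>P (i - n + 1)\<^esub> ((\<ominus> parity n) \<odot>\<^bsub>P (i - n + 1)\<^esub> ?f (i - 1) (d i x))"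
    using \<Delta>_app[OF f x, of "n - 1"] by (simp add: parity_pred algebra_simps)
  have B: "\<Delta> f (n - 1) (i - 1) (d i x) = d (i - n + 1) (?f (i - 1) (d i x)) \<oplus>\<^bsub>?N\<^esub> ((\<ominus> parity n) \<odot>\<^bsub>?N\<^esub> \<zero>\<^bsub>?N\<^esub>)"
    using \<Delta>_app[OF f dx, of "n - 1"] dd2 by (simp add: parity_pred algebra_simps)
  have "\<Delta> (\<Delta> f) n i x = d (i - n + 1) (\<Delta> f (n - 1) i x) \<oplus>\<^bsub>?N\<^esub> (parity n \<odot>\<^bsub>?N\<^esub> \<Delta> f (n - 1) (i - 1) (d i x))"
    by (rule \<Delta>_app[OF \<Delta>_closed[OF f] x])
  also have "d (i - n + 1) (\<Delta> f (n - 1) i x) = \<zero>\<^bsub>?N\<^esub> \<oplus>\<^bsub>?N\<^esub> ((\<ominus> parity n) \<odot>\<^bsub>?N\<^esub> d (i - n + 1) (?f (i - 1) (d i x)))"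
    unfolding A using 2 3 hom_add[OF dh] hom_smult[OF dh] by (simp add: dd1)
  also have "\<zero>\<^bsub>?N\<^esub> \<oplus>\<^bsub>?N\<^esub> ((\<ominus> parity n) \<odot>\<^bsub>?N\<^esub> d (i - n + 1) (?f (i - 1) (d i x))) \<oplus>\<^bsub>?N\<^esub>
      (parity n \<odot>\<^bsub>?N\<^esub> \<Delta> f (n - 1) (i - 1) (d i x)) = \<zero>\<^bsub>?N\<^esub>"
    unfolding B using 4 parity_closed[of n] by algebra
  finally show "\<Delta> (\<Delta> f) n i x = \<zero>\<^bsub>E\<^esub> n i x" using x by simp
qed (use f in \<open>auto intro!: \<Delta>_closed\<close>)


text \<open>The defining sum ranges over an index set that depends on the argument x. A fixed finite
  set makes the product visibly linear in x and allows sums for different factors to be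
  compared.\<close>

lemma mult_app:
  assumes f: "f \<in> carrier E" and g: "g \<in> carrier E" and x: "x \<in> carrier (P i)"
    and Q: "finite Q" "\<And>q. q \<notin> Q \<Longrightarrow> g q i x = \<zero>\<^bsub>P (i - q)\<^esub>"
  shows "(f \<otimes>\<^bsub>E\<^esub> g) n i x = (\<Oplus>\<^bsub>P (i - n)\<^esub>q\<in>Q. f (n - q) (i - q) (g q i x))"
proof -
  let ?h = "\<lambda>q. f (n - q) (i - q) (g q i x)"
  have cl: "?h q \<in> carrier (P (i - n))" for q by (rule E_closed[OF f E_closed'[OF g x]]) simp
  have z: "?h q = \<zero>\<^bsub>P (i - n)\<^esub>" if "q \<notin> Q" for q
    unfolding Q(2)[OF that] by (rule hom_P_zero[OF E_hom[OF f]]) simp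
  have "(f \<otimes>\<^bsub>E\<^esub> g) n i x = (\<Oplus>\<^bsub>P (i - n)\<^esub>q\<in>{q. ?h q \<noteq> \<zero>\<^bsub>P (i - n)\<^esub>}. ?h q)"
    using x by (simp add: end_complex_def)
  also have "\<dots> = (\<Oplus>\<^bsub>P (i - n)\<^esub>q\<in>Q. ?h q)"
    using z cl Q(1) by (intro P.M.add.finprod_mono_neutral_cong_left) auto
  finally show ?thesis .
qed

lemma mult_degrees:
  assumes "f \<in> carrier E" "g \<in> carrier E" "x \<in> carrier (P i)"
  shows "(f \<otimes>\<^bsub>E\<^esub> g) n i x = (\<Oplus>\<^bsub>P (i - n)\<^esub>q\<in>degrees g. f (n - q) (i - q) (g q i x))"
  using assms by (intro mult_app) (auto simp: E_finite notin_degrees)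

lemma mult_closed:
  assumes f: "f \<in> carrier E" and g: "g \<in> carrier E"
  shows "f \<otimes>\<^bsub>E\<^esub> g \<in> carrier E"
proof (rule E_I[where D = "(\<lambda>(p, q). p + q) ` (degrees f \<times> degrees g)"])
  fix n i
  have "(\<lambda>x. \<Oplus>\<^bsub>P (i - n)\<^esub>q\<in>degrees g. f (n - q) (i - q) (g q i x)) \<in> module_hom R (P i) (P (i - n))"
    by (intro hom_finsum P_module E_finite g hom_comp[OF E_hom[OF g refl] E_hom[OF f]]) simp
  from this P_module show "(f \<otimes>\<^bsub>E\<^esub> g) n i \<in> module_hom R (P i) (P (i - n))"
    by (rule hom_cong) (simp add: mult_degrees[OF f g])
  show "(f \<otimes>\<^bsub>E\<^esub> g) n i \<in> extensional (carrier (P i))" by (simp add: end_complex_def)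
next
  fix n i x assume n: "n \<notin> (\<lambda>(p, q). p + q) ` (degrees f \<times> degrees g)" and x: "x \<in> carrier (P i)"
  have "f (n - q) (i - q) (g q i x) = \<zero>\<^bsub>P (i - n)\<^esub>" if "q \<in> degrees g" for q
  proof -
    have "n - q \<notin> degrees f"
    proof
      assume "n - q \<in> degrees f"
      hence "(n - q, q) \<in> degrees f \<times> degrees g" using that by simp
      hence "n \<in> (\<lambda>(p, q). p + q) ` (degrees f \<times> degrees g)" by (rule image_eqI[rotated]) simp
      with n show False by (rule notE)
    qed
    from notin_degrees[OF this E_closed'[OF g x]] show ?thesis by simp
  qed
  thus "(f \<otimes>\<^bsub>E\<^esub> g) n i x = \<zero>\<^bsub>P (i - n)\<^esub>"
    unfolding mult_degrees[OF f g x] by (intro P.M.add.finprod_one_eqI) auto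
qed (simp add: E_finite f g)

text \<open>The grading involution, (-1)^n in degree n. It carries the sign of the Leibniz rule for
  elements that are not homogeneous.\<close>

definition twist :: "(int \<Rightarrow> int \<Rightarrow> 'b \<Rightarrow> 'b) \<Rightarrow> int \<Rightarrow> int \<Rightarrow> 'b \<Rightarrow> 'b" where
  "twist f = (\<lambda>n i. \<lambda>x\<in>carrier (P i). parity n \<odot>\<^bsub>P (i - n)\<^esub> f n i x)"

lemma twist_app: "x \<in> carrier (P i) \<Longrightarrow> twist f n i x = parity n \<odot>\<^bsub>P (i - n)\<^esub> f n i x"
  by (simp add: twist_def)

lemma twist_closed: "f \<in> carrier E \<Longrightarrow> twist f \<in> carrier E"
proof (rule E_I[where D = "degrees f"])
  fix n i assume f: "f \<in> carrier E"
  show "twist f n i \<in> module_hom R (P i) (P (i - n))"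
    unfolding twist_def by (intro hom_restrict hom_scale P_module E_hom[OF f] refl parity_closed)
qed (auto simp: twist_def E_finite notin_degrees)

lemma twist_twist: "f \<in> carrier E \<Longrightarrow> twist (twist f) = f"
proof (rule E_ext)
  fix n i x assume f: "f \<in> carrier E" and x: "x \<in> carrier (P i)"
  show "twist (twist f) n i x = f n i x"
    using f x by (simp add: twist_app P.smult_assoc1[symmetric] parity_sq)
qed (auto intro!: twist_closed)

text \<open>The differential raises the degree by one, so moving it past the involution costs one
  sign.\<close>

lemma \<Delta>_twist:
  assumes f: "f \<in> carrier E"
  shows "\<Delta> (twist f) = \<ominus>\<^bsub>E\<^esub> twist (\<Delta> f)"
proof (rule E_ext)
  fix n i x assume x: "x \<in> carrier (P i)"
  have dh: "d (i - n + 1) \<in> module_hom R (P (i - (n - 1))) (P (i - n))"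
    using d_hom[of "i - n + 1"] by (simp add: algebra_simps)
  have fd: "f (n - 1) (i - 1) (d i x) \<in> carrier (P (i - n))" by (rule E_closed[OF f d_closed[OF x]]) simp
  have "\<Delta> (twist f) n i x = ((\<ominus> parity n) \<odot>\<^bsub>P (i - n)\<^esub> d (i - n + 1) (f (n - 1) i x)) \<oplus>\<^bsub>P (i - n)\<^esub>
      (parity n \<odot>\<^bsub>P (i - n)\<^esub> ((\<ominus> parity n) \<odot>\<^bsub>P (i - n)\<^esub> f (n - 1) (i - 1) (d i x)))"
    using x f d_closed[OF x] hom_smult[OF dh]
    by (simp add: \<Delta>_app[OF twist_closed[OF f]] twist_app parity_pred)
  also have "\<dots> = \<ominus>\<^bsub>P (i - n)\<^esub> (parity n \<odot>\<^bsub>P (i - n)\<^esub> \<Delta> f n i x)"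
    unfolding \<Delta>_app[OF f x] using fd hom_closed[OF dh E_closed'[OF f x]] parity_closed[of n] by algebra
  also have "\<dots> = (\<ominus>\<^bsub>E\<^esub> twist (\<Delta> f)) n i x"
    using x f by (simp add: \<Delta>_closed twist_closed twist_app)
  finally show "\<Delta> (twist f) n i x = (\<ominus>\<^bsub>E\<^esub> twist (\<Delta> f)) n i x" .
qed (use f in \<open>auto intro!: \<Delta>_closed twist_closed\<close>)

text \<open>Differentiating outside, between and inside the factors gives the terms
  \<open>A\<close>, \<open>B\<close> and \<open>C\<close>. The left side is A + C; the products on
  the right are A + B and - B + C.\<close>

lemma Leibniz:
  assumes f: "f \<in> carrier E" and g: "g \<in> carrier E"
  shows "\<Delta> (f \<otimes>\<^bsub>E\<^esub> g) = (\<Delta> f \<otimes>\<^bsub>E\<^esub> g) \<oplus>\<^bsub>E\<^esub> (twist f \<otimes>\<^bsub>E\<^esub> \<Delta> g)"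
proof (rule E_ext)
  fix n i x assume x: "x \<in> carrier (P i)"
  let ?N = "P (i - n)" and ?Q = "degrees g" and ?s = "parity n"
  have Q: "finite ?Q" by (rule E_finite[OF g])
  have dx: "d i x \<in> carrier (P (i - 1))" by (rule d_closed[OF x])
  define A where "A q = d (i - n + 1) (f (n - 1 - q) (i - q) (g q i x))" for q
  define B where "B q = parity (n - q) \<odot>\<^bsub>?N\<^esub> f (n - 1 - q) (i - q - 1) (d (i - q) (g q i x))" for q
  define C where "C q = ?s \<odot>\<^bsub>?N\<^esub> f (n - 1 - q) (i - 1 - q) (g q (i - 1) (d i x))" for q
  have dh: "d (i - n + 1) \<in> module_hom R (P (i - (n - 1))) ?N"
    using d_hom[of "i - n + 1"] by (simp add: algebra_simps)
  have fg: "f (n - 1 - q) (i - q) (g q i x) \<in> carrier (P (i - (n - 1)))" for q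
    by (rule E_closed[OF f E_closed'[OF g x]]) simp
  have Ac: "A q \<in> carrier ?N" for q unfolding A_def by (rule hom_closed[OF dh fg])
  have fdg: "f (n - 1 - q) (i - q - 1) (d (i - q) (g q i x)) \<in> carrier ?N" for q
    by (rule E_closed[OF f d_closed[OF E_closed'[OF g x]]]) simp
  have Bc: "B q \<in> carrier ?N" for q unfolding B_def using fdg by simp
  have fgd: "f (n - 1 - q) (i - 1 - q) (g q (i - 1) (d i x)) \<in> carrier ?N" for q
    by (rule E_closed[OF f E_closed'[OF g dx]]) simp
  have Cc: "C q \<in> carrier ?N" for q unfolding C_def using fgd by simp
  have cl: "A \<in> ?Q \<rightarrow> carrier ?N" "B \<in> ?Q \<rightarrow> carrier ?N" "C \<in> ?Q \<rightarrow> carrier ?N"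
    using Ac Bc Cc by auto
  note sc = P.M.finsum_closed[OF cl(1)] P.M.finsum_closed[OF cl(2)] P.M.finsum_closed[OF cl(3)]
  have L: "\<Delta> (f \<otimes>\<^bsub>E\<^esub> g) n i x = (\<Oplus>\<^bsub>?N\<^esub>q\<in>?Q. A q) \<oplus>\<^bsub>?N\<^esub> (\<Oplus>\<^bsub>?N\<^esub>q\<in>?Q. C q)"
  proof -
    have "d (i - n + 1) ((f \<otimes>\<^bsub>E\<^esub> g) (n - 1) i x) = (\<Oplus>\<^bsub>?N\<^esub>q\<in>?Q. A q)"
      unfolding mult_degrees[OF f g x] A_def using fg by (intro finsum_hom[OF P_module P_module dh Q]) auto
    moreover have "?s \<odot>\<^bsub>?N\<^esub> (f \<otimes>\<^bsub>E\<^esub> g) (n - 1) (i - 1) (d i x) = (\<Oplus>\<^bsub>?N\<^esub>q\<in>?Q. C q)"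
      using mult_degrees[OF f g dx, of "n - 1"] fgd
        P.finsum_smult_ldistr[OF Q parity_closed[of n], of "\<lambda>q. f (n - 1 - q) (i - 1 - q) (g q (i - 1) (d i x))" "i - n"]
      by (simp add: C_def)
    ultimately show ?thesis by (simp add: \<Delta>_app[OF mult_closed[OF f g] x])
  qed
  have M1: "(\<Delta> f \<otimes>\<^bsub>E\<^esub> g) n i x = (\<Oplus>\<^bsub>?N\<^esub>q\<in>?Q. A q) \<oplus>\<^bsub>?N\<^esub> (\<Oplus>\<^bsub>?N\<^esub>q\<in>?Q. B q)"
  proof -
    have "\<Delta> f (n - q) (i - q) (g q i x) = A q \<oplus>\<^bsub>?N\<^esub> B q" for q
      unfolding A_def B_def \<Delta>_app[OF f E_closed'[OF g x]] by (simp add: algebra_simps)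
    hence "(\<Delta> f \<otimes>\<^bsub>E\<^esub> g) n i x = (\<Oplus>\<^bsub>?N\<^esub>q\<in>?Q. A q \<oplus>\<^bsub>?N\<^esub> B q)"
      unfolding mult_degrees[OF \<Delta>_closed[OF f] g x] by simp
    thus ?thesis using P.M.finsum_addf[OF cl(1,2)] by simp
  qed
  have M2: "(twist f \<otimes>\<^bsub>E\<^esub> \<Delta> g) n i x = (\<Oplus>\<^bsub>?N\<^esub>q\<in>?Q. \<ominus>\<^bsub>?N\<^esub> B q) \<oplus>\<^bsub>?N\<^esub> (\<Oplus>\<^bsub>?N\<^esub>q\<in>?Q. C q)"
  proof -
    let ?h = "\<lambda>q. twist f (n - q) (i - q) (\<Delta> g q i x)"
    have shift: "?h (q + 1) = \<ominus>\<^bsub>?N\<^esub> B q \<oplus>\<^bsub>?N\<^esub> C q" for q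
    proof -
      have e: "i - (q + 1) = i - q - 1" "n - (q + 1) = n - 1 - q" "i - (q + 1) + 1 = i - q" "q + 1 - 1 = q" by auto
      have fh: "f (n - 1 - q) (i - q - 1) \<in> module_hom R (P (i - q - 1)) ?N" by (rule E_hom[OF f]) simp
      have c1: "d (i - q) (g q i x) \<in> carrier (P (i - q - 1))" by (rule d_closed[OF E_closed'[OF g x]])
      have c2: "g q (i - 1) (d i x) \<in> carrier (P (i - q - 1))" by (rule E_closed[OF g dx]) simp
      have D: "\<Delta> g (q + 1) i x = d (i - q) (g q i x) \<oplus>\<^bsub>P (i - q - 1)\<^esub>
          (parity (q + 1) \<odot>\<^bsub>P (i - q - 1)\<^esub> g q (i - 1) (d i x))"
        using \<Delta>_app[OF g x, of "q + 1"] unfolding e by simp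
      have "\<Delta> g (q + 1) i x \<in> carrier (P (i - q - 1))" unfolding D using c1 c2 by simp
      hence "?h (q + 1) = parity (n - 1 - q) \<odot>\<^bsub>?N\<^esub> f (n - 1 - q) (i - q - 1) (\<Delta> g (q + 1) i x)"
        unfolding e by (subst twist_app) (simp_all add: algebra_simps)
      also have "f (n - 1 - q) (i - q - 1) (\<Delta> g (q + 1) i x) = f (n - 1 - q) (i - q - 1) (d (i - q) (g q i x))
          \<oplus>\<^bsub>?N\<^esub> (parity (q + 1) \<odot>\<^bsub>?N\<^esub> f (n - 1 - q) (i - 1 - q) (g q (i - 1) (d i x)))"
        unfolding D using c1 c2 hom_add[OF fh c1] hom_smult[OF fh _ c2] by (simp add: algebra_simps)
      also have "parity (n - 1 - q) \<odot>\<^bsub>?N\<^esub> \<dots> =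
        (parity (n - 1 - q) \<odot>\<^bsub>?N\<^esub> f (n - 1 - q) (i - q - 1) (d (i - q) (g q i x))) \<oplus>\<^bsub>?N\<^esub>
        ((parity (n - 1 - q) \<otimes> parity (q + 1)) \<odot>\<^bsub>?N\<^esub> f (n - 1 - q) (i - 1 - q) (g q (i - 1) (d i x)))"
        using fdg[of q] fgd[of q] by (simp add: P.smult_r_distr P.smult_assoc1)
      also have "parity (n - 1 - q) = \<ominus> parity (n - q)" using parity_pred[of "n - q"] by (simp add: algebra_simps)
      also have "\<ominus> parity (n - q) \<otimes> parity (q + 1) = parity n"
        by (simp add: parity_def l_minus)
      finally show ?thesis unfolding B_def C_def using fdg[of q] by (simp add: P.smult_l_minus)
    qed
    \<comment> \<open>The degrees of \<open>\<Delta> g\<close> are among those of \<open>g\<close>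
      shifted by one, so the sum is reindexed by q + 1 before it is compared with \<open>B\<close>
      and \<open>C\<close>.\<close>
    have hc: "?h \<in> (\<lambda>q. q + 1) ` ?Q \<rightarrow> carrier ?N" using shift Bc Cc by auto
    have "(twist f \<otimes>\<^bsub>E\<^esub> \<Delta> g) n i x = (\<Oplus>\<^bsub>?N\<^esub>q\<in>(\<lambda>q. q + 1) ` ?Q. ?h q)"
    proof (rule mult_app[OF twist_closed[OF f] \<Delta>_closed[OF g] x])
      fix q assume q: "q \<notin> (\<lambda>q. q + 1) ` ?Q"
      have q': "q - 1 \<notin> ?Q" using q by (rule contrapos_nn) (rule image_eqI[rotated], assumption, presburger)
      have "g (q - 1) i x = \<zero>\<^bsub>P (i - (q - 1))\<^esub>" "g (q - 1) (i - 1) (d i x) = \<zero>\<^bsub>P (i - 1 - (q - 1))\<^esub>"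
        by (rule notin_degrees[OF q' x], rule notin_degrees[OF q' dx])
      thus "\<Delta> g q i x = \<zero>\<^bsub>P (i - q)\<^esub>"
        using d_zero[of "i - q + 1"] by (simp add: \<Delta>_app[OF g x] algebra_simps)
    qed (simp add: Q)
    also have "\<dots> = (\<Oplus>\<^bsub>?N\<^esub>q\<in>?Q. ?h (q + 1))" by (rule P.M.finsum_reindex[OF hc]) simp
    also have "\<dots> = (\<Oplus>\<^bsub>?N\<^esub>q\<in>?Q. \<ominus>\<^bsub>?N\<^esub> B q \<oplus>\<^bsub>?N\<^esub> C q)" unfolding shift ..
    also have "\<dots> = (\<Oplus>\<^bsub>?N\<^esub>q\<in>?Q. \<ominus>\<^bsub>?N\<^esub> B q) \<oplus>\<^bsub>?N\<^esub> (\<Oplus>\<^bsub>?N\<^esub>q\<in>?Q. C q)"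
      using Bc cl(3) by (intro P.M.finsum_addf) auto
    finally show ?thesis .
  qed
  have "(\<lambda>x. \<ominus>\<^bsub>?N\<^esub> x) \<in> module_hom R ?N ?N"
    by (rule hom_negate[OF P_module]) (simp add: module_hom_def)
  hence neg: "(\<Oplus>\<^bsub>?N\<^esub>q\<in>?Q. \<ominus>\<^bsub>?N\<^esub> B q) = \<ominus>\<^bsub>?N\<^esub> (\<Oplus>\<^bsub>?N\<^esub>q\<in>?Q. B q)"
    using finsum_hom[OF P_module P_module _ Q cl(2)] by simp
  show "\<Delta> (f \<otimes>\<^bsub>E\<^esub> g) n i x = ((\<Delta> f \<otimes>\<^bsub>E\<^esub> g) \<oplus>\<^bsub>E\<^esub> (twist f \<otimes>\<^bsub>E\<^esub> \<Delta> g)) n i x"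
    unfolding E_add_app[OF x] L M1 M2 neg using sc by algebra
qed (use f g in \<open>auto intro!: \<Delta>_closed twist_closed mult_closed\<close>)

lemma mult_add_left:
  assumes f: "f \<in> carrier E" and g: "g \<in> carrier E" and h: "h \<in> carrier E"
  shows "(f \<oplus>\<^bsub>E\<^esub> g) \<otimes>\<^bsub>E\<^esub> h = (f \<otimes>\<^bsub>E\<^esub> h) \<oplus>\<^bsub>E\<^esub> (g \<otimes>\<^bsub>E\<^esub> h)"
proof (rule E_ext)
  fix n i x assume x: "x \<in> carrier (P i)"
  have c: "f (n - q) (i - q) (h q i x) \<in> carrier (P (i - n))" "g (n - q) (i - q) (h q i x) \<in> carrier (P (i - n))" for q
    by (rule E_closed[OF f E_closed'[OF h x]], simp) (rule E_closed[OF g E_closed'[OF h x]], simp)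
  show "((f \<oplus>\<^bsub>E\<^esub> g) \<otimes>\<^bsub>E\<^esub> h) n i x = ((f \<otimes>\<^bsub>E\<^esub> h) \<oplus>\<^bsub>E\<^esub> (g \<otimes>\<^bsub>E\<^esub> h)) n i x"
    using c x f g h by (simp add: mult_degrees E_add_closed P.M.finsum_addf Pi_iff)
qed (use f g h in \<open>auto intro!: mult_closed\<close>)

lemma mult_add_right:
  assumes f: "f \<in> carrier E" and g: "g \<in> carrier E" and h: "h \<in> carrier E"
  shows "f \<otimes>\<^bsub>E\<^esub> (g \<oplus>\<^bsub>E\<^esub> h) = (f \<otimes>\<^bsub>E\<^esub> g) \<oplus>\<^bsub>E\<^esub> (f \<otimes>\<^bsub>E\<^esub> h)"
proof (rule E_ext)
  fix n i x assume x: "x \<in> carrier (P i)"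
  let ?Q = "degrees g \<union> degrees h"
  have c: "f (n - q) (i - q) (h q i x) \<in> carrier (P (i - n))" "f (n - q) (i - q) (g q i x) \<in> carrier (P (i - n))" for q
    by (rule E_closed[OF f E_closed'[OF h x]], simp) (rule E_closed[OF f E_closed'[OF g x]], simp)
  have Q: "finite ?Q" using E_finite g h by simp
  have fh: "f (n - q) (i - q) \<in> module_hom R (P (i - q)) (P (i - n))" for q by (rule E_hom[OF f]) simp
  have "(f \<otimes>\<^bsub>E\<^esub> (g \<oplus>\<^bsub>E\<^esub> h)) n i x = (\<Oplus>\<^bsub>P (i - n)\<^esub>q\<in>?Q. f (n - q) (i - q) ((g \<oplus>\<^bsub>E\<^esub> h) q i x))"
    using Q x by (intro mult_app f E_add_closed g h) (auto simp: notin_degrees)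
  also have "\<dots> = (\<Oplus>\<^bsub>P (i - n)\<^esub>q\<in>?Q. f (n - q) (i - q) (g q i x) \<oplus>\<^bsub>P (i - n)\<^esub> f (n - q) (i - q) (h q i x))"
    using x g h hom_add[OF fh] by simp
  also have "\<dots> = (\<Oplus>\<^bsub>P (i - n)\<^esub>q\<in>?Q. f (n - q) (i - q) (g q i x)) \<oplus>\<^bsub>P (i - n)\<^esub> (\<Oplus>\<^bsub>P (i - n)\<^esub>q\<in>?Q. f (n - q) (i - q) (h q i x))"
    using c by (intro P.M.finsum_addf) auto
  also have "(\<Oplus>\<^bsub>P (i - n)\<^esub>q\<in>?Q. f (n - q) (i - q) (g q i x)) = (f \<otimes>\<^bsub>E\<^esub> g) n i x"
    using Q x by (intro mult_app[symmetric] f g) (auto simp: notin_degrees)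
  also have "(\<Oplus>\<^bsub>P (i - n)\<^esub>q\<in>?Q. f (n - q) (i - q) (h q i x)) = (f \<otimes>\<^bsub>E\<^esub> h) n i x"
    using Q x by (intro mult_app[symmetric] f h) (auto simp: notin_degrees)
  finally show "(f \<otimes>\<^bsub>E\<^esub> (g \<oplus>\<^bsub>E\<^esub> h)) n i x = ((f \<otimes>\<^bsub>E\<^esub> g) \<oplus>\<^bsub>E\<^esub> (f \<otimes>\<^bsub>E\<^esub> h)) n i x"
    using x by simp
qed (use f g h in \<open>auto intro!: mult_closed\<close>)

text \<open>Only the component of \<open>f\<close> of degree n meets the identity. Together with
  \<open>null_homotopy\<close> this makes \<open>m\<close> act as zero on homology.\<close>

lemma one_mult:
  assumes f: "f \<in> carrier E" and r: "r \<in> carrier R"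
  shows "(r \<odot>\<^bsub>E\<^esub> \<one>\<^bsub>E\<^esub>) \<otimes>\<^bsub>E\<^esub> f = r \<odot>\<^bsub>E\<^esub> f"
proof (rule E_ext)
  fix n i x assume x: "x \<in> carrier (P i)"
  have r1: "r \<odot>\<^bsub>E\<^esub> \<one>\<^bsub>E\<^esub> \<in> carrier E" by (rule E_smult_closed[OF r E_one_closed])
  have "((r \<odot>\<^bsub>E\<^esub> \<one>\<^bsub>E\<^esub>) \<otimes>\<^bsub>E\<^esub> f) n i x =
      (\<Oplus>\<^bsub>P (i - n)\<^esub>q\<in>insert n (degrees f). (r \<odot>\<^bsub>E\<^esub> \<one>\<^bsub>E\<^esub>) (n - q) (i - q) (f q i x))"
    using x E_finite[OF f] by (intro mult_app r1 f) (auto simp: notin_degrees)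
  also have "\<dots> = (\<Oplus>\<^bsub>P (i - n)\<^esub>q\<in>{n}. r \<odot>\<^bsub>P (i - n)\<^esub> f n i x)"
    using x f r E_finite[OF f]
    by (intro P.M.add.finprod_mono_neutral_cong_right) (auto simp: E_one_app)
  also have "\<dots> = (r \<odot>\<^bsub>E\<^esub> f) n i x" using x f r by simp
  finally show "((r \<odot>\<^bsub>E\<^esub> \<one>\<^bsub>E\<^esub>) \<otimes>\<^bsub>E\<^esub> f) n i x = (r \<odot>\<^bsub>E\<^esub> f) n i x" .
qed (use f r in \<open>auto intro!: mult_closed E_one_closed\<close>)

end

section \<open>Construction of homotopies and cycles by the comparison argument\<close>

context residue_resolution
begin

text \<open>Only odd \<open>p\<close> are needed, where the differential of \<open>g\<close> is \<open>d \<circ> g + g \<circ> d\<close>.\<close>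

lemma extend_homotopy:
  assumes p: "odd p" and f: "f \<in> carrier E" and \<Delta>f: "\<Delta> f = \<zero>\<^bsub>E\<^esub>"
    and f_deg: "\<And>n i x. \<lbrakk>n \<noteq> p + 1; x \<in> carrier (P i)\<rbrakk> \<Longrightarrow> f n i x = \<zero>\<^bsub>P (i - n)\<^esub>"
    and g0: "g0 \<in> module_hom R (P p) (P 0)"
    and start: "\<And>x. x \<in> carrier (P (p + 1)) \<Longrightarrow> \<rho> (f (p + 1) (p + 1) x \<ominus>\<^bsub>P 0\<^esub> g0 (d (p + 1) x)) \<in> m"
  obtains g where "g \<in> carrier E" "\<Delta> g = f" "\<And>x. x \<in> carrier (P p) \<Longrightarrow> g p p x = g0 x"
    "\<And>n i x. \<lbrakk>n \<noteq> p; x \<in> carrier (P i)\<rbrakk> \<Longrightarrow> g n i x = \<zero>\<^bsub>P (i - n)\<^esub>"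
proof -
  let ?err = "\<lambda>k G x. f (p + 1) (p + 1 + int k) x \<ominus>\<^bsub>P (int k)\<^esub> G (d (p + 1 + int k) x)"
  \<comment> \<open>Stage k is a map from P_(p+k) to P_k whose error against \<open>f\<close> is a
    boundary, so that the next stage is a lift of that error. The condition at k = 0 pins the
    prescribed map \<open>g0\<close>.\<close>
  define ok where "ok k G \<longleftrightarrow> G \<in> module_hom R (P (p + int k)) (P (int k)) \<and> (k = 0 \<longrightarrow> G = g0) \<and>
    (\<forall>x\<in>carrier (P (p + 1 + int k)). ?err k G x \<in> d (1 + int k) ` carrier (P (1 + int k)))" for k and G :: "'b \<Rightarrow> 'b"
  have dh: "d (p + 1 + int k) \<in> module_hom R (P (p + 1 + int k)) (P (p + int k))" for k
    by (rule d_hom') simp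
  have fh: "f (p + 1) (p + 1 + int k) \<in> module_hom R (P (p + 1 + int k)) (P (int k))" for k
    by (rule E_hom[OF f]) simp
  have err_hom: "?err k G \<in> module_hom R (P (p + 1 + int k)) (P (int k))" if "ok k G" for k G
    using that unfolding ok_def by (intro hom_diff P_module fh hom_comp[OF dh]) simp
  \<comment> \<open>As p + 1 is even, the cycle \<open>f\<close> commutes with \<open>d\<close>
    without a sign.\<close>
  have comm: "d (i - p - 1) (f (p + 1) i x) = f (p + 1) (i - 1) (d i x)" if x: "x \<in> carrier (P i)" for i x
  proof -
    have e: "i - (p + 2) + 1 = i - p - 1" "p + 2 - 1 = p + 1" by auto
    have c: "f (p + 1) (i - 1) (d i x) \<in> carrier (P (i - (p + 2)))" by (rule E_closed[OF f d_closed[OF x]]) simp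
    have "d (i - p - 1) (f (p + 1) i x) \<in> carrier (P (i - (p + 2)))"
      by (rule hom_closed[OF d_hom' E_closed[OF f x]]) simp_all
    moreover have "\<Delta> f (p + 2) i x = \<zero>\<^bsub>P (i - (p + 2))\<^esub>" using \<Delta>f x by simp
    ultimately have "d (i - p - 1) (f (p + 1) i x) \<ominus>\<^bsub>P (i - (p + 2))\<^esub> f (p + 1) (i - 1) (d i x) = \<zero>\<^bsub>P (i - (p + 2))\<^esub>"
      unfolding \<Delta>_app[OF f x] e using p c by (simp add: parity_def a_minus_def P.smult_l_minus)
    thus ?thesis using c \<open>d (i - p - 1) (f (p + 1) i x) \<in> _\<close> by (simp add: P.sub_eq_zero_iff)
  qed
  have "\<exists>G. \<forall>k. ok k (G k) \<and> (\<forall>x\<in>carrier (P (p + 1 + int k)). d (1 + int k) (G (Suc k) x) = ?err k (G k) x)"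
  proof (rule dependent_nat_choice)
    have "?err 0 g0 x \<in> d (1 + int 0) ` carrier (P (1 + int 0))" if x: "x \<in> carrier (P (p + 1 + int 0))" for x
    proof -
      have "?err 0 g0 x \<in> carrier (P 0)"
        using x E_closed[OF f, of x "p + 1" 0 "p + 1"] hom_closed[OF g0, of "d (p + 1) x"] d_closed[of x "p + 1"] by simp
      from exact0[OF this] start[of x] x show ?thesis by force
    qed
    hence "ok 0 g0" using g0 by (simp add: ok_def)
    thus "\<exists>G. ok 0 G" by (rule exI[of _ g0])
  next
    fix G :: "'b \<Rightarrow> 'b" and k assume G: "ok k G"
    have d1: "d (1 + int k) \<in> module_hom R (P (1 + int k)) (P (int k))" by (rule d_hom') simp
    obtain H where H: "H \<in> module_hom R (P (p + 1 + int k)) (P (1 + int k))"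
        "\<And>x. x \<in> carrier (P (p + 1 + int k)) \<Longrightarrow> d (1 + int k) (H x) = ?err k G x"
      using free_lift[OF P_free P_module P_module d1 err_hom[OF G]] G unfolding ok_def by blast
    \<comment> \<open>The new error is a cycle: d f equals f d, and d H d equals f d - G d d = f d.
      Exactness makes it a boundary.\<close>
    have "?err (Suc k) H x \<in> d (1 + int (Suc k)) ` carrier (P (1 + int (Suc k)))"
      if x: "x \<in> carrier (P (p + 1 + int (Suc k)))" for x
    proof -
      let ?i = "p + 1 + int (Suc k)" and ?N = "P (int k)"
      have e: "p + 1 + int k = ?i - 1" "1 + int k = int (Suc k)" "p + 1 + int (Suc k) - p - 1 = int (Suc k)" by auto
      have dx: "d ?i x \<in> carrier (P (?i - 1))" by (rule d_closed[OF x])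
      have G_hom: "G \<in> module_hom R (P (?i - 2)) ?N" using G by (simp add: ok_def algebra_simps)
      have Hdx: "H (d ?i x) \<in> carrier (P (int (Suc k)))" using hom_closed[OF H(1)] dx unfolding e by simp
      have fx: "f (p + 1) ?i x \<in> carrier (P (int (Suc k)))" by (rule E_closed[OF f x]) simp
      have fdx: "f (p + 1) (?i - 1) (d ?i x) \<in> carrier ?N" by (rule E_closed[OF f dx]) simp
      have "d (int (Suc k)) (?err (Suc k) H x) = d (int (Suc k)) (f (p + 1) ?i x) \<ominus>\<^bsub>?N\<^esub> d (int (Suc k)) (H (d ?i x))"
        using hom_minus[OF P_module P_module d1[unfolded e(2)] fx Hdx] .
      also have "d (int (Suc k)) (f (p + 1) ?i x) = f (p + 1) (?i - 1) (d ?i x)"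
        using comm[OF x] unfolding e(3) .
      also have "d (int (Suc k)) (H (d ?i x)) = f (p + 1) (?i - 1) (d ?i x) \<ominus>\<^bsub>?N\<^esub> G (d (?i - 1) (d ?i x))"
        using H(2)[unfolded e(1,2), OF dx] .
      also have "G (d (?i - 1) (d ?i x)) = \<zero>\<^bsub>?N\<^esub>"
        unfolding d_d[OF x] by (rule hom_P_zero[OF G_hom])
      also have "f (p + 1) (?i - 1) (d ?i x) \<ominus>\<^bsub>?N\<^esub> (f (p + 1) (?i - 1) (d ?i x) \<ominus>\<^bsub>?N\<^esub> \<zero>\<^bsub>?N\<^esub>) = \<zero>\<^bsub>?N\<^esub>"
        using fdx by algebra
      finally have "d (int (Suc k)) (?err (Suc k) H x) = \<zero>\<^bsub>?N\<^esub>" .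
      moreover have "?err (Suc k) H x \<in> carrier (P (int (Suc k)))" using fx Hdx by simp
      ultimately have "\<exists>y\<in>carrier (P (int (Suc k) + 1)). d (int (Suc k) + 1) y = ?err (Suc k) H x"
        by (intro exact) simp_all
      thus ?thesis by (metis add.commute imageI)
    qed
    hence "ok (Suc k) H" using H(1) unfolding ok_def by (simp add: algebra_simps)
    thus "\<exists>H. ok (Suc k) H \<and> (\<forall>x\<in>carrier (P (p + 1 + int k)). d (1 + int k) (H x) = ?err k G x)"
      using H(2) by blast
  qed
  then obtain G where G: "\<And>k. ok k (G k)"
    and dG: "\<And>k x. x \<in> carrier (P (p + 1 + int k)) \<Longrightarrow> d (1 + int k) (G (Suc k) x) = ?err k (G k) x" by metis
  define g where "g n i = (\<lambda>x\<in>carrier (P i). if n = p \<and> p \<le> i then G (nat (i - p)) x else \<zero>\<^bsub>P (i - n)\<^esub>)" for n i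
  have G_hom: "G (nat (i - p)) \<in> module_hom R (P i) (P (i - p))" if "p \<le> i" for i
    using G[of "nat (i - p)"] that by (simp add: ok_def)
  have g: "g \<in> carrier E"
  proof (rule E_I[where D = "{p}"])
    fix n i show "g n i \<in> module_hom R (P i) (P (i - n))"
      unfolding g_def by (intro hom_restrict) (cases "n = p \<and> p \<le> i", simp add: G_hom, simp only: if_False zero_hom)
  qed (auto simp: g_def)
  have g_deg: "g n i x = \<zero>\<^bsub>P (i - n)\<^esub>" if "n \<noteq> p" "x \<in> carrier (P i)" for n i x
    using that by (simp add: g_def)
  have g_p: "g p (p + int k) x = G k x" if "x \<in> carrier (P (p + int k))" for k x
    using that by (simp add: g_def)
  have "\<Delta> g = f"
  proof (rule E_ext[OF \<Delta>_closed[OF g] f])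
    fix n i x assume x: "x \<in> carrier (P i)"
    have dx: "d i x \<in> carrier (P (i - 1))" by (rule d_closed[OF x])
    show "\<Delta> g n i x = f n i x"
    proof (cases "n = p + 1")
      case False
      hence n: "n - 1 \<noteq> p" by auto
      have "g (n - 1) i x = \<zero>\<^bsub>P (i - (n - 1))\<^esub>" "g (n - 1) (i - 1) (d i x) = \<zero>\<^bsub>P (i - 1 - (n - 1))\<^esub>"
        by (rule g_deg[OF n x], rule g_deg[OF n dx])
      hence "\<Delta> g n i x = \<zero>\<^bsub>P (i - n)\<^esub>"
        using d_zero[of "i - n + 1"] by (simp add: \<Delta>_app[OF g x] algebra_simps)
      thus ?thesis using f_deg[OF False x] by simp
    next
      case n: True
      show ?thesis
      proof (cases "i \<le> p")
        \<comment> \<open>The target has degree i - p - 1, which is negative.\<close>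
        case True
        hence "carrier (P (i - n)) = {\<zero>\<^bsub>P (i - n)\<^esub>}" using n by (intro P_neg) simp
        thus ?thesis using E_closed'[OF \<Delta>_closed[OF g] x, of n] E_closed'[OF f x, of n] by simp
      next
        case False
        then obtain k where i: "i = p + 1 + int k" using zle_iff_zadd[of "p + 1" i] by auto
        have e: "i - n = int k" "i = p + int (Suc k)" "i - 1 = p + int k" "n - 1 = p" using n i by auto
        have Gk: "G k \<in> module_hom R (P (p + int k)) (P (int k))" using G[of k] by (simp add: ok_def)
        have c: "G k (d i x) \<in> carrier (P (int k))" using hom_closed[OF Gk dx[unfolded e(3)]] .
        have fc: "f n i x \<in> carrier (P (int k))" by (rule E_closed[OF f x]) (simp add: n i)
        have 1: "g p i x = G (Suc k) x" using g_p[of x "Suc k"] x unfolding e(2) by simp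
        have 2: "g p (i - 1) (d i x) = G k (d i x)" using g_p[of "d i x" k] dx unfolding e(3) by simp
        have 3: "d (int k + 1) (G (Suc k) x) = f n i x \<ominus>\<^bsub>P (int k)\<^esub> G k (d i x)"
          using dG[of x k] x n i by (simp add: add.commute)
        have 4: "parity n = \<one>" using p n by (simp add: parity_def)
        have "\<Delta> g n i x = d (int k + 1) (g p i x) \<oplus>\<^bsub>P (int k)\<^esub> (parity n \<odot>\<^bsub>P (int k)\<^esub> g p (i - 1) (d i x))"
          using \<Delta>_app[OF g x, of n] unfolding e(1,4) .
        also have "\<dots> = (f n i x \<ominus>\<^bsub>P (int k)\<^esub> G k (d i x)) \<oplus>\<^bsub>P (int k)\<^esub> (\<one> \<odot>\<^bsub>P (int k)\<^esub> G k (d i x))"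
          unfolding 1 2 3 4 ..
        also have "\<dots> = f n i x" using c fc by algebra
        finally show ?thesis .
      qed
    qed
  qed
  moreover have "g p p x = g0 x" if "x \<in> carrier (P p)" for x
    using g_p[of x 0] that G[of 0] by (simp add: ok_def)
  ultimately show thesis using that g g_deg by blast
qed

lemma \<Delta>_one: "\<Delta> \<one>\<^bsub>E\<^esub> = \<zero>\<^bsub>E\<^esub>"
proof (rule E_ext[OF \<Delta>_closed[OF E_one_closed] E_zero_closed])
  fix n i x assume x: "x \<in> carrier (P i)"
  show "\<Delta> \<one>\<^bsub>E\<^esub> n i x = \<zero>\<^bsub>E\<^esub> n i x"
  proof (cases "n = 1")
    case True
    thus ?thesis
      using x d_closed[OF x] by (simp add: \<Delta>_app E_one_closed E_one_app parity_def P.smult_l_minus P.M.r_neg)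
  next
    case False
    hence "\<one>\<^bsub>E\<^esub> (n - 1) i x = \<zero>\<^bsub>P (i - (n - 1))\<^esub>" "\<one>\<^bsub>E\<^esub> (n - 1) (i - 1) (d i x) = \<zero>\<^bsub>P (i - 1 - (n - 1))\<^esub>"
      using x d_closed[OF x] by (simp_all add: E_one_app)
    thus ?thesis
      using x d_zero[of "i - n + 1"] by (simp add: \<Delta>_app E_one_closed algebra_simps)
  qed
qed

text \<open>Multiplication by r induces zero on the residue field. Here p = -1, the homotopy starts
  from zero on P_(-1), and the start condition says that r x has augmentation zero.\<close>

lemma null_homotopy:
  assumes r: "r \<in> m"
  obtains \<eta> where "\<eta> \<in> carrier E" "\<Delta> \<eta> = r \<odot>\<^bsub>E\<^esub> \<one>\<^bsub>E\<^esub>"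
proof (rule extend_homotopy)
  note rR = m_closed'[OF r]
  show "r \<odot>\<^bsub>E\<^esub> \<one>\<^bsub>E\<^esub> \<in> carrier E" by (rule E_smult_closed[OF rR E_one_closed])
  show "\<Delta> (r \<odot>\<^bsub>E\<^esub> \<one>\<^bsub>E\<^esub>) = \<zero>\<^bsub>E\<^esub>"
    unfolding hom_smult[OF \<Delta>_hom rR E_one_closed] \<Delta>_one using rR by simp
  show "(\<lambda>_. \<zero>\<^bsub>P 0\<^esub>) \<in> module_hom R (P (- 1)) (P 0)" by (rule zero_hom)
  show "odd (- 1 :: int)" by simp
  fix x assume "x \<in> carrier (P (- 1 + 1))"
  hence x: "x \<in> carrier (P 0)" by simp
  have "\<rho> (r \<odot>\<^bsub>P 0\<^esub> x \<ominus>\<^bsub>P 0\<^esub> \<zero>\<^bsub>P 0\<^esub>) = r \<otimes> \<rho> x"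
    using x rR hom_smult[OF \<rho>_hom rR x] by (simp add: a_minus_def P.neg_zero)
  thus "\<rho> ((r \<odot>\<^bsub>E\<^esub> \<one>\<^bsub>E\<^esub>) (- 1 + 1) (- 1 + 1) x \<ominus>\<^bsub>P 0\<^esub> \<zero>\<^bsub>P 0\<^esub>) \<in> m"
    using x m.I_r_closed[OF r \<rho>_closed[OF x]] by (simp add: E_one_app)
qed (use m_closed'[OF r] in \<open>auto simp: E_one_app\<close>)


section \<open>Cycles, boundaries and computation with classes in Ext\<close>

abbreviation Z where "Z \<equiv> end_cycles R P d"
abbreviation Bd where "Bd \<equiv> end_boundaries R P d"
abbreviation ZM where "ZM \<equiv> E\<lparr>carrier := Z\<rparr>"
abbreviation Ext where "Ext \<equiv> ext_algebra R P d"

lemma Z_iff: "f \<in> Z \<longleftrightarrow> f \<in> carrier E \<and> \<Delta> f = \<zero>\<^bsub>E\<^esub>"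
  by (simp add: end_cycles_def)

lemma Z_E: "f \<in> Z \<Longrightarrow> f \<in> carrier E"
  by (simp add: Z_iff)

lemma Bd_I: "f \<in> carrier E \<Longrightarrow> \<Delta> f \<in> Bd"
  by (simp add: end_boundaries_def)

lemma Bd_E: "b \<in> Bd \<Longrightarrow> (\<And>f. f \<in> carrier E \<Longrightarrow> b = \<Delta> f \<Longrightarrow> thesis) \<Longrightarrow> thesis"
  by (auto simp: end_boundaries_def)

lemma Bd_Z: "b \<in> Bd \<Longrightarrow> b \<in> Z"
  by (elim Bd_E) (simp add: Z_iff \<Delta>_closed \<Delta>_\<Delta>)

lemma Z_add: "\<lbrakk>f \<in> Z; g \<in> Z\<rbrakk> \<Longrightarrow> f \<oplus>\<^bsub>E\<^esub> g \<in> Z"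
  by (simp add: Z_iff hom_add[OF \<Delta>_hom])

lemma Z_smult: "\<lbrakk>r \<in> carrier R; f \<in> Z\<rbrakk> \<Longrightarrow> r \<odot>\<^bsub>E\<^esub> f \<in> Z"
  by (simp add: Z_iff hom_smult[OF \<Delta>_hom])

lemma Bd_add: "\<lbrakk>f \<in> Bd; g \<in> Bd\<rbrakk> \<Longrightarrow> f \<oplus>\<^bsub>E\<^esub> g \<in> Bd"
  by (elim Bd_E) (metis Bd_I EM.M.a_closed hom_add[OF \<Delta>_hom])

lemma Bd_smult: "\<lbrakk>r \<in> carrier R; f \<in> Bd\<rbrakk> \<Longrightarrow> r \<odot>\<^bsub>E\<^esub> f \<in> Bd"
  by (elim Bd_E) (metis Bd_I EM.smult_closed hom_smult[OF \<Delta>_hom])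

lemma Z_zero: "\<zero>\<^bsub>E\<^esub> \<in> Z"
  by (simp add: Z_iff hom_zero[OF E_module E_module \<Delta>_hom])

lemma Bd_zero: "\<zero>\<^bsub>E\<^esub> \<in> Bd"
  using Bd_I[OF EM.M.zero_closed] by (simp add: hom_zero[OF E_module E_module \<Delta>_hom])

lemma Z_one: "\<one>\<^bsub>E\<^esub> \<in> Z"
  by (simp add: Z_iff E_one_closed \<Delta>_one)

lemma Z_neg: "f \<in> Z \<Longrightarrow> \<ominus>\<^bsub>E\<^esub> f \<in> Z"
  by (simp add: Z_iff hom_neg[OF E_module E_module \<Delta>_hom] EM.neg_zero)

lemma Bd_neg: "f \<in> Bd \<Longrightarrow> \<ominus>\<^bsub>E\<^esub> f \<in> Bd"
  by (elim Bd_E) (metis Bd_I EM.M.a_inv_closed hom_neg[OF E_module E_module \<Delta>_hom])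

lemma mult_zero_right: "f \<in> carrier E \<Longrightarrow> f \<otimes>\<^bsub>E\<^esub> \<zero>\<^bsub>E\<^esub> = \<zero>\<^bsub>E\<^esub>"
  using mult_add_right[of f "\<zero>\<^bsub>E\<^esub>" "\<zero>\<^bsub>E\<^esub>"] mult_closed[of f "\<zero>\<^bsub>E\<^esub>"] by simp

lemma mult_zero_left: "f \<in> carrier E \<Longrightarrow> \<zero>\<^bsub>E\<^esub> \<otimes>\<^bsub>E\<^esub> f = \<zero>\<^bsub>E\<^esub>"
  using mult_add_left[of "\<zero>\<^bsub>E\<^esub>" "\<zero>\<^bsub>E\<^esub>" f] mult_closed[of "\<zero>\<^bsub>E\<^esub>" f] by simp

lemma twist_zero: "twist \<zero>\<^bsub>E\<^esub> = \<zero>\<^bsub>E\<^esub>"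
  by (rule E_ext) (auto simp: twist_app intro!: twist_closed)

lemma twist_Z: "f \<in> Z \<Longrightarrow> twist f \<in> Z"
  by (simp add: Z_iff twist_closed \<Delta>_twist twist_zero EM.neg_zero)

lemma Z_mult: "\<lbrakk>f \<in> Z; g \<in> Z\<rbrakk> \<Longrightarrow> f \<otimes>\<^bsub>E\<^esub> g \<in> Z"
  by (simp add: Z_iff mult_closed Leibniz mult_zero_left mult_zero_right twist_closed)

lemma Bd_mult_left: "\<lbrakk>b \<in> Bd; g \<in> Z\<rbrakk> \<Longrightarrow> b \<otimes>\<^bsub>E\<^esub> g \<in> Bd"
proof (elim Bd_E)
  fix f assume f: "f \<in> carrier E" "b = \<Delta> f" and g: "g \<in> Z"
  have "\<Delta> (f \<otimes>\<^bsub>E\<^esub> g) = b \<otimes>\<^bsub>E\<^esub> g"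
    using f g by (simp add: Z_iff Leibniz mult_zero_right twist_closed mult_closed \<Delta>_closed)
  thus ?thesis using Bd_I[OF mult_closed[OF f(1) Z_E[OF g]]] by simp
qed

text \<open>The Leibniz rule for \<open>twist f\<close> instead of \<open>f\<close>: twisting twice
  is the identity, so the surviving term carries no sign.\<close>

lemma Bd_mult_right: "\<lbrakk>f \<in> Z; b \<in> Bd\<rbrakk> \<Longrightarrow> f \<otimes>\<^bsub>E\<^esub> b \<in> Bd"
proof (elim Bd_E)
  fix g assume f: "f \<in> Z" and g: "g \<in> carrier E" "b = \<Delta> g"
  have t: "twist f \<in> carrier E" "\<Delta> (twist f) = \<zero>\<^bsub>E\<^esub>" using twist_Z[OF f] by (auto simp: Z_iff)
  have "\<Delta> (twist f \<otimes>\<^bsub>E\<^esub> g) = f \<otimes>\<^bsub>E\<^esub> b"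
    using Z_E[OF f] g t by (simp add: Leibniz mult_zero_left twist_twist mult_closed \<Delta>_closed)
  thus ?thesis using Bd_I[OF mult_closed[OF t(1) g(1)]] by simp
qed

text \<open>r f is the product of r times the identity, a boundary, with the cycle \<open>f\<close>.
  This makes the action of the residue field on Ext independent of representatives.\<close>

lemma m_smult_Bd: "\<lbrakk>r \<in> m; f \<in> Z\<rbrakk> \<Longrightarrow> r \<odot>\<^bsub>E\<^esub> f \<in> Bd"
proof -
  assume r: "r \<in> m" and f: "f \<in> Z"
  obtain \<eta> where \<eta>: "\<eta> \<in> carrier E" "\<Delta> \<eta> = r \<odot>\<^bsub>E\<^esub> \<one>\<^bsub>E\<^esub>" using null_homotopy[OF r] by blast
  have "(r \<odot>\<^bsub>E\<^esub> \<one>\<^bsub>E\<^esub>) \<otimes>\<^bsub>E\<^esub> f \<in> Bd" unfolding \<eta>(2)[symmetric] by (rule Bd_mult_left[OF Bd_I[OF \<eta>(1)] f])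
  thus ?thesis using one_mult[OF Z_E[OF f] m_closed'[OF r]] by simp
qed

lemma ZM_simps [simp]:
  "carrier ZM = Z" "f \<oplus>\<^bsub>ZM\<^esub> g = f \<oplus>\<^bsub>E\<^esub> g" "\<zero>\<^bsub>ZM\<^esub> = \<zero>\<^bsub>E\<^esub>" "f \<otimes>\<^bsub>ZM\<^esub> g = f \<otimes>\<^bsub>E\<^esub> g" "\<one>\<^bsub>ZM\<^esub> = \<one>\<^bsub>E\<^esub>"
  by simp_all

lemma ZM_abelian_group: "abelian_group ZM"
proof (rule abelian_groupI)
  fix f assume "f \<in> carrier ZM"
  thus "\<exists>g\<in>carrier ZM. g \<oplus>\<^bsub>ZM\<^esub> f = \<zero>\<^bsub>ZM\<^esub>"
    using Z_neg[of f] Z_E[of f] by (auto intro!: bexI[of _ "\<ominus>\<^bsub>E\<^esub> f"] simp: EM.M.l_neg)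
qed (use Z_E in \<open>auto simp: Z_add Z_zero EM.M.a_ac\<close>)

lemma ZM_neg: "f \<in> Z \<Longrightarrow> \<ominus>\<^bsub>ZM\<^esub> f = \<ominus>\<^bsub>E\<^esub> f"
proof -
  assume f: "f \<in> Z"
  interpret ZM: abelian_group ZM by (rule ZM_abelian_group)
  show ?thesis using f Z_neg[OF f] Z_E[OF f] by (intro ZM.minus_equality) (auto simp: EM.M.l_neg)
qed

lemma Bd_abelian_subgroup: "abelian_subgroup Bd ZM"
proof (rule abelian_subgroupI3[OF _ ZM_abelian_group])
  interpret ZM: abelian_group ZM by (rule ZM_abelian_group)
  show "additive_subgroup Bd ZM"
  proof (rule additive_subgroupI, rule ZM.add.subgroupI)
    show "Bd \<subseteq> carrier ZM" using Bd_Z by auto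
    show "Bd \<noteq> {}" using Bd_zero by auto
    fix b assume b: "b \<in> Bd"
    show "\<ominus>\<^bsub>ZM\<^esub> b \<in> Bd" using ZM_neg[OF Bd_Z[OF b]] Bd_neg[OF b] by simp
    fix c assume "c \<in> Bd"
    thus "b \<oplus>\<^bsub>ZM\<^esub> c \<in> Bd" using Bd_add[OF b] by simp
  qed
qed

sublocale Bd: abelian_subgroup Bd ZM by (rule Bd_abelian_subgroup)

definition cls :: "(int \<Rightarrow> int \<Rightarrow> 'b \<Rightarrow> 'b) \<Rightarrow> (int \<Rightarrow> int \<Rightarrow> 'b \<Rightarrow> 'b) set" where
  "cls f = Bd +>\<^bsub>ZM\<^esub> f"

text \<open>\<open>ext_component\<close> forms cosets in the whole complex, the quotient ring forms
  them among cycles; the addition is the same.\<close>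

lemma cls_E: "Bd +>\<^bsub>E\<^esub> f = cls f"
  by (simp add: cls_def a_r_coset_def')

lemma in_cls: "f \<in> cls g \<longleftrightarrow> (\<exists>b\<in>Bd. f = b \<oplus>\<^bsub>E\<^esub> g)"
  by (auto simp: cls_def a_r_coset_def')

lemma cls_eqI: "\<lbrakk>g \<in> Z; b \<in> Bd; f = b \<oplus>\<^bsub>E\<^esub> g\<rbrakk> \<Longrightarrow> cls f = cls g"
  unfolding cls_def
  by (rule Bd.a_repr_independence[symmetric, OF _ _ Bd.a_subgroup]) (auto simp: in_cls[unfolded cls_def])

lemma cls_self: "f \<in> Z \<Longrightarrow> f \<in> cls f"
  unfolding in_cls using Z_E[of f] Bd_zero by (intro bexI[of _ "\<zero>\<^bsub>E\<^esub>"]) simp_all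

lemma cls_eqD: "\<lbrakk>f \<in> Z; cls f = cls g\<rbrakk> \<Longrightarrow> \<exists>b\<in>Bd. f = b \<oplus>\<^bsub>E\<^esub> g"
  using cls_self[of f] in_cls[of f g] by simp

lemma Ext_def':
  "carrier Ext = a_rcosets\<^bsub>ZM\<^esub> Bd" "x \<oplus>\<^bsub>Ext\<^esub> y = x <+>\<^bsub>ZM\<^esub> y" "\<zero>\<^bsub>Ext\<^esub> = Bd"
  "x \<otimes>\<^bsub>Ext\<^esub> y = rcoset_mult ZM Bd x y" "\<one>\<^bsub>Ext\<^esub> = cls \<one>\<^bsub>E\<^esub>"
  "k \<odot>\<^bsub>Ext\<^esub> x = (\<Union>r\<in>k. \<Union>f\<in>x. cls (r \<odot>\<^bsub>E\<^esub> f))"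
  by (simp_all add: ext_algebra_def Let_def FactRing_def ring.defs module.defs cls_def)

lemma Ext_carrier: "carrier Ext = cls ` Z"
  by (auto simp: Ext_def' A_RCOSETS_def' cls_def)

lemma Ext_add: "\<lbrakk>f \<in> Z; g \<in> Z\<rbrakk> \<Longrightarrow> cls f \<oplus>\<^bsub>Ext\<^esub> cls g = cls (f \<oplus>\<^bsub>E\<^esub> g)"
  unfolding Ext_def' cls_def using Bd.a_rcos_sum[of f g] by simp

text \<open>\<open>rcoset_mult\<close> is a union over all pairs of representatives. It collapses to
  one coset because boundaries absorb cycles from both sides.\<close>

lemma Ext_mult:
  assumes f: "f \<in> Z" and g: "g \<in> Z"
  shows "cls f \<otimes>\<^bsub>Ext\<^esub> cls g = cls (f \<otimes>\<^bsub>E\<^esub> g)"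
proof -
  have "cls (f' \<otimes>\<^bsub>E\<^esub> g') = cls (f \<otimes>\<^bsub>E\<^esub> g)" if "f' \<in> cls f" "g' \<in> cls g" for f' g'
  proof -
    obtain b c where b: "b \<in> Bd" "f' = b \<oplus>\<^bsub>E\<^esub> f" and c: "c \<in> Bd" "g' = c \<oplus>\<^bsub>E\<^esub> g"
      using \<open>f' \<in> cls f\<close> \<open>g' \<in> cls g\<close> unfolding in_cls by blast
    have g': "g' \<in> Z" unfolding c(2) by (rule Z_add[OF Bd_Z[OF c(1)] g])
    note ZE = Z_E[OF f] Z_E[OF g] Z_E[OF g'] Z_E[OF Bd_Z[OF b(1)]] Z_E[OF Bd_Z[OF c(1)]]
    have "f' \<otimes>\<^bsub>E\<^esub> g' = (b \<otimes>\<^bsub>E\<^esub> g') \<oplus>\<^bsub>E\<^esub> ((f \<otimes>\<^bsub>E\<^esub> c) \<oplus>\<^bsub>E\<^esub> (f \<otimes>\<^bsub>E\<^esub> g))"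
      unfolding b(2) mult_add_left[OF ZE(4,1,3)] using mult_add_right[OF ZE(1,5,2)] c(2) by simp
    also have "\<dots> = ((b \<otimes>\<^bsub>E\<^esub> g') \<oplus>\<^bsub>E\<^esub> (f \<otimes>\<^bsub>E\<^esub> c)) \<oplus>\<^bsub>E\<^esub> (f \<otimes>\<^bsub>E\<^esub> g)"
      using ZE by (simp add: EM.M.a_assoc mult_closed)
    finally show ?thesis
      by (rule cls_eqI[OF Z_mult[OF f g] Bd_add[OF Bd_mult_left[OF b(1) g'] Bd_mult_right[OF f c(1)]]])
  qed
  thus ?thesis
    unfolding Ext_def' rcoset_mult_def ZM_simps cls_def[symmetric] using cls_self f g by blast
qed

text \<open>Again a union over representatives. A change of the cycle is absorbed by
  \<open>Bd_smult\<close>, a change of the scalar by \<open>m_smult_Bd\<close>.\<close>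

lemma Ext_smult:
  assumes r: "r \<in> carrier R" and f: "f \<in> Z"
  shows "(m +>\<^bsub>R\<^esub> r) \<odot>\<^bsub>Ext\<^esub> cls f = cls (r \<odot>\<^bsub>E\<^esub> f)"
proof -
  have "cls (r' \<odot>\<^bsub>E\<^esub> f') = cls (r \<odot>\<^bsub>E\<^esub> f)" if *: "r' \<in> m +>\<^bsub>R\<^esub> r" "f' \<in> cls f" for r' f'
  proof -
    obtain b h where b: "b \<in> Bd" "f' = b \<oplus>\<^bsub>E\<^esub> f" and h: "h \<in> m" "r' = h \<oplus> r"
      using * unfolding in_cls a_r_coset_def' by auto
    have f': "f' \<in> Z" unfolding b(2) by (rule Z_add[OF Bd_Z[OF b(1)] f])
    note ZE = Z_E[OF f] Z_E[OF f'] Z_E[OF Bd_Z[OF b(1)]] m_closed'[OF h(1)]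
    have "r' \<odot>\<^bsub>E\<^esub> f' = (h \<odot>\<^bsub>E\<^esub> f') \<oplus>\<^bsub>E\<^esub> (r \<odot>\<^bsub>E\<^esub> (b \<oplus>\<^bsub>E\<^esub> f))"
      unfolding h(2) using ZE r by (simp add: EM.smult_l_distr flip: b(2))
    also have "\<dots> = ((h \<odot>\<^bsub>E\<^esub> f') \<oplus>\<^bsub>E\<^esub> (r \<odot>\<^bsub>E\<^esub> b)) \<oplus>\<^bsub>E\<^esub> (r \<odot>\<^bsub>E\<^esub> f)"
      using ZE r by (simp add: EM.smult_r_distr EM.M.a_assoc)
    finally show ?thesis
      by (rule cls_eqI[OF Z_smult[OF r f] Bd_add[OF m_smult_Bd[OF h(1) f'] Bd_smult[OF r b(1)]]])
  qed
  moreover have "r \<in> m +>\<^bsub>R\<^esub> r" using r by (auto simp: a_r_coset_def' intro!: bexI[of _ "\<zero>"])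
  ultimately show ?thesis unfolding Ext_def' using cls_self[OF f] by blast
qed

lemma Ext_abelian_group: "abelian_group Ext"
proof (rule abelian_groupI)
  show "\<zero>\<^bsub>Ext\<^esub> \<in> carrier Ext"
    using Ext_carrier Z_zero Bd.a_coset_add_zero[OF Bd.a_subset] by (auto simp: Ext_def'(3) cls_def intro!: image_eqI[of _ _ "\<zero>\<^bsub>E\<^esub>"])
  have z: "\<zero>\<^bsub>Ext\<^esub> = cls \<zero>\<^bsub>E\<^esub>"
    using Bd.a_coset_add_zero[OF Bd.a_subset] by (simp add: Ext_def'(3) cls_def)
  fix x y z assume "x \<in> carrier Ext" "y \<in> carrier Ext" "z \<in> carrier Ext"
  then obtain f g h where f: "f \<in> Z" "x = cls f" and g: "g \<in> Z" "y = cls g" and h: "h \<in> Z" "z = cls h"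
    unfolding Ext_carrier by blast
  show "x \<oplus>\<^bsub>Ext\<^esub> y \<in> carrier Ext" using f g by (simp add: Ext_add Ext_carrier Z_add)
  show "x \<oplus>\<^bsub>Ext\<^esub> y \<oplus>\<^bsub>Ext\<^esub> z = x \<oplus>\<^bsub>Ext\<^esub> (y \<oplus>\<^bsub>Ext\<^esub> z)"
    using f g h Z_E by (simp add: Ext_add Z_add EM.M.a_assoc)
  show "x \<oplus>\<^bsub>Ext\<^esub> y = y \<oplus>\<^bsub>Ext\<^esub> x" using f g Z_E by (simp add: Ext_add EM.M.a_comm)
  show "\<zero>\<^bsub>Ext\<^esub> \<oplus>\<^bsub>Ext\<^esub> x = x" unfolding z using f Z_E Z_zero by (simp add: Ext_add)
  show "\<exists>y\<in>carrier Ext. y \<oplus>\<^bsub>Ext\<^esub> x = \<zero>\<^bsub>Ext\<^esub>"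
  proof
    show "cls (\<ominus>\<^bsub>E\<^esub> f) \<in> carrier Ext" using f Z_neg by (simp add: Ext_carrier)
    show "cls (\<ominus>\<^bsub>E\<^esub> f) \<oplus>\<^bsub>Ext\<^esub> x = \<zero>\<^bsub>Ext\<^esub>"
      unfolding z using f Z_E Z_neg by (simp add: Ext_add EM.M.l_neg)
  qed
qed

lemma Ext_zero: "\<zero>\<^bsub>Ext\<^esub> = cls \<zero>\<^bsub>E\<^esub>"
  using Bd.a_coset_add_zero[OF Bd.a_subset] by (simp add: Ext_def'(3) cls_def)

lemma Ext_neg: "f \<in> Z \<Longrightarrow> \<ominus>\<^bsub>Ext\<^esub> cls f = cls (\<ominus>\<^bsub>E\<^esub> f)"
proof -
  assume f: "f \<in> Z"
  interpret Ext: abelian_group Ext by (rule Ext_abelian_group)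
  show ?thesis
    using f Z_neg[OF f] Z_E[OF f]
    by (intro Ext.minus_equality) (auto simp: Ext_add Ext_carrier Ext_zero EM.M.l_neg)
qed

lemma Ext_additive_subgroup:
  assumes K: "K \<subseteq> Z" "\<zero>\<^bsub>E\<^esub> \<in> K" "\<And>f g. \<lbrakk>f \<in> K; g \<in> K\<rbrakk> \<Longrightarrow> f \<oplus>\<^bsub>E\<^esub> g \<in> K" "\<And>f. f \<in> K \<Longrightarrow> \<ominus>\<^bsub>E\<^esub> f \<in> K"
  shows "additive_subgroup (cls ` K) Ext"
proof -
  interpret Ext: abelian_group Ext by (rule Ext_abelian_group)
  show ?thesis
  proof (rule additive_subgroupI, rule Ext.add.subgroupI)
    show "cls ` K \<subseteq> carrier Ext" using K(1) by (auto simp: Ext_carrier)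
    show "cls ` K \<noteq> {}" using K(2) by auto
    fix x assume "x \<in> cls ` K"
    then obtain f where f: "f \<in> K" "x = cls f" by blast
    have fZ: "f \<in> Z" using f K by blast
    show "\<ominus>\<^bsub>Ext\<^esub> x \<in> cls ` K" using K(4)[OF f(1)] Ext_neg[OF fZ] f(2) by simp
    fix y assume "y \<in> cls ` K"
    then obtain g where g: "g \<in> K" "y = cls g" by blast
    have gZ: "g \<in> Z" using g K by blast
    show "x \<oplus>\<^bsub>Ext\<^esub> y \<in> cls ` K" using K(3)[OF f(1) g(1)] Ext_add[OF fZ gZ] f(2) g(2) by simp
  qed
qed

text \<open>Lets subalgebras of Ext be given by closure conditions on cycles; \<open>K\<close> need
  not contain all boundaries.\<close>

lemma Ext_subalgebra:
  assumes K: "K \<subseteq> Z" "\<one>\<^bsub>E\<^esub> \<in> K" "\<And>f g. \<lbrakk>f \<in> K; g \<in> K\<rbrakk> \<Longrightarrow> f \<oplus>\<^bsub>E\<^esub> g \<in> K"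
    "\<And>r f. \<lbrakk>r \<in> carrier R; f \<in> K\<rbrakk> \<Longrightarrow> r \<odot>\<^bsub>E\<^esub> f \<in> K" "\<And>f g. \<lbrakk>f \<in> K; g \<in> K\<rbrakk> \<Longrightarrow> f \<otimes>\<^bsub>E\<^esub> g \<in> K"
  shows "subalgebra_over (R Quot m) Ext (cls ` K)"
proof -
  have KE: "f \<in> carrier E" if "f \<in> K" for f using that K(1) Z_E by blast
  have zero: "\<zero>\<^bsub>E\<^esub> \<in> K" using K(4)[OF zero_closed K(2)] E_one_closed by simp
  have neg: "\<ominus>\<^bsub>E\<^esub> f \<in> K" if "f \<in> K" for f
    using K(4)[of "\<ominus> \<one>" f] that KE[OF that] by (simp add: EM.smult_l_minus)
  have 1: "subgroup (cls ` K) (add_monoid Ext)"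
    using Ext_additive_subgroup[OF K(1) zero K(3) neg] by (simp add: additive_subgroup_def)
  have 2: "submonoid (cls ` K) Ext"
  proof
    show "cls ` K \<subseteq> carrier Ext" using K(1) by (auto simp: Ext_carrier)
    show "\<one>\<^bsub>Ext\<^esub> \<in> cls ` K" using K(2) by (auto simp: Ext_def')
    fix x y assume "x \<in> cls ` K" "y \<in> cls ` K"
    then obtain f g where fg: "f \<in> K" "g \<in> K" "x = cls f" "y = cls g" by blast
    have "f \<in> Z" "g \<in> Z" using fg K(1) by auto
    thus "x \<otimes>\<^bsub>Ext\<^esub> y \<in> cls ` K" using fg K(5) by (simp add: Ext_mult)
  qed
  have 3: "k \<odot>\<^bsub>Ext\<^esub> x \<in> cls ` K" if k: "k \<in> carrier (R Quot m)" and x: "x \<in> cls ` K" for k x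
  proof -
    obtain r where r: "r \<in> carrier R" "k = m +>\<^bsub>R\<^esub> r"
      using k by (auto simp: FactRing_def A_RCOSETS_def')
    obtain f where f: "f \<in> K" "x = cls f" using x by blast
    have "f \<in> Z" using f K(1) by auto
    thus ?thesis using Ext_smult[OF r(1)] K(4)[OF r(1) f(1)] r(2) f(2) by simp
  qed
  show ?thesis unfolding subalgebra_over_def subring_def using 1 2 3 by blast
qed

end

section \<open>Generation by elements of degree one\<close>

context residue_resolution
begin

lemma Z_comm:
  assumes f: "f \<in> Z" and x: "x \<in> carrier (P i)"
  shows "d (i - n) (f n i x) = parity n \<odot>\<^bsub>P (i - n - 1)\<^esub> f n (i - 1) (d i x)"
proof -
  let ?N = "P (i - n - 1)"
  have e: "i - (n + 1) = i - n - 1" "i - n - 1 + 1 = i - n" "n + 1 - 1 = n" by auto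
  have 1: "d (i - n) (f n i x) \<in> carrier ?N" by (rule d_closed[OF E_closed'[OF Z_E[OF f] x]])
  have 2: "f n (i - 1) (d i x) \<in> carrier ?N" by (rule E_closed[OF Z_E[OF f] d_closed[OF x]]) simp
  have "\<Delta> f (n + 1) i x = \<zero>\<^bsub>?N\<^esub>" using f x by (simp add: Z_iff e(1)[symmetric])
  moreover have "\<Delta> f (n + 1) i x = d (i - n) (f n i x) \<oplus>\<^bsub>?N\<^esub> (parity (n + 1) \<odot>\<^bsub>?N\<^esub> f n (i - 1) (d i x))"
    using \<Delta>_app[OF Z_E[OF f] x, of "n + 1"] unfolding e .
  moreover have "parity (n + 1) = \<ominus> parity n" by (simp add: parity_def)
  ultimately have "d (i - n) (f n i x) \<ominus>\<^bsub>?N\<^esub> (parity n \<odot>\<^bsub>?N\<^esub> f n (i - 1) (d i x)) = \<zero>\<^bsub>?N\<^esub>"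
    using 2 by (simp add: a_minus_def P.smult_l_minus)
  thus ?thesis using 1 2 P.sub_eq_zero_iff[of "d (i - n) (f n i x)" "i - n - 1"] by simp
qed

text \<open>A cycle commutes with \<open>d\<close> up to sign, hence maps boundaries to boundaries
  in each of its degrees.\<close>

lemma Z_rad:
  assumes f: "f \<in> Z" and x: "x \<in> rad i" and j: "j = i - n"
  shows "f n i x \<in> rad j"
proof (rule rad_map[OF _ _ x])
  show "f n i \<in> module_hom R (P i) (P j)" by (rule E_hom[OF Z_E[OF f] j])
  fix z assume z: "z \<in> carrier (P (i + 1))"
  have e: "i + 1 - n = j + 1" "j + 1 - 1 = j" "i + 1 - 1 = i" using j by auto
  have 1: "f n (i + 1) z \<in> carrier (P (j + 1))" by (rule E_closed[OF Z_E[OF f] z]) (simp add: j)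
  have 2: "f n i (d (i + 1) z) \<in> carrier (P j)"
    using hom_closed[OF E_hom[OF Z_E[OF f] j] d_closed[OF z, unfolded e(3)]] .
  have "f n i (d (i + 1) z) = parity n \<odot>\<^bsub>P j\<^esub> (parity n \<odot>\<^bsub>P j\<^esub> f n i (d (i + 1) z))"
    using 2 by (simp add: P.smult_assoc1[symmetric] parity_sq)
  also have "parity n \<odot>\<^bsub>P j\<^esub> f n i (d (i + 1) z) = d (j + 1) (f n (i + 1) z)"
    using Z_comm[OF f z, of n] unfolding e ..
  finally show "f n i (d (i + 1) z) \<in> rad j"
    using rad_smult_closed[OF parity_closed rad_d[OF 1]] by simp
qed

lemma finsum_rad:
  assumes "finite Q" "\<And>q. q \<in> Q \<Longrightarrow> f q \<in> rad i"
  shows "(\<Oplus>\<^bsub>P i\<^esub>q\<in>Q. f q) \<in> rad i"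
  using assms
proof induction
  case empty
  show ?case by (simp add: rad_zero)
next
  case (insert q Q)
  have "f \<in> Q \<rightarrow> carrier (P i)" "f q \<in> carrier (P i)" using insert.prems rad_closed by auto
  thus ?case using insert by (simp add: rad_add)
qed

definition homogeneous :: "int \<Rightarrow> (int \<Rightarrow> int \<Rightarrow> 'b \<Rightarrow> 'b) \<Rightarrow> bool" where
  "homogeneous n f \<longleftrightarrow> f \<in> Z \<and> (\<forall>p i. p \<noteq> n \<longrightarrow> (\<forall>x\<in>carrier (P i). f p i x = \<zero>\<^bsub>P (i - p)\<^esub>))"

lemma homogeneousD: "homogeneous n f \<Longrightarrow> f \<in> Z"
  and homogeneous_zero: "\<lbrakk>homogeneous n f; p \<noteq> n; x \<in> carrier (P i)\<rbrakk> \<Longrightarrow> f p i x = \<zero>\<^bsub>P (i - p)\<^esub>"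
  by (auto simp: homogeneous_def)

lemma ext_component_eq: "ext_component R P d n = cls ` Collect (homogeneous n)"
  by (auto simp: ext_component_def homogeneous_def cls_E)

lemma homogeneous_add: "\<lbrakk>homogeneous n f; homogeneous n g\<rbrakk> \<Longrightarrow> homogeneous n (f \<oplus>\<^bsub>E\<^esub> g)"
  by (simp add: homogeneous_def Z_add)

lemma homogeneous_smult: "\<lbrakk>r \<in> carrier R; homogeneous n f\<rbrakk> \<Longrightarrow> homogeneous n (r \<odot>\<^bsub>E\<^esub> f)"
  by (simp add: homogeneous_def Z_smult)

lemma homogeneous_diff: "\<lbrakk>homogeneous n f; homogeneous n g\<rbrakk> \<Longrightarrow> homogeneous n (f \<ominus>\<^bsub>E\<^esub> g)"
  using Z_E by (simp add: homogeneous_def Z_add Z_neg a_minus_def P.neg_zero)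

lemma homogeneous_mult_app:
  assumes f: "f \<in> Z" and g: "homogeneous n g" and x: "x \<in> carrier (P i)"
  shows "(f \<otimes>\<^bsub>E\<^esub> g) p i x = f (p - n) (i - n) (g n i x)"
proof -
  note gE = Z_E[OF homogeneousD[OF g]]
  have "f (p - n) (i - n) (g n i x) \<in> carrier (P (i - p))"
    by (rule E_closed[OF Z_E[OF f] E_closed'[OF gE x]]) simp
  thus ?thesis
    using mult_app[OF Z_E[OF f] gE x, of "{n}" p] homogeneous_zero[OF g _ x] by simp
qed

lemma homogeneous_mult:
  assumes f: "homogeneous k f" and g: "homogeneous n g"
  shows "homogeneous (k + n) (f \<otimes>\<^bsub>E\<^esub> g)"
  unfolding homogeneous_def
proof (intro conjI allI impI ballI)
  show "f \<otimes>\<^bsub>E\<^esub> g \<in> Z" by (rule Z_mult) (use f g homogeneousD in auto)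
  fix p i x assume p: "p \<noteq> k + n" and x: "x \<in> carrier (P i)"
  have "f (p - n) (i - n) (g n i x) = \<zero>\<^bsub>P (i - n - (p - n))\<^esub>"
    by (rule homogeneous_zero[OF f _ E_closed'[OF Z_E[OF homogeneousD[OF g]] x]]) (use p in auto)
  thus "(f \<otimes>\<^bsub>E\<^esub> g) p i x = \<zero>\<^bsub>P (i - p)\<^esub>"
    using homogeneous_mult_app[OF homogeneousD[OF f] g x] by simp
qed

text \<open>Linear algebra over the residue field, without passing to the quotient.\<close>

lemma functional_in_span:
  assumes M: "module R M" and "finite I"
    and \<phi>: "\<And>i. i \<in> I \<Longrightarrow> \<phi> i \<in> W"
    and W_hom: "\<And>w. w \<in> W \<Longrightarrow> w \<in> module_hom R M (self_module R)"
    and W_zero: "(\<lambda>x. \<zero>) \<in> W"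
    and W_add: "\<And>w w' r. \<lbrakk>w \<in> W; w' \<in> W; r \<in> carrier R\<rbrakk> \<Longrightarrow> (\<lambda>x. w x \<oplus> r \<otimes> w' x) \<in> W"
    and V: "V \<subseteq> carrier M" "\<And>x y r. \<lbrakk>x \<in> V; y \<in> V; r \<in> carrier R\<rbrakk> \<Longrightarrow> x \<ominus>\<^bsub>M\<^esub> (r \<odot>\<^bsub>M\<^esub> y) \<in> V"
    and \<chi>: "\<chi> \<in> module_hom R M (self_module R)"
    and vanish: "\<And>x. \<lbrakk>x \<in> V; \<And>i. i \<in> I \<Longrightarrow> \<phi> i x \<in> m\<rbrakk> \<Longrightarrow> \<chi> x \<in> m"
  shows "\<exists>w\<in>W. \<forall>x\<in>V. \<chi> x \<ominus> w x \<in> m"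
  using assms(2,3) \<chi> vanish
proof (induction I arbitrary: \<chi>)
  case empty
  have "\<chi> x \<ominus> \<zero> \<in> m" if "x \<in> V" for x
    using empty(3)[OF that] m_closed' by (simp add: a_minus_def)
  thus ?case by (intro bexI[OF _ W_zero] ballI)
next
  case (insert i I)
  interpret M: module R M by fact
  note W_cl = hom_closed[OF W_hom, simplified]
  have \<phi>i: "\<phi> i \<in> W" using insert.prems(1) by simp
  show ?case
  \<comment> \<open>If the new functional already vanishes modulo \<open>m\<close> on the common
    zeros of the others, it adds nothing. Otherwise some x0 in \<open>V\<close> separates it, and a
    multiple of it is subtracted from \<open>\<chi>\<close>.\<close>
  proof (cases "\<forall>x\<in>V. (\<forall>j\<in>I. \<phi> j x \<in> m) \<longrightarrow> \<phi> i x \<in> m")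
    case True
    show ?thesis
    proof (rule insert.IH)
      fix x assume "x \<in> V" "\<And>j. j \<in> I \<Longrightarrow> \<phi> j x \<in> m"
      thus "\<chi> x \<in> m" using True insert.prems(3) by auto
    qed (use insert.prems in auto)
  next
    case False
    then obtain x0 where x0: "x0 \<in> V" "\<And>j. j \<in> I \<Longrightarrow> \<phi> j x0 \<in> m" "\<phi> i x0 \<notin> m" by blast
    have x0M: "x0 \<in> carrier M" using x0 V by blast
    have a: "\<phi> i x0 \<in> carrier R" and c: "\<chi> x0 \<in> carrier R"
      using W_cl[OF \<phi>i x0M] hom_closed[OF insert.prems(2) x0M] by auto
    obtain q where q: "q \<in> carrier R" "q \<otimes> \<phi> i x0 = \<one>" using unit[OF a x0(3)] by blast
    \<comment> \<open>The quotient of \<open>\<chi>\<close> x0 by \<open>\<phi> i x0\<close>, so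
      that \<open>\<chi>\<close> - r \<open>\<phi> i\<close> vanishes at x0.\<close>
    define r where "r = \<chi> x0 \<otimes> q"
    have r: "r \<in> carrier R" using c q by (simp add: r_def)
    let ?\<chi> = "\<lambda>x. \<chi> x \<oplus> (\<ominus> r) \<otimes> \<phi> i x"
    have hom: "?\<chi> \<in> module_hom R M (self_module R)"
      using hom_plus[OF self_module insert.prems(2) hom_scale[OF self_module W_hom[OF \<phi>i], of "\<ominus> r"]] r by simp
    have "\<exists>w\<in>W. \<forall>x\<in>V. ?\<chi> x \<ominus> w x \<in> m"
    proof (rule insert.IH[OF _ hom])
      fix x assume x: "x \<in> V" and Ix: "\<And>j. j \<in> I \<Longrightarrow> \<phi> j x \<in> m"
      have xM: "x \<in> carrier M" using x V by blast
      note b = W_cl[OF \<phi>i xM] and e = hom_closed[OF insert.prems(2) xM, simplified]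
      let ?k = "\<phi> i x \<otimes> q"
      have k: "?k \<in> carrier R" using b q by simp
      \<comment> \<open>Moving x along x0 makes \<open>\<phi> i\<close> vanish and keeps the other
        functionals in \<open>m\<close>. At this point \<open>\<chi>\<close> takes the value that
        the modified functional has at x.\<close>
      let ?y = "x \<ominus>\<^bsub>M\<^esub> (?k \<odot>\<^bsub>M\<^esub> x0)"
      have y: "?y \<in> V" by (rule V(2)[OF x x0(1) k])
      have app: "w ?y = w x \<ominus> ?k \<otimes> w x0" if w: "w \<in> module_hom R M (self_module R)" for w
        using hom_minus[OF M self_module w xM, of "?k \<odot>\<^bsub>M\<^esub> x0"] hom_smult[OF w k x0M] k x0M
          hom_closed[OF w x0M] by (simp add: a_minus_def self_module_neg)
      have "\<phi> j ?y \<in> m" if j: "j \<in> I" for j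
      proof -
        have "\<phi> j \<in> W" using insert.prems(1) j by simp
        from app[OF W_hom[OF this]] show ?thesis
          using m_minus[OF Ix[OF j] m.I_l_closed[OF x0(2)[OF j] k]] by simp
      qed
      moreover have "\<phi> i ?y \<in> m"
      proof -
        have "\<phi> i ?y = \<phi> i x \<ominus> \<phi> i x \<otimes> (q \<otimes> \<phi> i x0)"
          using app[OF W_hom[OF \<phi>i]] b q(1) a by (simp add: m_assoc)
        also have "\<dots> = \<zero>" using b q(2) by (simp add: a_minus_def r_neg)
        finally show ?thesis by simp
      qed
      ultimately have "\<chi> ?y \<in> m" using insert.prems(3)[OF y] by blast
      also have "\<chi> ?y = ?\<chi> x"
        unfolding app[OF insert.prems(2)] r_def using b c e q(1) by algebra
      finally show "?\<chi> x \<in> m" .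
    qed (use insert.prems in auto)
    then obtain w where w: "w \<in> W" "\<And>x. x \<in> V \<Longrightarrow> ?\<chi> x \<ominus> w x \<in> m" by blast
    have "\<chi> x \<ominus> (w x \<oplus> r \<otimes> \<phi> i x) \<in> m" if x: "x \<in> V" for x
    proof -
      have xM: "x \<in> carrier M" using x V by blast
      have "\<chi> x \<ominus> (w x \<oplus> r \<otimes> \<phi> i x) = ?\<chi> x \<ominus> w x"
        using W_cl[OF \<phi>i xM] W_cl[OF w(1) xM] hom_closed[OF insert.prems(2) xM, simplified] r by algebra
      thus ?thesis using w(2)[OF x] by simp
    qed
    thus ?thesis by (intro bexI[OF _ W_add[OF w(1) \<phi>i r]] ballI)
  qed
qed

end

section \<open>Classes of degrees one and two in terms of generators of m\<close>

context koszul
begin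

lemma m_lift: "r \<in> m \<Longrightarrow> \<exists>l\<in>carrier F. \<delta> l = r"
  unfolding \<delta>_image[symmetric] by (erule imageE) (rule bexI, simp_all)

text \<open>Since \<open>\<delta>\<close>(a) = 0, both \<open>\<delta>\<close>(y) s and
  \<open>\<tau> y a\<close> have boundary \<open>\<delta>\<close>(y) t(a); a linear comparison gives
  \<open>u\<close>. At y = a both terms of d(u a) vanish, the second because \<open>\<tau>\<close>
  is alternating, and exactness gives \<open>v\<close>.\<close>

lemma tate_variable_exists:
  assumes s: "s \<in> carrier (P 2)" and a: "a \<in> carrier F" "\<And>i. a i \<in> m2" and ds: "d 2 s = t a" and \<delta>a: "\<delta> a = \<zero>"
  obtains u v where "tate_variable R P d m \<rho> \<omega> n \<delta> t \<tau> s a u v"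
proof -
  have f: "(\<lambda>y. \<delta> y \<odot>\<^bsub>P 2\<^esub> s) \<in> module_hom R F (P 2)" by (rule hom_smult_vec[OF P_module \<delta>_hom s])
  note g = alternating_hom[OF \<tau>_alternating a(1)]
  have "d 2 (\<delta> y \<odot>\<^bsub>P 2\<^esub> s) = d 2 (\<tau> y a)" if y: "y \<in> carrier F" for y
  proof -
    have "d 2 (\<tau> y a) = (\<delta> y \<odot>\<^bsub>P 1\<^esub> t a) \<ominus>\<^bsub>P 1\<^esub> (\<zero> \<odot>\<^bsub>P 1\<^esub> t y)" using d_\<tau>[OF y a(1)] \<delta>a by simp
    also have "\<dots> = \<delta> y \<odot>\<^bsub>P 1\<^esub> t a" using \<delta>_closed[OF y] t_closed[OF y] t_closed[OF a(1)] by algebra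
    finally show ?thesis using hom_smult[OF d_hom[of 2] \<delta>_closed[OF y] s] ds by simp
  qed
  then obtain u where u: "u \<in> module_hom R F (P 3)"
      "\<And>y. y \<in> carrier F \<Longrightarrow> \<delta> y \<odot>\<^bsub>P 2\<^esub> s = \<tau> y a \<oplus>\<^bsub>P 2\<^esub> d 3 (u y)"
    using tuples_lift_diff[OF _ f g] by auto
  have du: "d 3 (u y) = (\<delta> y \<odot>\<^bsub>P 2\<^esub> s) \<ominus>\<^bsub>P 2\<^esub> \<tau> y a" if y: "y \<in> carrier F" for y
    unfolding u(2)[OF y] using \<tau>_closed[OF y a(1)] d_closed[OF hom_closed[OF u(1) y], simplified] by algebra
  have "d 3 (u a) = \<zero>\<^bsub>P 2\<^esub>"
    unfolding du[OF a(1)] \<delta>a alternating_diag[OF \<tau>_alternating a(1)] using s by (simp add: a_minus_def P.neg_zero)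
  then obtain v where v: "v \<in> carrier (P 4)" "d 4 v = u a"
    using exact[of 3 "u a"] hom_closed[OF u(1) a(1)] by auto
  have "tate_variable R P d m \<rho> \<omega> n \<delta> t \<tau> s a u v"
    by unfold_locales (use s a ds u(1) du v in auto)
  thus thesis by (rule that)
qed

lemma degree_one_Z:
  assumes h: "h \<in> Z"
  shows "degree_one R P d m \<rho> \<omega> n \<delta> t \<tau> (h 1)"
proof unfold_locales
  fix i x
  show "h 1 i \<in> module_hom R (P i) (P (i - 1))" by (rule E_hom[OF Z_E[OF h] refl])
  assume x: "x \<in> carrier (P i)"
  have "h 1 (i - 1) (d i x) \<in> carrier (P (i - 2))" by (rule E_closed[OF Z_E[OF h] d_closed[OF x]]) simp
  thus "d (i - 1) (h 1 i x) = \<ominus>\<^bsub>P (i - 2)\<^esub> h 1 (i - 1) (d i x)"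
    using Z_comm[OF h x, of 1] by (simp add: parity_def P.smult_l_minus)
qed

text \<open>A null homotopy of \<open>f\<close> may start from any \<open>g0\<close> from P_1 to P_0
  for which f - g0 d has augmentation zero. If y is d x + t(l) after a correction by
  \<open>\<kappa>\<close>, then g0(y) is taken congruent to f(x); \<open>vanish\<close> controls the
  ambiguity of x.\<close>

lemma coboundary:
  assumes f: "homogeneous 2 f"
    and vanish: "\<And>s a. \<lbrakk>s \<in> carrier (P 2); a \<in> carrier F; d 2 s = t a\<rbrakk> \<Longrightarrow> \<rho> (f 2 2 s) \<in> m"
  shows "f \<in> Bd"
proof -
  note fZ = homogeneousD[OF f]
  have f2: "f 2 2 \<in> module_hom R (P 2) (P 0)" by (rule E_hom[OF Z_E[OF fZ]]) simp
  have \<rho>f: "(\<lambda>x. \<rho> (f 2 2 x)) \<in> module_hom R (P 2) (self_module R)" by (rule hom_comp[OF f2 \<rho>_hom])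
  have d1: "d 1 \<in> module_hom R (P 1) (P 0)" by (rule d_hom') simp
  have d2: "d 2 \<in> module_hom R (P 2) (P 1)" by (rule d_hom') simp
  \<comment> \<open>The correction leaves an element with boundary \<open>\<rho> (d 1 y)\<close>
    times \<open>\<omega>\<close>, which is also the boundary of t(l) for some tuple l.\<close>
  let ?\<pi> = "\<lambda>y. y \<ominus>\<^bsub>P 1\<^esub> \<kappa> (d 1 y)"
  have \<pi>: "?\<pi> \<in> module_hom R (P 1) (P 1)"
    by (intro hom_diff P_module hom_comp[OF d1 \<kappa>_hom]) (simp add: module_hom_def)
  \<comment> \<open>A relation and not a map, since x and l are not unique;
    \<open>free_selection\<close> extracts a linear choice.\<close>
  let ?S = "\<lambda>y p. \<exists>x\<in>carrier (P 2). \<exists>l\<in>carrier F. ?\<pi> y = d 2 x \<oplus>\<^bsub>P 1\<^esub> t l \<and> \<rho> p \<ominus> \<rho> (f 2 2 x) \<in> m"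
  have total: "\<exists>p\<in>carrier (P 0). ?S y p" if y: "y \<in> carrier (P 1)" for y
  proof -
    have dy: "d 1 y \<in> carrier (P 0)" using hom_closed[OF d1 y] .
    obtain l where l: "l \<in> carrier F" "\<delta> l = \<rho> (d 1 y)" using m_lift[OF \<rho>_d[OF y]] by blast
    note \<kappa>c = hom_closed[OF \<kappa>_hom dy]
    have "d 1 (?\<pi> y) = d 1 y \<ominus>\<^bsub>P 0\<^esub> (d 1 y \<ominus>\<^bsub>P 0\<^esub> (\<rho> (d 1 y) \<odot>\<^bsub>P 0\<^esub> \<omega>))"
      using hom_P_minus[OF d1 y \<kappa>c] d_\<kappa>[OF dy] by simp
    also have "\<dots> = \<rho> (d 1 y) \<odot>\<^bsub>P 0\<^esub> \<omega>" using dy \<rho>_closed[OF dy] \<omega>_closed by algebra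
    also have "\<dots> = d 1 (t l)" using d_t[OF l(1)] l(2) by simp
    finally obtain x where x: "x \<in> carrier (P 2)" "?\<pi> y = t l \<oplus>\<^bsub>P 1\<^esub> d 2 x"
      using exact_diff[of 1 "?\<pi> y" "t l"] hom_closed[OF \<pi> y] t_closed[OF l(1)] by auto
    have fx: "f 2 2 x \<in> carrier (P 0)" by (rule hom_closed[OF f2 x(1)])
    have "?\<pi> y = d 2 x \<oplus>\<^bsub>P 1\<^esub> t l"
      using x t_closed[OF l(1)] hom_closed[OF d2 x(1)] by (simp add: P.M.a_comm)
    moreover have "\<rho> (f 2 2 x) \<ominus> \<rho> (f 2 2 x) \<in> m" using \<rho>_closed[OF fx] by (simp add: a_minus_def r_neg)
    ultimately show ?thesis using x(1) l(1) fx by blast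
  qed
  obtain g0 where g0: "g0 \<in> module_hom R (P 1) (P 0)" "\<And>y. y \<in> carrier (P 1) \<Longrightarrow> ?S y (g0 y)"
  proof (rule free_selection[OF P_free P_module total])
    fix y y' p p' assume y: "y \<in> carrier (P 1)" "y' \<in> carrier (P 1)" and p: "p \<in> carrier (P 0)" "p' \<in> carrier (P 0)"
      and "?S y p" "?S y' p'"
    then obtain x l x' l' where
      x: "x \<in> carrier (P 2)" "l \<in> carrier F" "?\<pi> y = d 2 x \<oplus>\<^bsub>P 1\<^esub> t l" "\<rho> p \<ominus> \<rho> (f 2 2 x) \<in> m" and
      x': "x' \<in> carrier (P 2)" "l' \<in> carrier F" "?\<pi> y' = d 2 x' \<oplus>\<^bsub>P 1\<^esub> t l'" "\<rho> p' \<ominus> \<rho> (f 2 2 x') \<in> m" by blast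
    note cl = hom_closed[OF d2 x(1)] hom_closed[OF d2 x'(1)] t_closed[OF x(2)] t_closed[OF x'(2)]
      \<rho>_closed[OF p(1)] \<rho>_closed[OF p(2)] \<rho>_closed[OF hom_closed[OF f2 x(1)]] \<rho>_closed[OF hom_closed[OF f2 x'(1)]]
    have "?\<pi> (y \<oplus>\<^bsub>P 1\<^esub> y') = d 2 (x \<oplus>\<^bsub>P 2\<^esub> x') \<oplus>\<^bsub>P 1\<^esub> t (l \<oplus>\<^bsub>F\<^esub> l')"
      unfolding hom_add[OF \<pi> y] x(3) x'(3) hom_add[OF d2 x(1) x'(1)] hom_add[OF t_hom x(2) x'(2)]
      using cl by algebra
    moreover have "\<rho> (p \<oplus>\<^bsub>P 0\<^esub> p') \<ominus> \<rho> (f 2 2 (x \<oplus>\<^bsub>P 2\<^esub> x')) =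
        (\<rho> p \<ominus> \<rho> (f 2 2 x)) \<oplus> (\<rho> p' \<ominus> \<rho> (f 2 2 x'))"
      unfolding hom_add[OF \<rho>_hom p, simplified] hom_add[OF \<rho>f x(1) x'(1), simplified] using cl by algebra
    moreover have "\<dots> \<in> m" using x(4) x'(4) by simp
    ultimately show "?S (y \<oplus>\<^bsub>P 1\<^esub> y') (p \<oplus>\<^bsub>P 0\<^esub> p')"
      using P.M.a_closed[OF x(1) x'(1)] F.M.a_closed[OF x(2) x'(2)] by auto
  next
    fix r y p assume r: "r \<in> carrier R" and y: "y \<in> carrier (P 1)" and p: "p \<in> carrier (P 0)" and "?S y p"
    then obtain x l where
      x: "x \<in> carrier (P 2)" "l \<in> carrier F" "?\<pi> y = d 2 x \<oplus>\<^bsub>P 1\<^esub> t l" "\<rho> p \<ominus> \<rho> (f 2 2 x) \<in> m" by blast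
    note cl = hom_closed[OF d2 x(1)] t_closed[OF x(2)] \<rho>_closed[OF p] \<rho>_closed[OF hom_closed[OF f2 x(1)]] r
    have "?\<pi> (r \<odot>\<^bsub>P 1\<^esub> y) = d 2 (r \<odot>\<^bsub>P 2\<^esub> x) \<oplus>\<^bsub>P 1\<^esub> t (r \<odot>\<^bsub>F\<^esub> l)"
      unfolding hom_smult[OF \<pi> r y] x(3) hom_smult[OF d2 r x(1)] hom_smult[OF t_hom r x(2)] using cl by algebra
    moreover have "\<rho> (r \<odot>\<^bsub>P 0\<^esub> p) \<ominus> \<rho> (f 2 2 (r \<odot>\<^bsub>P 2\<^esub> x)) = r \<otimes> (\<rho> p \<ominus> \<rho> (f 2 2 x))"
      unfolding hom_smult[OF \<rho>_hom r p, simplified] hom_smult[OF \<rho>f r x(1), simplified] using cl by algebra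
    moreover have "\<dots> \<in> m" using m.I_l_closed[OF x(4) r] .
    ultimately show "?S (r \<odot>\<^bsub>P 1\<^esub> y) (r \<odot>\<^bsub>P 0\<^esub> p)"
      using P.smult_closed[OF r x(1)] F.smult_closed[OF r x(2)] by auto
  qed (assumption, rule that)
  have "\<rho> (f 2 2 x0 \<ominus>\<^bsub>P 0\<^esub> g0 (d 2 x0)) \<in> m" if x0: "x0 \<in> carrier (P 2)" for x0
  proof -
    note dx0 = hom_closed[OF d2 x0]
    obtain x l where
      x: "x \<in> carrier (P 2)" "l \<in> carrier F" "?\<pi> (d 2 x0) = d 2 x \<oplus>\<^bsub>P 1\<^esub> t l" "\<rho> (g0 (d 2 x0)) \<ominus> \<rho> (f 2 2 x) \<in> m"
      using g0(2)[OF dx0] by blast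
    \<comment> \<open>d x0 is a cycle and is fixed by \<open>?\<pi>\<close>. Its decomposition d x +
      t(l) shows that x0 - x has boundary t(l), so \<open>vanish\<close> applies to x0 - x.\<close>
    have "d 1 (d 2 x0) = \<zero>\<^bsub>P 0\<^esub>" using d_d[OF x0] by simp
    hence "?\<pi> (d 2 x0) = d 2 x0" using dx0 hom_P_zero[OF \<kappa>_hom] by (simp add: a_minus_def P.neg_zero)
    hence "d 2 (x0 \<ominus>\<^bsub>P 2\<^esub> x) = (d 2 x \<oplus>\<^bsub>P 1\<^esub> t l) \<ominus>\<^bsub>P 1\<^esub> d 2 x"
      using hom_P_minus[OF d2 x0 x(1)] x(3) by simp
    also have "\<dots> = t l" using hom_closed[OF d2 x(1)] t_closed[OF x(2)] by algebra
    finally have "\<rho> (f 2 2 (x0 \<ominus>\<^bsub>P 2\<^esub> x)) \<in> m" using vanish[OF P.M.minus_closed[OF x0 x(1)] x(2)] by simp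
    note fx0 = hom_closed[OF f2 x0] and fx = hom_closed[OF f2 x(1)] and g0x = hom_closed[OF g0(1) dx0]
    have \<rho>_minus: "\<rho> (p \<ominus>\<^bsub>P 0\<^esub> p') = \<rho> p \<ominus> \<rho> p'" if "p \<in> carrier (P 0)" "p' \<in> carrier (P 0)" for p p'
      using hom_minus[OF P_module self_module \<rho>_hom that] that by (simp add: a_minus_def self_module_neg \<rho>_closed)
    have "\<rho> (f 2 2 (x0 \<ominus>\<^bsub>P 2\<^esub> x)) = \<rho> (f 2 2 x0) \<ominus> \<rho> (f 2 2 x)"
      unfolding hom_P_minus[OF f2 x0 x(1)] by (rule \<rho>_minus[OF fx0 fx])
    hence "\<rho> (f 2 2 x0) \<ominus> \<rho> (f 2 2 x) \<in> m" using \<open>\<rho> (f 2 2 (x0 \<ominus>\<^bsub>P 2\<^esub> x)) \<in> m\<close> by simp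
    hence "(\<rho> (f 2 2 x0) \<ominus> \<rho> (f 2 2 x)) \<ominus> (\<rho> (g0 (d 2 x0)) \<ominus> \<rho> (f 2 2 x)) \<in> m" using x(4) by (rule m_minus)
    moreover have "(\<rho> (f 2 2 x0) \<ominus> \<rho> (f 2 2 x)) \<ominus> (\<rho> (g0 (d 2 x0)) \<ominus> \<rho> (f 2 2 x)) = \<rho> (f 2 2 x0) \<ominus> \<rho> (g0 (d 2 x0))"
      using \<rho>_closed[OF fx0] \<rho>_closed[OF fx] \<rho>_closed[OF g0x] by algebra
    ultimately show ?thesis using \<rho>_minus[OF fx0 g0x] by simp
  qed
  note start = this
  show ?thesis
  proof (rule extend_homotopy[of 1 f g0])
    show "\<Delta> f = \<zero>\<^bsub>E\<^esub>" using fZ by (simp add: Z_iff)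
    show "f n i x = \<zero>\<^bsub>P (i - n)\<^esub>" if "n \<noteq> 1 + 1" "x \<in> carrier (P i)" for n i x
      by (rule homogeneous_zero[OF f]) (use that in auto)
    show "\<rho> (f (1 + 1) (1 + 1) x \<ominus>\<^bsub>P 0\<^esub> g0 (d (1 + 1) x)) \<in> m" if "x \<in> carrier (P (1 + 1))" for x
      using start[of x] that by simp
    fix g assume "g \<in> carrier E" "\<Delta> g = f"
    thus "f \<in> Bd" using Bd_I by blast
  qed (use Z_E[OF fZ] g0(1) in auto)
qed

text \<open>The class reads off the j-th coefficient of the augmented boundary over the minimal
  generators. The coefficient is unique modulo \<open>m\<close> by \<open>\<delta>_minimal\<close>.
  Extending the homotopy for the zero map turns the resulting map on P_1 into a cycle.\<close>

lemma dual_class: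
  obtains h where "homogeneous 1 h" "\<And>y. y \<in> carrier F \<Longrightarrow> \<rho> (h 1 1 (t y)) \<ominus> y j \<in> m"
proof -
  have d1: "d 1 \<in> module_hom R (P 1) (P 0)" by (rule d_hom') simp
  have \<rho>d: "(\<lambda>y. \<rho> (d 1 y)) \<in> module_hom R (P 1) (self_module R)" by (rule hom_comp[OF d1 \<rho>_hom])
  let ?S = "\<lambda>y p. \<exists>l\<in>carrier F. \<delta> l = \<rho> (d 1 y) \<and> \<rho> p \<ominus> l j \<in> m"
  have total: "\<exists>p\<in>carrier (P 0). ?S y p" if y: "y \<in> carrier (P 1)" for y
  proof -
    obtain l where l: "l \<in> carrier F" "\<delta> l = \<rho> (d 1 y)" using m_lift[OF \<rho>_d[OF y]] by blast
    have "\<rho> (l j \<odot>\<^bsub>P 0\<^esub> \<omega>) \<ominus> l j = \<zero>"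
      using hom_smult[OF \<rho>_hom F_nth[OF l(1), of j] \<omega>_closed] \<rho>_\<omega> F_nth[OF l(1), of j] by (simp add: a_minus_def r_neg)
    thus ?thesis using l F_nth[OF l(1), of j] \<omega>_closed by (intro bexI[of _ "l j \<odot>\<^bsub>P 0\<^esub> \<omega>"]) auto
  qed
  obtain g0 where g0: "g0 \<in> module_hom R (P 1) (P 0)" "\<And>y. y \<in> carrier (P 1) \<Longrightarrow> ?S y (g0 y)"
  proof (rule free_selection[OF P_free P_module total])
    fix y y' p p' assume y: "y \<in> carrier (P 1)" "y' \<in> carrier (P 1)" and p: "p \<in> carrier (P 0)" "p' \<in> carrier (P 0)"
      and "?S y p" "?S y' p'"
    then obtain l l' where l: "l \<in> carrier F" "\<delta> l = \<rho> (d 1 y)" "\<rho> p \<ominus> l j \<in> m"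
      and l': "l' \<in> carrier F" "\<delta> l' = \<rho> (d 1 y')" "\<rho> p' \<ominus> l' j \<in> m" by blast
    have "\<delta> (l \<oplus>\<^bsub>F\<^esub> l') = \<rho> (d 1 (y \<oplus>\<^bsub>P 1\<^esub> y'))"
      using hom_add[OF \<delta>_hom l(1) l'(1)] hom_add[OF \<rho>d y] l(2) l'(2) by simp
    moreover have "\<rho> (p \<oplus>\<^bsub>P 0\<^esub> p') \<ominus> (l \<oplus>\<^bsub>F\<^esub> l') j = (\<rho> p \<ominus> l j) \<oplus> (\<rho> p' \<ominus> l' j)"
      unfolding hom_add[OF \<rho>_hom p, simplified] tuples_ops
      using \<rho>_closed[OF p(1)] \<rho>_closed[OF p(2)] F_nth[OF l(1), of j] F_nth[OF l'(1), of j] by algebra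
    moreover have "\<dots> \<in> m" using l(3) l'(3) by simp
    ultimately show "?S (y \<oplus>\<^bsub>P 1\<^esub> y') (p \<oplus>\<^bsub>P 0\<^esub> p')" using F.M.a_closed[OF l(1) l'(1)] by auto
  next
    fix r y p assume r: "r \<in> carrier R" and y: "y \<in> carrier (P 1)" and p: "p \<in> carrier (P 0)" and "?S y p"
    then obtain l where l: "l \<in> carrier F" "\<delta> l = \<rho> (d 1 y)" "\<rho> p \<ominus> l j \<in> m" by blast
    have "\<delta> (r \<odot>\<^bsub>F\<^esub> l) = \<rho> (d 1 (r \<odot>\<^bsub>P 1\<^esub> y))"
      using hom_smult[OF \<delta>_hom r l(1)] hom_smult[OF \<rho>d r y] l(2) by simp
    moreover have "\<rho> (r \<odot>\<^bsub>P 0\<^esub> p) \<ominus> (r \<odot>\<^bsub>F\<^esub> l) j = r \<otimes> (\<rho> p \<ominus> l j)"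
      unfolding hom_smult[OF \<rho>_hom r p, simplified] tuples_ops
      using \<rho>_closed[OF p] F_nth[OF l(1), of j] r by algebra
    moreover have "\<dots> \<in> m" using m.I_l_closed[OF l(3) r] .
    ultimately show "?S (r \<odot>\<^bsub>P 1\<^esub> y) (r \<odot>\<^bsub>P 0\<^esub> p)" using F.smult_closed[OF r l(1)] by auto
  qed (assumption, rule that)
  have start: "\<rho> (\<zero>\<^bsub>E\<^esub> (1 + 1) (1 + 1) x \<ominus>\<^bsub>P 0\<^esub> g0 (d (1 + 1) x)) \<in> m" if "x \<in> carrier (P (1 + 1))" for x
  proof -
    have x: "x \<in> carrier (P 2)" using that by simp
    note dx = d_closed[OF x, simplified]
    obtain l where l: "l \<in> carrier F" "\<delta> l = \<rho> (d 1 (d 2 x))" "\<rho> (g0 (d 2 x)) \<ominus> l j \<in> m" using g0(2)[OF dx] by blast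
    \<comment> \<open>The coefficients of d d x form a relation among the generators, and minimality
      puts them into \<open>m\<close>.\<close>
    have "\<delta> l = \<zero>" using l(2) d_d[OF x] hom_zero[OF P_module self_module \<rho>_hom] by simp
    hence lj: "l j \<in> m" by (rule \<delta>_minimal[OF l(1)])
    note g = hom_closed[OF g0(1) dx]
    have "\<rho> (g0 (d 2 x)) = (\<rho> (g0 (d 2 x)) \<ominus> l j) \<oplus> l j" using \<rho>_closed[OF g] F_nth[OF l(1), of j] by algebra
    hence "\<rho> (g0 (d 2 x)) \<in> m" using l(3) lj m.a_closed by metis
    hence "g0 (d 2 x) \<in> rad 0" using rad0_iff[OF g] by simp
    hence "\<zero>\<^bsub>P 0\<^esub> \<ominus>\<^bsub>P 0\<^esub> g0 (d 2 x) \<in> rad 0" by (rule rad_minus[OF rad_zero])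
    thus ?thesis using x \<rho>_rad by simp
  qed
  obtain h where h: "h \<in> carrier E" "\<Delta> h = \<zero>\<^bsub>E\<^esub>" "\<And>x. x \<in> carrier (P 1) \<Longrightarrow> h 1 1 x = g0 x"
    "\<And>n i x. \<lbrakk>n \<noteq> 1; x \<in> carrier (P i)\<rbrakk> \<Longrightarrow> h n i x = \<zero>\<^bsub>P (i - n)\<^esub>"
  proof (rule extend_homotopy[OF _ EM.M.zero_closed _ _ g0(1) start])
    show "\<Delta> \<zero>\<^bsub>E\<^esub> = \<zero>\<^bsub>E\<^esub>" by (rule hom_zero[OF E_module E_module \<Delta>_hom])
  qed auto
  have "\<rho> (h 1 1 (t y)) \<ominus> y j \<in> m" if y: "y \<in> carrier F" for y
  proof -
    note ty = t_closed[OF y]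
    obtain l where l: "l \<in> carrier F" "\<delta> l = \<rho> (d 1 (t y))" "\<rho> (g0 (t y)) \<ominus> l j \<in> m" using g0(2)[OF ty] by blast
    have "\<delta> l = \<delta> y" using l(2) d_t[OF y] hom_smult[OF \<rho>_hom \<delta>_closed[OF y] \<omega>_closed] \<rho>_\<omega> \<delta>_closed[OF y] by simp
    hence "\<delta> (l \<oplus>\<^bsub>F\<^esub> (\<ominus> \<one> \<odot>\<^bsub>F\<^esub> y)) = \<delta> y \<oplus> \<ominus> \<one> \<otimes> \<delta> y"
      using hom_add[OF \<delta>_hom l(1)] hom_smult[OF \<delta>_hom _ y] y by simp
    also have "\<dots> = \<zero>" using \<delta>_closed[OF y] by algebra
    finally have "(l \<oplus>\<^bsub>F\<^esub> (\<ominus> \<one> \<odot>\<^bsub>F\<^esub> y)) j \<in> m" using \<delta>_minimal l(1) y by simp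
    hence "(\<rho> (g0 (t y)) \<ominus> l j) \<oplus> (l j \<oplus> \<ominus> \<one> \<otimes> y j) \<in> m" using l(3) by (simp add: tuples_ops)
    moreover have "(\<rho> (g0 (t y)) \<ominus> l j) \<oplus> (l j \<oplus> \<ominus> \<one> \<otimes> y j) = \<rho> (g0 (t y)) \<ominus> y j"
      using \<rho>_closed[OF hom_closed[OF g0(1) ty]] F_nth[OF l(1), of j] F_nth[OF y, of j] by algebra
    ultimately show ?thesis using h(3)[OF ty] by simp
  qed
  moreover have "homogeneous 1 h" using h by (simp add: homogeneous_def Z_iff)
  ultimately show thesis using that by blast
qed

lemma hom_in_m:
  assumes f: "f \<in> module_hom R (tuples R k) (self_module R)" and a: "a \<in> carrier (tuples R k)" "\<And>i. i < k \<Longrightarrow> a i \<in> m"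
  shows "f a \<in> m"
proof (rule hom_tuples_in[OF self_module f _ _ _ a(1)])
  fix i assume i: "i < k"
  show "a i \<odot>\<^bsub>self_module R\<^esub> f (unit_tuple R i) \<in> m"
    using m.I_r_closed[OF a(2)[OF i]] hom_closed[OF f unit_tuple_closed[OF i]] by simp
qed auto

text \<open>By \<open>h2_lift\<close>, h_j(s) is - t(b) up to terms that h_i sends into
  \<open>rad 0\<close>, where \<open>\<delta>\<close>(b) = c_j(a). Thus h_i h_j at s is - b_i modulo
  m. If all these vanish, c_j(a) is in m^2, and c_j(a) agrees with a_j modulo m^2.\<close>

lemma products_detect:
  assumes h: "\<And>j. j < n \<Longrightarrow> h j \<in> Z" "\<And>j y. \<lbrakk>j < n; y \<in> carrier F\<rbrakk> \<Longrightarrow> \<rho> (h j 1 1 (t y)) \<ominus> y j \<in> m"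
    and s: "s \<in> carrier (P 2)" and a: "a \<in> carrier F" and ds: "d 2 s = t a" and \<delta>a: "\<delta> a = \<zero>"
    and products: "\<And>i j. \<lbrakk>i < n; j < n\<rbrakk> \<Longrightarrow> \<rho> (h i 1 1 (h j 1 2 s)) \<in> m"
  shows "a j \<in> m2"
proof (cases "j < n")
  case False
  thus ?thesis using a m2_zero by (simp add: in_tuples)
next
  case j: True
  interpret h: degree_one R P d m \<rho> \<omega> n \<delta> t \<tau> "h j 1" by (rule degree_one_Z[OF h(1)[OF j]])
  have am: "a i \<in> m" for i by (rule \<delta>_minimal[OF a \<delta>a])
  have "h.c a \<in> m" by (rule hom_in_m[OF h.c_hom a am])
  then obtain b where b: "b \<in> carrier F" "\<delta> b = h.c a" using m_lift by blast
  obtain q where q: "q \<in> carrier (P 2)" "h j 1 2 s = (\<ominus>\<^bsub>P 1\<^esub> t b \<ominus>\<^bsub>P 1\<^esub> h.p a) \<oplus>\<^bsub>P 1\<^esub> d 2 q"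
    using h.h2_lift[OF s a ds b] by blast
  have bm: "b i \<in> m" for i
  proof (cases "i < n")
    case False
    thus ?thesis using b(1) by (simp add: in_tuples)
  next
    case i: True
    have hi: "h i 1 1 \<in> module_hom R (P 1) (P 0)" by (rule E_hom[OF Z_E[OF h(1)[OF i]]]) simp
    note tb = t_closed[OF b(1)] and pa = h.p_closed[OF a] and dq = d_closed[OF q(1), simplified]
    have "h i 1 1 (h.p a) \<in> rad 0" by (rule hom_in_rad[OF hom_comp[OF h.p_hom hi] a am])
    moreover have "h i 1 1 (d 2 q) \<in> rad 0"
      by (rule Z_rad[OF h(1)[OF i] rad_d[of q 1, simplified]]) (use q(1) in auto)
    moreover have "h i 1 1 (h j 1 2 s) \<in> rad 0"
      using rad0_iff products[OF i j] hom_closed[OF hi h.h_closed[OF s, simplified]] by blast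
    ultimately have "(h i 1 1 (d 2 q) \<ominus>\<^bsub>P 0\<^esub> h i 1 1 (h.p a)) \<ominus>\<^bsub>P 0\<^esub> h i 1 1 (h j 1 2 s) \<in> rad 0"
      by (intro rad_minus)
    moreover have "(h i 1 1 (d 2 q) \<ominus>\<^bsub>P 0\<^esub> h i 1 1 (h.p a)) \<ominus>\<^bsub>P 0\<^esub> h i 1 1 (h j 1 2 s) = h i 1 1 (t b)"
    proof -
      have "h i 1 1 (h j 1 2 s) = (\<ominus>\<^bsub>P 0\<^esub> h i 1 1 (t b) \<ominus>\<^bsub>P 0\<^esub> h i 1 1 (h.p a)) \<oplus>\<^bsub>P 0\<^esub> h i 1 1 (d 2 q)"
        unfolding q(2) using tb pa dq by (simp add: hom_add[OF hi] hom_P_minus[OF hi] hom_P_neg[OF hi])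
      thus ?thesis using hom_closed[OF hi tb] hom_closed[OF hi pa] hom_closed[OF hi dq] by algebra
    qed
    ultimately have "\<rho> (h i 1 1 (t b)) \<in> m" using \<rho>_rad by simp
    hence "\<rho> (h i 1 1 (t b)) \<ominus> (\<rho> (h i 1 1 (t b)) \<ominus> b i) \<in> m" by (rule m_minus[OF _ h(2)[OF i b(1)]])
    moreover have "\<rho> (h i 1 1 (t b)) \<ominus> (\<rho> (h i 1 1 (t b)) \<ominus> b i) = b i"
      using \<rho>_closed[OF hom_closed[OF hi tb]] F_nth[OF b(1), of i] by algebra
    ultimately show ?thesis by simp
  qed
  have cm2: "h.c a \<in> m2" using m2I[OF b(1) bm] b(2) by simp
  have nth: "(\<lambda>y. y j) \<in> module_hom R F (self_module R)"
    by (rule module_homI) (auto simp: tuples_ops in_tuples)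
  \<comment> \<open>The difference of c_j and the j-th coordinate takes values in \<open>m\<close>
    on unit tuples. As \<open>a\<close> has entries in \<open>m\<close>, its value at
    \<open>a\<close> lies in m^2.\<close>
  let ?\<mu> = "\<lambda>y. h.c y \<ominus>\<^bsub>self_module R\<^esub> y j"
  have \<mu>: "?\<mu> \<in> module_hom R F (self_module R)" by (rule hom_diff[OF self_module h.c_hom nth])
  have \<mu>_eq: "?\<mu> y = h.c y \<ominus> y j" if "y \<in> carrier F" for y
    using that by (simp add: a_minus_def self_module_neg F_nth)
  have "?\<mu> a \<in> m2"
  proof (rule hom_tuples_in[OF self_module \<mu> _ _ _ a])
    fix i assume i: "i < n"
    have "?\<mu> (unit_tuple R i) \<in> m"
      using h(2)[OF j unit_tuple_closed[OF i]] unfolding \<mu>_eq[OF unit_tuple_closed[OF i]] unfolding h.c_def .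
    thus "a i \<odot>\<^bsub>self_module R\<^esub> ?\<mu> (unit_tuple R i) \<in> m2" using m2_mult[OF am] by simp
  qed (auto simp: m2_zero m2_add)
  hence "h.c a \<oplus> (\<ominus> \<one>) \<otimes> (h.c a \<ominus> a j) \<in> m2"
    unfolding \<mu>_eq[OF a] using m2_add[OF cm2 m2_smult[of "\<ominus> \<one>"]] by simp
  moreover have "h.c a \<oplus> (\<ominus> \<one>) \<otimes> (h.c a \<ominus> a j) = a j"
    using h.c_closed[OF a] F_nth[OF a, of j] by algebra
  ultimately show ?thesis by simp
qed

end

section \<open>The action of the degree-one subalgebra on the divided square\<close>

context tate_variable
begin

text \<open>The cycles that act on \<open>v\<close>, modulo \<open>rad\<close>, only as scalars in
  degree zero. This condition contains the classes of degree one and is stable under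
  products.\<close>

definition K where
  "K = {f \<in> Z. (\<forall>n. n \<noteq> 0 \<longrightarrow> f n 4 v \<in> rad (4 - n)) \<and>
    (\<exists>r\<in>carrier R. \<exists>w\<in>rad 4. f 0 4 v = (r \<odot>\<^bsub>P 4\<^esub> v) \<oplus>\<^bsub>P 4\<^esub> w)}"

lemma K_Z: "f \<in> K \<Longrightarrow> f \<in> Z"
  by (simp add: K_def)

lemma K_rad: "\<lbrakk>f \<in> K; k \<noteq> 0\<rbrakk> \<Longrightarrow> f k 4 v \<in> rad (4 - k)"
  by (simp add: K_def)

lemma K_zero_component:
  "f \<in> K \<Longrightarrow> \<exists>r\<in>carrier R. \<exists>w\<in>rad 4. f 0 4 v = (r \<odot>\<^bsub>P 4\<^esub> v) \<oplus>\<^bsub>P 4\<^esub> w"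
  by (simp add: K_def)

lemma K_I:
  assumes "f \<in> Z" "\<And>n. n \<noteq> 0 \<Longrightarrow> f n 4 v \<in> rad (4 - n)"
    and "r \<in> carrier R" "w \<in> rad 4" "f 0 4 v = (r \<odot>\<^bsub>P 4\<^esub> v) \<oplus>\<^bsub>P 4\<^esub> w"
  shows "f \<in> K"
  using assms unfolding K_def by blast

text \<open>In the sum defining the product, the components of \<open>g\<close> of nonzero degree
  send \<open>v\<close> into \<open>rad\<close>, where \<open>f\<close> keeps them; the component of
  degree zero contributes a multiple of f(v). It serves both for the closure of \<open>K\<close> and
  for the right action on arbitrary cycles.\<close>

lemma mult_K:
  assumes f: "f \<in> Z" and g: "g \<in> K"
  shows "\<exists>r\<in>carrier R. \<exists>w\<in>rad (4 - k). (f \<otimes>\<^bsub>E\<^esub> g) k 4 v = (r \<odot>\<^bsub>P (4 - k)\<^esub> f k 4 v) \<oplus>\<^bsub>P (4 - k)\<^esub> w"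
proof -
  let ?N = "P (4 - k)"
  obtain r w0 where r: "r \<in> carrier R" and w0: "w0 \<in> rad 4" and g0: "g 0 4 v = (r \<odot>\<^bsub>P 4\<^esub> v) \<oplus>\<^bsub>P 4\<^esub> w0"
    using K_zero_component[OF g] by (elim bexE)
  note gZ = K_Z[OF g] and gE = Z_E[OF K_Z[OF g]] and fE = Z_E[OF f]
  let ?h = "\<lambda>q. f (k - q) (4 - q) (g q 4 v)"
  let ?Q = "degrees g - {0}"
  have hc: "?h q \<in> carrier ?N" for q by (rule E_closed[OF fE E_closed'[OF gE v_closed]]) simp
  have Q: "finite ?Q" using E_finite[OF gE] by simp
  have fn: "f k 4 \<in> module_hom R (P 4) ?N" by (rule E_hom[OF fE refl])
  have h0: "?h 0 = (r \<odot>\<^bsub>?N\<^esub> f k 4 v) \<oplus>\<^bsub>?N\<^esub> f k 4 w0"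
    using g0 r rad_closed[OF w0] v_closed by (simp add: hom_add[OF fn] hom_smult[OF fn])
  have w0': "f k 4 w0 \<in> rad (4 - k)" by (rule Z_rad[OF f w0 refl])
  have "?h q \<in> rad (4 - k)" if "q \<in> ?Q" for q
    by (rule Z_rad[OF f K_rad[OF g]]) (use that in auto)
  hence S: "(\<Oplus>\<^bsub>?N\<^esub>q\<in>?Q. ?h q) \<in> rad (4 - k)" by (rule finsum_rad[OF Q])
  have "(f \<otimes>\<^bsub>E\<^esub> g) k 4 v = (\<Oplus>\<^bsub>?N\<^esub>q\<in>insert 0 ?Q. ?h q)"
    by (rule mult_app[OF fE gE v_closed]) (use Q in \<open>auto intro: notin_degrees[OF _ v_closed]\<close>)
  also have "\<dots> = ?h 0 \<oplus>\<^bsub>?N\<^esub> (\<Oplus>\<^bsub>?N\<^esub>q\<in>?Q. ?h q)"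
    by (rule P.M.finsum_insert) (use Q hc hc[of 0] in auto)
  also have "\<dots> = (r \<odot>\<^bsub>?N\<^esub> f k 4 v) \<oplus>\<^bsub>?N\<^esub> (f k 4 w0 \<oplus>\<^bsub>?N\<^esub> (\<Oplus>\<^bsub>?N\<^esub>q\<in>?Q. ?h q))"
    unfolding h0 using E_closed'[OF fE v_closed] r rad_closed[OF w0'] rad_closed[OF S]
    by (simp add: P.M.a_assoc)
  finally show ?thesis using r rad_add[OF w0' S] by blast
qed

lemma K_subalgebra: "subalgebra_over (R Quot m) Ext (cls ` K)"
proof (rule Ext_subalgebra)
  show "K \<subseteq> Z" using K_Z by blast
  show "\<one>\<^bsub>E\<^esub> \<in> K"
    by (rule K_I[OF Z_one _ one_closed rad_zero]) (use v_closed in \<open>auto simp: E_one_app rad_zero\<close>)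
next
  fix f g assume f: "f \<in> K" and g: "g \<in> K"
  obtain r w where r: "r \<in> carrier R" "w \<in> rad 4" "f 0 4 v = (r \<odot>\<^bsub>P 4\<^esub> v) \<oplus>\<^bsub>P 4\<^esub> w"
    using K_zero_component[OF f] by (elim bexE)
  obtain r' w' where r': "r' \<in> carrier R" "w' \<in> rad 4" "g 0 4 v = (r' \<odot>\<^bsub>P 4\<^esub> v) \<oplus>\<^bsub>P 4\<^esub> w'"
    using K_zero_component[OF g] by (elim bexE)
  show "f \<oplus>\<^bsub>E\<^esub> g \<in> K"
  proof (rule K_I[OF Z_add[OF K_Z[OF f] K_Z[OF g]] _ add.m_closed[OF r(1) r'(1)] rad_add[OF r(2) r'(2)]])
    show "(f \<oplus>\<^bsub>E\<^esub> g) n 4 v \<in> rad (4 - n)" if "n \<noteq> 0" for n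
      using K_rad[OF f that] K_rad[OF g that] v_closed by (simp add: rad_add)
    have "(f \<oplus>\<^bsub>E\<^esub> g) 0 4 v = ((r \<odot>\<^bsub>P 4\<^esub> v) \<oplus>\<^bsub>P 4\<^esub> w) \<oplus>\<^bsub>P 4\<^esub> ((r' \<odot>\<^bsub>P 4\<^esub> v) \<oplus>\<^bsub>P 4\<^esub> w')"
      using E_add_app[OF v_closed, of f g 0] r(3) r'(3) by simp
    also have "\<dots> = ((r \<oplus> r') \<odot>\<^bsub>P 4\<^esub> v) \<oplus>\<^bsub>P 4\<^esub> (w \<oplus>\<^bsub>P 4\<^esub> w')"
      using v_closed r(1) r'(1) rad_closed[OF r(2)] rad_closed[OF r'(2)] by algebra
    finally show "(f \<oplus>\<^bsub>E\<^esub> g) 0 4 v = ((r \<oplus> r') \<odot>\<^bsub>P 4\<^esub> v) \<oplus>\<^bsub>P 4\<^esub> (w \<oplus>\<^bsub>P 4\<^esub> w')" .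
  qed
  show "f \<otimes>\<^bsub>E\<^esub> g \<in> K"
  proof -
    obtain k x where k: "k \<in> carrier R" "x \<in> rad 4" "(f \<otimes>\<^bsub>E\<^esub> g) 0 4 v = (k \<odot>\<^bsub>P 4\<^esub> f 0 4 v) \<oplus>\<^bsub>P 4\<^esub> x"
      using mult_K[OF K_Z[OF f] g, of 0] by auto
    show ?thesis
    proof (rule K_I[OF Z_mult[OF K_Z[OF f] K_Z[OF g]]])
      show "(f \<otimes>\<^bsub>E\<^esub> g) n 4 v \<in> rad (4 - n)" if "n \<noteq> 0" for n
      proof -
        obtain k x where k: "k \<in> carrier R" "x \<in> rad (4 - n)"
          "(f \<otimes>\<^bsub>E\<^esub> g) n 4 v = (k \<odot>\<^bsub>P (4 - n)\<^esub> f n 4 v) \<oplus>\<^bsub>P (4 - n)\<^esub> x"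
          using mult_K[OF K_Z[OF f] g, of n] by auto
        show ?thesis unfolding k(3) by (intro rad_add rad_smult_closed k K_rad[OF f that])
      qed
      show "k \<otimes> r \<in> carrier R" using k r by simp
      show "(k \<odot>\<^bsub>P 4\<^esub> w) \<oplus>\<^bsub>P 4\<^esub> x \<in> rad 4" by (intro rad_add rad_smult_closed k r)
      show "(f \<otimes>\<^bsub>E\<^esub> g) 0 4 v = ((k \<otimes> r) \<odot>\<^bsub>P 4\<^esub> v) \<oplus>\<^bsub>P 4\<^esub> ((k \<odot>\<^bsub>P 4\<^esub> w) \<oplus>\<^bsub>P 4\<^esub> x)"
        unfolding k(3) r(3) using v_closed k(1) r(1) rad_closed[OF r(2)] rad_closed[OF k(2)] by algebra
    qed
  qed
next
  fix k f assume k: "k \<in> carrier R" and f: "f \<in> K"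
  obtain r w where r: "r \<in> carrier R" "w \<in> rad 4" "f 0 4 v = (r \<odot>\<^bsub>P 4\<^esub> v) \<oplus>\<^bsub>P 4\<^esub> w"
    using K_zero_component[OF f] by (elim bexE)
  show "k \<odot>\<^bsub>E\<^esub> f \<in> K"
  proof (rule K_I[OF Z_smult[OF k K_Z[OF f]]])
    show "(k \<odot>\<^bsub>E\<^esub> f) n 4 v \<in> rad (4 - n)" if "n \<noteq> 0" for n
      using rad_smult_closed[OF k K_rad[OF f that]] v_closed by simp
    show "k \<otimes> r \<in> carrier R" using k r by simp
    show "k \<odot>\<^bsub>P 4\<^esub> w \<in> rad 4" by (intro rad_smult_closed k r)
    have "(k \<odot>\<^bsub>E\<^esub> f) 0 4 v = k \<odot>\<^bsub>P 4\<^esub> ((r \<odot>\<^bsub>P 4\<^esub> v) \<oplus>\<^bsub>P 4\<^esub> w)"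
      using E_smult_app[OF v_closed, of k f 0] r(3) by simp
    thus "(k \<odot>\<^bsub>E\<^esub> f) 0 4 v = ((k \<otimes> r) \<odot>\<^bsub>P 4\<^esub> v) \<oplus>\<^bsub>P 4\<^esub> (k \<odot>\<^bsub>P 4\<^esub> w)"
      using v_closed k r(1) rad_closed[OF r(2)] by algebra
  qed
qed

lemma shriek_K: "ext_shriek R m P d \<subseteq> cls ` K"
  unfolding ext_shriek_def
proof (intro hull_minimal K_subalgebra)
  show "ext_component R P d 1 \<subseteq> cls ` K"
    unfolding ext_component_eq
  proof (rule image_mono, rule subsetI)
    fix h assume "h \<in> Collect (homogeneous 1)"
    hence h: "homogeneous 1 h" by simp
    interpret h: degree_one R P d m \<rho> \<omega> n \<delta> t \<tau> "h 1" by (rule degree_one_Z[OF homogeneousD[OF h]])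
    interpret h: tate_degree_one R P d m \<rho> \<omega> n \<delta> t \<tau> "h 1" s a u v by unfold_locales
    show "h \<in> K"
    proof (rule K_I[OF homogeneousD[OF h] _ zero_closed rad_zero])
      show "h n 4 v \<in> rad (4 - n)" if "n \<noteq> 0" for n
      proof (cases "n = 1")
        case True
        thus ?thesis using h.h_v by simp
      next
        case False
        thus ?thesis using homogeneous_zero[OF h False v_closed] rad_zero by simp
      qed
      show "h 0 4 v = (\<zero> \<odot>\<^bsub>P 4\<^esub> v) \<oplus>\<^bsub>P 4\<^esub> \<zero>\<^bsub>P 4\<^esub>"
        using homogeneous_zero[OF h _ v_closed, of 0] v_closed by simp
    qed
  qed
qed

text \<open>The cycles whose component of degree four maps \<open>v\<close> into
  \<open>rad 0\<close> form a right submodule by \<open>mult_K\<close>. Homogeneous cycles of degree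
  at most two belong to it since that component is zero, so by the generation hypothesis it gives
  every class.\<close>

lemma vanish_on_v:
  assumes gen: "right_submodule (ext_shriek R m P d) Ext hull (\<Union>n\<in>{0..2}. ext_component R P d n) = carrier Ext"
    and f: "f \<in> Z"
  shows "f 4 4 v \<in> rad 0"
proof -
  define N where "N = {f \<in> Z. f 4 4 v \<in> rad 0}"
  have N: "g \<in> Z" "g 4 4 v \<in> rad 0" if "g \<in> N" for g using that by (auto simp: N_def)
  have add: "additive_subgroup (cls ` N) Ext"
  proof (rule Ext_additive_subgroup)
    show "N \<subseteq> Z" using N by blast
    show "\<zero>\<^bsub>E\<^esub> \<in> N" using v_closed rad_zero[of 0] by (simp add: N_def Z_zero)
    show "f \<oplus>\<^bsub>E\<^esub> g \<in> N" if "f \<in> N" "g \<in> N" for f g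
      using N[OF that(1)] N[OF that(2)] rad_add[of _ 0] v_closed by (simp add: N_def Z_add)
    show "\<ominus>\<^bsub>E\<^esub> f \<in> N" if "f \<in> N" for f
      using N[OF that] rad_neg[of _ 0] v_closed Z_E by (simp add: N_def Z_neg)
  qed
  have mult: "cls f \<otimes>\<^bsub>Ext\<^esub> y \<in> cls ` N" if f: "f \<in> N" and y: "y \<in> ext_shriek R m P d" for f y
  proof -
    obtain g where g: "g \<in> K" "y = cls g" using shriek_K y by blast
    obtain r w where r: "r \<in> carrier R" "w \<in> rad 0" "(f \<otimes>\<^bsub>E\<^esub> g) 4 4 v = (r \<odot>\<^bsub>P 0\<^esub> f 4 4 v) \<oplus>\<^bsub>P 0\<^esub> w"
      using mult_K[OF N(1)[OF f] g(1), of 4] by auto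
    have "(f \<otimes>\<^bsub>E\<^esub> g) 4 4 v \<in> rad 0"
      unfolding r(3) by (intro rad_add rad_smult_closed r N(2)[OF f])
    hence "f \<otimes>\<^bsub>E\<^esub> g \<in> N" using Z_mult[OF N(1)[OF f] K_Z[OF g(1)]] by (simp add: N_def)
    thus ?thesis using Ext_mult[OF N(1)[OF f] K_Z[OF g(1)]] g(2) by simp
  qed
  have "right_submodule (ext_shriek R m P d) Ext (cls ` N)"
    unfolding right_submodule_def using add mult by blast
  moreover have "(\<Union>n\<in>{0..2}. ext_component R P d n) \<subseteq> cls ` N"
  proof (rule UN_least)
    fix n :: int assume n: "n \<in> {0..2}"
    show "ext_component R P d n \<subseteq> cls ` N"
      unfolding ext_component_eq
    proof (rule image_mono, rule subsetI)
      fix g assume "g \<in> Collect (homogeneous n)"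
      hence g: "homogeneous n g" by simp
      have "g 4 4 v = \<zero>\<^bsub>P (4 - 4)\<^esub>" by (rule homogeneous_zero[OF g _ v_closed]) (use n in auto)
      thus "g \<in> N" using homogeneousD[OF g] rad_zero[of 0] by (simp add: N_def)
    qed
  qed
  ultimately have "carrier Ext \<subseteq> cls ` N" unfolding gen[symmetric] by (intro hull_minimal)
  hence "cls f \<in> cls ` N" using f Ext_carrier by blast
  then obtain g where g: "g \<in> N" "cls f = cls g" by blast
  \<comment> \<open>So far some representative of the class is known to vanish. A boundary changes
    the value at \<open>v\<close> by d(k v) and, up to sign, k(u a); the latter is in
    \<open>rad 0\<close> because \<open>a\<close> has entries in \<open>m\<close>.\<close>
  obtain b where b: "b \<in> Bd" "f = b \<oplus>\<^bsub>E\<^esub> g" using cls_eqD[OF f g(2)] by blast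
  obtain k where k: "k \<in> carrier E" "b = \<Delta> k" using b(1) by (rule Bd_E)
  have k3: "k 3 4 v \<in> carrier (P 1)" by (rule E_closed[OF k(1) v_closed]) simp
  have k33: "k 3 3 \<in> module_hom R (P 3) (P 0)" by (rule E_hom[OF k(1)]) simp
  have "b 4 4 v = d 1 (k 3 4 v) \<oplus>\<^bsub>P 0\<^esub> (parity 4 \<odot>\<^bsub>P 0\<^esub> k 3 3 (u a))"
    unfolding k(2) using \<Delta>_app[OF k(1) v_closed, of 4] d_v by simp
  moreover have "k 3 3 (u a) \<in> rad 0" by (rule hom_in_rad[OF hom_comp[OF u_hom k33] a_closed a_in_m])
  moreover have "d 1 (k 3 4 v) \<in> rad 0" using rad_d[of _ 0] k3 by simp
  ultimately have "b 4 4 v \<in> rad 0" by (simp add: rad_add rad_smult_closed)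
  thus ?thesis using b(2) N(2)[OF g(1)] v_closed rad_add[of "b 4 4 v" 0] by simp
qed

end

section \<open>Degrees zero and two, and the conclusion for a Koszul datum\<close>

context koszul
begin

text \<open>\<open>vanish_on_v\<close> is applied to the square of \<open>f\<close>, whose value at
  \<open>v\<close> is f(f(v)); \<open>f_v\<close> converts this into the statement about
  f(s).\<close>

lemma degree_two_vanish:
  assumes gen: "right_submodule (ext_shriek R m P d) Ext hull (\<Union>n\<in>{0..2}. ext_component R P d n) = carrier Ext"
    and f: "homogeneous 2 f"
    and s: "s \<in> carrier (P 2)" and a: "a \<in> carrier F" "\<And>i. a i \<in> m2" and ds: "d 2 s = t a" and \<delta>a: "\<delta> a = \<zero>"
  shows "\<rho> (f 2 2 s) \<in> m"
proof -
  obtain u v where "tate_variable R P d m \<rho> \<omega> n \<delta> t \<tau> s a u v"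
    by (rule tate_variable_exists[OF s a ds \<delta>a])
  then interpret T: tate_variable R P d m \<rho> \<omega> n \<delta> t \<tau> s a u v .
  note fZ = homogeneousD[OF f]
  interpret T: tate_degree_two R P d m \<rho> \<omega> n \<delta> t \<tau> s a u v "f 2"
  proof unfold_locales
    fix i x
    show "f 2 i \<in> module_hom R (P i) (P (i - 2))" by (rule E_hom[OF Z_E[OF fZ] refl])
    assume x: "x \<in> carrier (P i)"
    have "f 2 (i - 1) (d i x) \<in> carrier (P (i - 2 - 1))" by (rule E_closed[OF Z_E[OF fZ] d_closed[OF x]]) simp
    thus "d (i - 2) (f 2 i x) = f 2 (i - 1) (d i x)"
      using Z_comm[OF fZ x, of 2] by (simp add: parity_def)
  qed
  have "(f \<otimes>\<^bsub>E\<^esub> f) 4 4 v \<in> rad 0" by (rule T.vanish_on_v[OF gen Z_mult[OF fZ fZ]])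
  hence "f 2 2 (f 2 4 v) \<in> rad 0" using homogeneous_mult_app[OF fZ f T.v_closed, of 4] by simp
  thus ?thesis using T.f_v \<rho>_rad by blast
qed

text \<open>A chain map of degree zero is determined up to homotopy by the scalar it induces on the
  residue field. After subtracting that scalar it sends \<open>\<omega>\<close> and all boundaries,
  hence all of P_0, into \<open>rad 0\<close>, and \<open>extend_homotopy\<close> applies with p =
  -1.\<close>

lemma degree_zero:
  assumes f: "homogeneous 0 f"
  shows "\<exists>r\<in>carrier R. cls f = cls (r \<odot>\<^bsub>E\<^esub> \<one>\<^bsub>E\<^esub>)"
proof -
  note fZ = homogeneousD[OF f]
  have f0: "f 0 0 \<in> module_hom R (P 0) (P 0)" by (rule E_hom[OF Z_E[OF fZ]]) simp
  define r where "r = \<rho> (f 0 0 \<omega>)"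
  have fw: "f 0 0 \<omega> \<in> carrier (P 0)" by (rule hom_closed[OF f0 \<omega>_closed])
  have r: "r \<in> carrier R" unfolding r_def by (rule \<rho>_closed[OF fw])
  have r1: "r \<odot>\<^bsub>E\<^esub> \<one>\<^bsub>E\<^esub> \<in> Z" by (rule Z_smult[OF r Z_one])
  have "homogeneous 0 \<one>\<^bsub>E\<^esub>" by (simp add: homogeneous_def Z_one E_one_app)
  hence g: "homogeneous 0 (f \<ominus>\<^bsub>E\<^esub> (r \<odot>\<^bsub>E\<^esub> \<one>\<^bsub>E\<^esub>))" by (intro homogeneous_diff f homogeneous_smult r)
  let ?g = "f \<ominus>\<^bsub>E\<^esub> (r \<odot>\<^bsub>E\<^esub> \<one>\<^bsub>E\<^esub>)"
  note gZ = homogeneousD[OF g]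
  have "?g \<in> Bd"
  proof (rule extend_homotopy[of "-1" ?g "\<lambda>_. \<zero>\<^bsub>P 0\<^esub>"])
    show "\<Delta> ?g = \<zero>\<^bsub>E\<^esub>" "?g \<in> carrier E" using gZ by (simp_all add: Z_iff)
    show "?g n i x = \<zero>\<^bsub>P (i - n)\<^esub>" if "n \<noteq> - 1 + 1" "x \<in> carrier (P i)" for n i x
      by (rule homogeneous_zero[OF g]) (use that in auto)
    show "(\<lambda>_. \<zero>\<^bsub>P 0\<^esub>) \<in> module_hom R (P (- 1)) (P 0)" by (rule zero_hom)
    show "\<rho> (?g (- 1 + 1) (- 1 + 1) x \<ominus>\<^bsub>P 0\<^esub> \<zero>\<^bsub>P 0\<^esub>) \<in> m" if "x \<in> carrier (P (- 1 + 1))" for x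
    proof -
      have x: "x \<in> carrier (P 0)" using that by simp
      note \<kappa>x = hom_closed[OF \<kappa>_hom x]
      have g0: "?g 0 0 \<in> module_hom R (P 0) (P 0)" by (rule E_hom[OF Z_E[OF gZ]]) simp
      have g\<omega>: "?g 0 0 \<omega> = f 0 0 \<omega> \<ominus>\<^bsub>P 0\<^esub> (r \<odot>\<^bsub>P 0\<^esub> \<omega>)"
        using E_minus_app[OF Z_E[OF fZ] Z_E[OF r1] \<omega>_closed, of 0] \<omega>_closed by (simp add: E_one_app)
      have "\<rho> (?g 0 0 \<omega>) = r \<ominus>\<^bsub>self_module R\<^esub> r \<otimes> \<one>"
        unfolding g\<omega> using fw r \<omega>_closed \<rho>_\<omega>
        by (simp add: hom_minus[OF P_module self_module \<rho>_hom] hom_smult[OF \<rho>_hom] r_def)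
      also have "\<dots> = \<zero>" using r S.sub_eq_zero_iff[of r r] by simp
      finally have g\<omega>': "?g 0 0 \<omega> \<in> rad 0" using rad0_iff[OF hom_closed[OF g0 \<omega>_closed]] by simp
      have d\<kappa>: "d 1 (\<kappa> x) \<in> rad 0" using rad_d[of "\<kappa> x" 0] \<kappa>x by simp
      have "?g 0 0 (d 1 (\<kappa> x)) \<in> rad 0" by (rule Z_rad[OF gZ d\<kappa>]) simp
      moreover have "?g 0 0 x = ?g 0 0 (d 1 (\<kappa> x)) \<oplus>\<^bsub>P 0\<^esub> (\<rho> x \<odot>\<^bsub>P 0\<^esub> ?g 0 0 \<omega>)"
      proof -
        have "?g 0 0 x = ?g 0 0 (d 1 (\<kappa> x) \<oplus>\<^bsub>P 0\<^esub> (\<rho> x \<odot>\<^bsub>P 0\<^esub> \<omega>))" using d_\<kappa>'[OF x] by simp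
        also have "\<dots> = ?g 0 0 (d 1 (\<kappa> x)) \<oplus>\<^bsub>P 0\<^esub> (\<rho> x \<odot>\<^bsub>P 0\<^esub> ?g 0 0 \<omega>)"
          using rad_closed[OF d\<kappa>] \<rho>_closed[OF x] \<omega>_closed hom_add[OF g0] hom_smult[OF g0] by simp
        finally show ?thesis .
      qed
      ultimately have "?g 0 0 x \<in> rad 0" using g\<omega>' \<rho>_closed[OF x] by (simp only: rad_add rad_smult_closed)
      hence "?g 0 0 x \<ominus>\<^bsub>P 0\<^esub> \<zero>\<^bsub>P 0\<^esub> \<in> rad 0" by (rule rad_minus[OF _ rad_zero])
      thus ?thesis using \<rho>_rad by simp
    qed
    fix k assume "k \<in> carrier E" "\<Delta> k = ?g"
    thus "?g \<in> Bd" using Bd_I by metis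
  qed simp
  moreover have "f = ?g \<oplus>\<^bsub>E\<^esub> (r \<odot>\<^bsub>E\<^esub> \<one>\<^bsub>E\<^esub>)" using Z_E[OF fZ] Z_E[OF r1] by algebra
  ultimately have "cls f = cls (r \<odot>\<^bsub>E\<^esub> \<one>\<^bsub>E\<^esub>)" by (intro cls_eqI[OF r1])
  thus ?thesis using r by blast
qed

theorem generated_in_degree_one:
  assumes gen: "right_submodule (ext_shriek R m P d) Ext hull (\<Union>n\<in>{0..2}. ext_component R P d n) = carrier Ext"
  shows "carrier Ext = ext_shriek R m P d"
proof
  have "subalgebra_over (R Quot m) Ext (carrier Ext)"
    unfolding Ext_carrier by (rule Ext_subalgebra) (auto intro: Z_one Z_add Z_smult Z_mult)
  moreover have "ext_component R P d 1 \<subseteq> carrier Ext"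
    unfolding ext_component_eq Ext_carrier using homogeneousD by blast
  ultimately show "ext_shriek R m P d \<subseteq> carrier Ext"
    unfolding ext_shriek_def by (intro hull_minimal)
next
  show "carrier Ext \<subseteq> ext_shriek R m P d"
    unfolding ext_shriek_def hull_def
  proof (rule Inter_greatest)
    \<comment> \<open>An arbitrary subalgebra \<open>A\<close> containing degree one is shown to
      contain degrees zero and two. It is then a right submodule over the degree-one subalgebra, and
      the generation hypothesis puts all of Ext inside \<open>A\<close>.\<close>
    fix A assume "A \<in> {A. subalgebra_over (R Quot m) Ext A \<and> ext_component R P d 1 \<subseteq> A}"
    hence A: "subalgebra_over (R Quot m) Ext A" and A1: "ext_component R P d 1 \<subseteq> A" by auto
    have sub: "subring A Ext" using A by (simp add: subalgebra_over_def)
    have A_smult: "cls (r \<odot>\<^bsub>E\<^esub> f) \<in> A" if "r \<in> carrier R" "f \<in> Z" "cls f \<in> A" for r f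
    proof -
      have "m +>\<^bsub>R\<^esub> r \<in> carrier (R Quot m)" using that(1) by (auto simp: FactRing_def A_RCOSETS_def')
      thus ?thesis using A that unfolding subalgebra_over_def Ext_smult[OF that(1,2), symmetric] by blast
    qed
    have A_add: "cls (f \<oplus>\<^bsub>E\<^esub> g) \<in> A" if "f \<in> Z" "g \<in> Z" "cls f \<in> A" "cls g \<in> A" for f g
      using subringE(7)[OF sub that(3,4)] Ext_add[OF that(1,2)] by simp
    have A_mult: "cls (f \<otimes>\<^bsub>E\<^esub> g) \<in> A" if "f \<in> Z" "g \<in> Z" "cls f \<in> A" "cls g \<in> A" for f g
      using subringE(6)[OF sub that(3,4)] Ext_mult[OF that(1,2)] by simp
    have A_one: "cls \<one>\<^bsub>E\<^esub> \<in> A" using subringE(3)[OF sub] by (simp add: Ext_def')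
    have A_zero: "cls \<zero>\<^bsub>E\<^esub> \<in> A" using subringE(2)[OF sub] by (simp add: Ext_zero)
    have comp0: "ext_component R P d 0 \<subseteq> A"
      unfolding ext_component_eq
    proof (rule image_subsetI)
      fix f assume "f \<in> Collect (homogeneous 0)"
      then obtain r where r: "r \<in> carrier R" "cls f = cls (r \<odot>\<^bsub>E\<^esub> \<one>\<^bsub>E\<^esub>)" using degree_zero by auto
      show "cls f \<in> A" unfolding r(2) by (rule A_smult[OF r(1) Z_one A_one])
    qed
    have "\<exists>h. homogeneous 1 h \<and> (\<forall>y\<in>carrier F. \<rho> (h 1 1 (t y)) \<ominus> y j \<in> m)" for j
      by (rule dual_class[of j]) (intro exI conjI ballI)
    then obtain h where h: "\<And>j. homogeneous 1 (h j)" "\<And>j y. y \<in> carrier F \<Longrightarrow> \<rho> (h j 1 1 (t y)) \<ominus> y j \<in> m"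
      by metis
    note hZ = homogeneousD[OF h(1)]
    have hA: "cls (h j) \<in> A" for j using A1 h(1) unfolding ext_component_eq by blast
    \<comment> \<open>The functionals of the degree-two classes lying in \<open>A\<close>; they
      include those of the products h_i h_j.\<close>
    define W where "W = {w \<in> module_hom R (P 2) (self_module R).
      \<exists>f. homogeneous 2 f \<and> cls f \<in> A \<and> (\<forall>x\<in>carrier (P 2). w x = \<rho> (f 2 2 x))}"
    have W_I: "w \<in> W" if "homogeneous 2 f" "cls f \<in> A" "\<And>x. x \<in> carrier (P 2) \<Longrightarrow> w x = \<rho> (f 2 2 x)" for w f
    proof -
      have "f 2 2 \<in> module_hom R (P 2) (P 0)" by (rule E_hom[OF Z_E[OF homogeneousD[OF that(1)]]]) simp
      from hom_cong[OF hom_comp[OF this \<rho>_hom] P_module, of w] that show ?thesis by (auto simp: W_def)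
    qed
    have W_E: "\<exists>f. homogeneous 2 f \<and> cls f \<in> A \<and> (\<forall>x\<in>carrier (P 2). w x = \<rho> (f 2 2 x))" if "w \<in> W" for w
      using that by (simp add: W_def)
    \<comment> \<open>By \<open>coboundary\<close> a class of degree two is determined by the values
      of its functional on \<open>V\<close> modulo \<open>m\<close>.\<close>
    define V where "V = {s \<in> carrier (P 2). \<exists>a\<in>carrier F. d 2 s = t a}"
    have V_\<delta>: "\<delta> a = \<zero>" if "s \<in> carrier (P 2)" "a \<in> carrier F" "d 2 s = t a" for s a
    proof -
      have "\<zero>\<^bsub>P 0\<^esub> = \<delta> a \<odot>\<^bsub>P 0\<^esub> \<omega>" using d_d[OF that(1)] d_t[OF that(2)] that(3) by simp
      hence "\<rho> \<zero>\<^bsub>P 0\<^esub> = \<delta> a \<otimes> \<rho> \<omega>" using hom_smult[OF \<rho>_hom \<delta>_closed[OF that(2)] \<omega>_closed] by simp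
      thus ?thesis using hom_zero[OF P_module self_module \<rho>_hom] \<delta>_closed[OF that(2)] \<rho>_\<omega> by simp
    qed
    have comp2: "ext_component R P d 2 \<subseteq> A"
      unfolding ext_component_eq
    proof (rule image_subsetI)
      fix f assume "f \<in> Collect (homogeneous 2)"
      hence f: "homogeneous 2 f" by simp
      note fZ = homogeneousD[OF f]
      have f2: "f 2 2 \<in> module_hom R (P 2) (P 0)" by (rule E_hom[OF Z_E[OF fZ]]) simp
      let ?\<phi> = "\<lambda>(i, j) x. \<rho> (h i 1 1 (h j 1 2 x))"
      \<comment> \<open>A common zero in \<open>V\<close> of the products has its \<open>a\<close>
        in m^2 by \<open>products_detect\<close>, so f vanishes there by
        \<open>degree_two_vanish\<close>. Hence modulo \<open>m\<close> and on \<open>V\<close> the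
        functional of f belongs to the span of the products.\<close>
      have "\<exists>w\<in>W. \<forall>x\<in>V. \<rho> (f 2 2 x) \<ominus> w x \<in> m"
      proof (rule functional_in_span[where M = "P 2" and I = "{..<n} \<times> {..<n}" and \<phi> = ?\<phi>, OF P_module])
        fix p assume "p \<in> {..<n} \<times> {..<n}"
        obtain i j where p: "p = (i, j)" by (cases p)
        show "?\<phi> p \<in> W"
        proof (rule W_I)
          show "homogeneous 2 (h i \<otimes>\<^bsub>E\<^esub> h j)" using homogeneous_mult[OF h(1) h(1), of i j] by simp
          show "cls (h i \<otimes>\<^bsub>E\<^esub> h j) \<in> A" by (rule A_mult[OF hZ hZ hA hA])
          fix x assume "x \<in> carrier (P 2)"
          thus "?\<phi> p x = \<rho> ((h i \<otimes>\<^bsub>E\<^esub> h j) 2 2 x)"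
            using homogeneous_mult_app[OF hZ h(1), of x 2 i j 2] p by simp
        qed
      next
        fix w assume "w \<in> W"
        thus "w \<in> module_hom R (P 2) (self_module R)" by (simp add: W_def)
      next
        show "(\<lambda>x. \<zero>) \<in> W"
        proof (rule W_I)
          show "homogeneous 2 \<zero>\<^bsub>E\<^esub>" by (simp add: homogeneous_def Z_zero)
          show "cls \<zero>\<^bsub>E\<^esub> \<in> A" by (rule A_zero)
          fix x assume "x \<in> carrier (P 2)"
          thus "\<zero> = \<rho> (\<zero>\<^bsub>E\<^esub> 2 2 x)" using hom_zero[OF P_module self_module \<rho>_hom] by simp
        qed
      next
        fix w w' r assume w: "w \<in> W" "w' \<in> W" and r: "r \<in> carrier R"
        obtain g where g: "homogeneous 2 g" "cls g \<in> A" "\<forall>x\<in>carrier (P 2). w x = \<rho> (g 2 2 x)"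
          using W_E[OF w(1)] by (elim exE conjE)
        obtain g' where g': "homogeneous 2 g'" "cls g' \<in> A" "\<forall>x\<in>carrier (P 2). w' x = \<rho> (g' 2 2 x)"
          using W_E[OF w(2)] by (elim exE conjE)
        note gZ = homogeneousD[OF g(1)] and g'Z = homogeneousD[OF g'(1)]
        show "(\<lambda>x. w x \<oplus> r \<otimes> w' x) \<in> W"
        proof (rule W_I)
          show "homogeneous 2 (g \<oplus>\<^bsub>E\<^esub> (r \<odot>\<^bsub>E\<^esub> g'))" by (intro homogeneous_add homogeneous_smult g g' r)
          show "cls (g \<oplus>\<^bsub>E\<^esub> (r \<odot>\<^bsub>E\<^esub> g')) \<in> A"
            by (intro A_add A_smult Z_smult gZ g'Z r g(2) g'(2))
          fix x assume x: "x \<in> carrier (P 2)"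
          have c: "g 2 2 x \<in> carrier (P 0)" "g' 2 2 x \<in> carrier (P 0)"
            by (rule E_closed[OF Z_E[OF gZ] x], simp) (rule E_closed[OF Z_E[OF g'Z] x], simp)
          show "w x \<oplus> r \<otimes> w' x = \<rho> ((g \<oplus>\<^bsub>E\<^esub> (r \<odot>\<^bsub>E\<^esub> g')) 2 2 x)"
            using g(3) g'(3) x c r by (simp add: hom_add[OF \<rho>_hom] hom_smult[OF \<rho>_hom])
        qed
      next
        show "V \<subseteq> carrier (P 2)" by (auto simp: V_def)
        fix x y r assume x: "x \<in> V" and y: "y \<in> V" and r: "r \<in> carrier R"
        obtain a b where ab: "a \<in> carrier F" "b \<in> carrier F" "d 2 x = t a" "d 2 y = t b"
          using x y by (auto simp: V_def)
        have xy: "x \<in> carrier (P 2)" "y \<in> carrier (P 2)" using x y by (auto simp: V_def)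
        have d2: "d 2 \<in> module_hom R (P 2) (P 1)" by (rule d_hom') simp
        have "d 2 (x \<ominus>\<^bsub>P 2\<^esub> (r \<odot>\<^bsub>P 2\<^esub> y)) = t (a \<ominus>\<^bsub>F\<^esub> (r \<odot>\<^bsub>F\<^esub> b))"
          using hom_P_minus[OF d2 xy(1)] hom_smult[OF d2 r xy(2)] xy r ab
            hom_minus[OF tuples_module P_module t_hom ab(1)] hom_smult[OF t_hom r ab(2)] by simp
        moreover have "a \<ominus>\<^bsub>F\<^esub> (r \<odot>\<^bsub>F\<^esub> b) \<in> carrier F" using ab(1,2) r by simp
        moreover have "x \<ominus>\<^bsub>P 2\<^esub> (r \<odot>\<^bsub>P 2\<^esub> y) \<in> carrier (P 2)" using xy r by simp
        ultimately show "x \<ominus>\<^bsub>P 2\<^esub> (r \<odot>\<^bsub>P 2\<^esub> y) \<in> V" unfolding V_def by blast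
      next
        show "(\<lambda>x. \<rho> (f 2 2 x)) \<in> module_hom R (P 2) (self_module R)" by (rule hom_comp[OF f2 \<rho>_hom])
      next
        fix x assume "x \<in> V" and prods: "\<And>p. p \<in> {..<n} \<times> {..<n} \<Longrightarrow> ?\<phi> p x \<in> m"
        then obtain a where x: "x \<in> carrier (P 2)" and a: "a \<in> carrier F" "d 2 x = t a" by (auto simp: V_def)
        note \<delta>a = V_\<delta>[OF x a]
        have prods': "\<rho> (h i 1 1 (h j 1 2 x)) \<in> m" if "i < n" "j < n" for i j
          using prods[of "(i, j)"] that by simp
        have "a j \<in> m2" for j by (rule products_detect[OF hZ h(2) x a \<delta>a prods'])
        thus "\<rho> (f 2 2 x) \<in> m" by (rule degree_two_vanish[OF gen f x a(1) _ a(2) \<delta>a])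
      qed simp
      then obtain w where w: "w \<in> W" "\<And>x. x \<in> V \<Longrightarrow> \<rho> (f 2 2 x) \<ominus> w x \<in> m" by blast
      obtain g where g: "homogeneous 2 g" "cls g \<in> A" "\<forall>x\<in>carrier (P 2). w x = \<rho> (g 2 2 x)"
        using W_E[OF w(1)] by (elim exE conjE)
      note gZ = homogeneousD[OF g(1)]
      have "f \<ominus>\<^bsub>E\<^esub> g \<in> Bd"
      proof (rule coboundary[OF homogeneous_diff[OF f g(1)]])
        fix s a assume s: "s \<in> carrier (P 2)" and "a \<in> carrier F" "d 2 s = t a"
        hence "s \<in> V" unfolding V_def by blast
        have c: "f 2 2 s \<in> carrier (P 0)" "g 2 2 s \<in> carrier (P 0)"
          by (rule hom_closed[OF f2 s]) (rule E_closed[OF Z_E[OF gZ] s], simp)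
        have "\<rho> ((f \<ominus>\<^bsub>E\<^esub> g) 2 2 s) = \<rho> (f 2 2 s) \<ominus>\<^bsub>self_module R\<^esub> \<rho> (g 2 2 s)"
          using s Z_E[OF fZ] Z_E[OF gZ] c by (simp add: hom_minus[OF P_module self_module \<rho>_hom])
        also have "\<dots> = \<rho> (f 2 2 s) \<ominus> w s"
          using g(3) s \<rho>_closed[OF c(2)] by (simp add: a_minus_def self_module_neg)
        finally show "\<rho> ((f \<ominus>\<^bsub>E\<^esub> g) 2 2 s) \<in> m" using w(2)[OF \<open>s \<in> V\<close>] by simp
      qed
      moreover have "f = (f \<ominus>\<^bsub>E\<^esub> g) \<oplus>\<^bsub>E\<^esub> g" using Z_E[OF fZ] Z_E[OF gZ] by algebra
      ultimately have "cls f = cls g" by (rule cls_eqI[OF gZ])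
      thus "cls f \<in> A" using g(2) by simp
    qed
    have shriek: "ext_shriek R m P d \<subseteq> A"
      unfolding ext_shriek_def by (rule hull_minimal, rule A1, rule A)
    have "right_submodule (ext_shriek R m P d) Ext A"
      unfolding right_submodule_def
    proof (intro conjI ballI)
      show "additive_subgroup A Ext" using sub by (simp add: subring_def additive_subgroup_def)
      show "x \<otimes>\<^bsub>Ext\<^esub> y \<in> A" if "x \<in> A" "y \<in> ext_shriek R m P d" for x y
        using subringE(6)[OF sub that(1)] that(2) shriek by blast
    qed
    moreover have "(\<Union>n\<in>{0..2}. ext_component R P d n) \<subseteq> A"
    proof (rule UN_least)
      fix k :: int assume "k \<in> {0..2}"
      hence "k = 0 \<or> k = 1 \<or> k = 2" by auto
      thus "ext_component R P d k \<subseteq> A" using comp0 A1 comp2 by blast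
    qed
    ultimately show "carrier Ext \<subseteq> A" unfolding gen[symmetric] by (intro hull_minimal)
  qed
qed

end

section \<open>Resolutions of the residue field of a Noetherian local ring\<close>

context cring
begin

lemma hom_image_ideal:
  assumes f: "f \<in> module_hom R (tuples R n) (self_module R)"
  shows "ideal (f ` carrier (tuples R n)) R"
proof (rule idealI[OF ring_axioms])
  interpret T: module R "tuples R n" by (rule tuples_module)
  have cl: "f y \<in> carrier R" if "y \<in> carrier (tuples R n)" for y using hom_closed[OF f that] by simp
  show "subgroup (f ` carrier (tuples R n)) (add_monoid R)"
  proof (rule add.subgroupI)
    show "f ` carrier (tuples R n) \<subseteq> carrier R" using cl by blast
    show "f ` carrier (tuples R n) \<noteq> {}" using T.M.zero_closed by blast
    fix x assume "x \<in> f ` carrier (tuples R n)"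
    then obtain y where y: "y \<in> carrier (tuples R n)" "x = f y" by blast
    have "\<ominus> x = f (\<ominus>\<^bsub>tuples R n\<^esub> y)"
      using hom_neg[OF tuples_module self_module f y(1)] y cl by (simp add: self_module_neg)
    thus "\<ominus> x \<in> f ` carrier (tuples R n)" using y(1) T.M.a_inv_closed by blast
    fix x' assume "x' \<in> f ` carrier (tuples R n)"
    then obtain y' where y': "y' \<in> carrier (tuples R n)" "x' = f y'" by blast
    have "x \<oplus> x' = f (y \<oplus>\<^bsub>tuples R n\<^esub> y')" using hom_add[OF f y(1) y'(1)] y y' by simp
    thus "x \<oplus> x' \<in> f ` carrier (tuples R n)" using T.M.a_closed[OF y(1) y'(1)] by blast
  qed
  fix x r assume "x \<in> f ` carrier (tuples R n)" and r: "r \<in> carrier R"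
  then obtain y where y: "y \<in> carrier (tuples R n)" "x = f y" by blast
  have "r \<otimes> x = f (r \<odot>\<^bsub>tuples R n\<^esub> y)" using hom_smult[OF f r y(1)] y by simp
  thus rx: "r \<otimes> x \<in> f ` carrier (tuples R n)" using T.smult_closed[OF r y(1)] by blast
  thus "x \<otimes> r \<in> f ` carrier (tuples R n)" using m_comm[OF cl[OF y(1)] r] y by simp
qed

lemma finite_subset_hom_image:
  assumes I: "ideal I R" and "finite A" "A \<subseteq> I"
  shows "\<exists>n f. f \<in> module_hom R (tuples R n) (self_module R) \<and>
    A \<subseteq> f ` carrier (tuples R n) \<and> f ` carrier (tuples R n) \<subseteq> I"
  using assms(2,3)
proof induction
  case empty
  interpret I: ideal I R by fact
  show ?case
    by (intro exI[of _ 0] exI[of _ "\<lambda>_. \<zero>"]) (auto intro!: module_homI)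
next
  case (insert x A)
  interpret I: ideal I R by fact
  from insert obtain n f where f: "f \<in> module_hom R (tuples R n) (self_module R)"
    "A \<subseteq> f ` carrier (tuples R n)" "f ` carrier (tuples R n) \<subseteq> I" by auto
  interpret T: module R "tuples R n" by (rule tuples_module)
  have x: "x \<in> I" "x \<in> carrier R" using insert.prems I.Icarr by auto
  let ?g = "\<lambda>y. f (truncate R n y) \<oplus>\<^bsub>self_module R\<^esub> (y n \<odot>\<^bsub>self_module R\<^esub> x)"
  have fz: "f (\<lambda>i. \<zero>) = \<zero>" using hom_zero[OF tuples_module self_module f(1)] by (simp add: tuples_ops)
  have "x = ?g (unit_tuple R n)"
    using x(2) fz by (simp add: truncate_def unit_tuple_def fun_upd_def cong: if_cong)
  moreover have "unit_tuple R n \<in> carrier (tuples R (Suc n))" by (simp add: unit_tuple_closed)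
  ultimately have "x \<in> ?g ` carrier (tuples R (Suc n))" by (rule image_eqI)
  moreover have "A \<subseteq> ?g ` carrier (tuples R (Suc n))"
  proof
    fix b assume "b \<in> A"
    then obtain y where y: "y \<in> carrier (tuples R n)" "b = f y" using f(2) by blast
    have "f y \<in> carrier R" using hom_closed[OF f(1) y(1)] by simp
    moreover have "y n = \<zero>" using y(1) by (simp add: in_tuples)
    moreover from this have "truncate R n y = y" by (simp add: truncate_def fun_upd_idem)
    ultimately have "b = ?g y" using y(2) x(2) by simp
    moreover have "y \<in> carrier (tuples R (Suc n))" using y(1) tuples_mono[of n "Suc n"] by auto
    ultimately show "b \<in> ?g ` carrier (tuples R (Suc n))" by (rule image_eqI)
  qed
  moreover have "?g ` carrier (tuples R (Suc n)) \<subseteq> I"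
  proof (rule image_subsetI)
    fix y assume y: "y \<in> carrier (tuples R (Suc n))"
    have "f (truncate R n y) \<in> I" using truncate_closed[OF y] f(3) by blast
    thus "?g y \<in> I" using I.I_l_closed[OF x(1) tuples_nth[OF y, of n]] by simp
  qed
  moreover have "?g \<in> module_hom R (tuples R (Suc n)) (self_module R)"
    by (rule hom_extend_tuples[OF self_module f(1)]) (simp add: x(2))
  ultimately show ?case by (intro exI[of _ "Suc n"] exI[of _ ?g]) auto
qed

text \<open>A relation with an invertible i-th coefficient expresses the i-th generator through the
  others.\<close>

lemma drop_generator:
  assumes f: "f \<in> module_hom R (tuples R (Suc n)) (self_module R)"
    and y: "y \<in> carrier (tuples R (Suc n))" "f y = \<zero>" and i: "i \<le> n"
    and q: "q \<in> carrier R" "q \<otimes> y i = \<one>"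
  shows "\<exists>g. g \<in> module_hom R (tuples R n) (self_module R) \<and> g ` carrier (tuples R n) = f ` carrier (tuples R (Suc n))"
proof -
  interpret T: module R "tuples R (Suc n)" by (rule tuples_module)
  \<comment> \<open>Inserts a zero at position i, so that R^n becomes the tuples of R^(n+1) that
    avoid the redundant generator.\<close>
  define ins where "ins z k = (if k < i then z k else if k = i then \<zero> else z (k - 1))" for z :: "nat \<Rightarrow> 'a" and k
  have ins_closed: "ins z \<in> carrier (tuples R (Suc n))" if "z \<in> carrier (tuples R n)" for z
    using that i by (auto simp: ins_def in_tuples)
  have ins: "ins \<in> module_hom R (tuples R n) (tuples R (Suc n))"
    by (rule module_homI) (use ins_closed in \<open>auto simp: tuples_ops ins_def fun_eq_iff in_tuples\<close>)
  have "f w \<in> (\<lambda>z. f (ins z)) ` carrier (tuples R n)" if w: "w \<in> carrier (tuples R (Suc n))" for w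
  proof -
    let ?c = "w i \<otimes> q"
    have c: "?c \<in> carrier R" using tuples_nth[OF w, of i] q by simp
    \<comment> \<open>Subtracting this multiple of the relation \<open>y\<close> clears the i-th
      coordinate without changing the value of \<open>f\<close>.\<close>
    define x where "x = w \<ominus>\<^bsub>tuples R (Suc n)\<^esub> (?c \<odot>\<^bsub>tuples R (Suc n)\<^esub> y)"
    have x: "x \<in> carrier (tuples R (Suc n))" unfolding x_def using w y c by simp
    have fw: "f w \<in> carrier R" using hom_closed[OF f w] by simp
    have neg: "\<ominus>\<^bsub>self_module R\<^esub> \<zero> = \<zero>" by (simp add: self_module_neg)
    have "f x = f w"
      unfolding x_def using hom_minus[OF tuples_module self_module f w T.smult_closed[OF c y(1)]]
        hom_smult[OF f c y(1)] y(2) c fw neg by (simp add: a_minus_def)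
    have x_alt: "x = w \<oplus>\<^bsub>tuples R (Suc n)\<^esub> ((\<ominus> ?c) \<odot>\<^bsub>tuples R (Suc n)\<^esub> y)"
      unfolding x_def using w y(1) c by algebra
    have "x i = w i \<oplus> (\<ominus> ?c) \<otimes> y i" unfolding x_alt by (simp add: tuples_ops)
    also have "\<dots> = w i \<ominus> w i \<otimes> (q \<otimes> y i)"
      using tuples_nth[OF w, of i] tuples_nth[OF y(1), of i] q(1) by algebra
    also have "\<dots> = \<zero>" using tuples_nth[OF w, of i] q(2) by (simp add: a_minus_def r_neg)
    finally have xi: "x i = \<zero>" .
    let ?z = "\<lambda>k. if k < i then x k else x (Suc k)"
    have z: "?z \<in> carrier (tuples R n)" using x i by (auto simp: in_tuples)
    have "ins ?z = x" by (auto simp: ins_def fun_eq_iff xi)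
    thus ?thesis using z \<open>f x = f w\<close> by (metis (no_types, lifting) image_eqI)
  qed
  hence "(\<lambda>z. f (ins z)) ` carrier (tuples R n) = f ` carrier (tuples R (Suc n))"
    using ins_closed by blast
  thus ?thesis using hom_comp[OF ins f] by blast
qed

text \<open>The least number of generators is taken. A relation with a coefficient outside
  \<open>I\<close> would have an invertible coefficient and allow one generator to be
  dropped.\<close>

lemma minimal_generators:
  assumes noeth: "noetherian_ring R" and I: "ideal I R"
    and unit: "\<And>r. \<lbrakk>r \<in> carrier R; r \<notin> I\<rbrakk> \<Longrightarrow> \<exists>s\<in>carrier R. s \<otimes> r = \<one>"
  obtains n f where "f \<in> module_hom R (tuples R n) (self_module R)" "f ` carrier (tuples R n) = I"
    "\<And>y i. \<lbrakk>y \<in> carrier (tuples R n); f y = \<zero>\<rbrakk> \<Longrightarrow> y i \<in> I"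
proof -
  interpret noetherian_ring R by fact
  interpret I: ideal I R by fact
  let ?gen = "\<lambda>n. \<exists>f. f \<in> module_hom R (tuples R n) (self_module R) \<and> f ` carrier (tuples R n) = I"
  obtain A where A: "A \<subseteq> carrier R" "finite A" "I = Idl A" using finetely_gen[OF I] by blast
  have AI: "A \<subseteq> I" unfolding A(3) by (rule genideal_self[OF A(1)])
  obtain n0 f0 where f0: "f0 \<in> module_hom R (tuples R n0) (self_module R)"
    "A \<subseteq> f0 ` carrier (tuples R n0)" "f0 ` carrier (tuples R n0) \<subseteq> I"
    using finite_subset_hom_image[OF I A(2) AI] by blast
  have "I \<subseteq> f0 ` carrier (tuples R n0)"
    unfolding A(3) by (rule genideal_minimal[OF hom_image_ideal[OF f0(1)] f0(2)])
  hence "?gen n0" using f0 by blast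
  define n where "n = (LEAST n. ?gen n)"
  have "?gen n" unfolding n_def by (rule LeastI) (rule \<open>?gen n0\<close>)
  then obtain f where f: "f \<in> module_hom R (tuples R n) (self_module R)" "f ` carrier (tuples R n) = I" by blast
  have "y i \<in> I" if y: "y \<in> carrier (tuples R n)" "f y = \<zero>" for y i
  proof (rule ccontr)
    assume yi: "y i \<notin> I"
    hence "i < n" using y(1) I.zero_closed by (auto simp: in_tuples not_less[symmetric])
    then obtain k where k: "n = Suc k" by (cases n) auto
    obtain q where q: "q \<in> carrier R" "q \<otimes> y i = \<one>" using unit[OF tuples_nth[OF y(1)] yi] by blast
    have "?gen k"
      using drop_generator[of f k y i q] f y q \<open>i < n\<close> unfolding k by auto
    hence "n \<le> k" unfolding n_def by (rule Least_le)
    thus False using k by simp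
  qed
  with f show thesis using that by blast
qed

text \<open>Zorn's lemma; in a Noetherian ring the union of a nonempty chain of ideals is a member
  of the chain, so it is still proper.\<close>

lemma ideal_in_maximal:
  assumes noeth: "noetherian_ring R" and J: "ideal J R" "J \<noteq> carrier R"
  shows "\<exists>M. maximalideal M R \<and> J \<subseteq> M"
proof -
  interpret noetherian_ring R by fact
  let ?\<I> = "{I. ideal I R \<and> I \<noteq> carrier R \<and> J \<subseteq> I}"
  have "\<exists>M\<in>?\<I>. \<forall>I\<in>?\<I>. M \<subseteq> I \<longrightarrow> I = M"
  proof (rule subset_Zorn_nonempty)
    show "?\<I> \<noteq> {}" using J by blast
    fix C assume C: "C \<noteq> {}" "subset.chain ?\<I> C"
    hence "subset.chain {I. ideal I R} C" by (auto simp: subset.chain_def)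
    hence "\<Union>C \<in> C" by (rule ideal_chain_is_trivial[OF C(1)])
    thus "\<Union>C \<in> ?\<I>" using C(2) by (auto simp: subset.chain_def)
  qed
  then obtain M where M: "M \<in> ?\<I>" and max: "\<forall>I\<in>?\<I>. M \<subseteq> I \<longrightarrow> I = M" by (rule bexE)
  have "maximalideal M R"
  proof (rule maximalidealI)
    show "ideal M R" "carrier R \<noteq> M" using M by auto
    fix I assume I: "ideal I R" "M \<subseteq> I" "I \<subseteq> carrier R"
    show "I = M \<or> I = carrier R"
    proof (rule disjCI)
      assume "I \<noteq> carrier R"
      hence "I \<in> ?\<I>" using I M by auto
      thus "I = M" using max I(2) by simp
    qed
  qed
  thus ?thesis using M by auto
qed

text \<open>The principal ideal of a nonunit is proper, so it lies in a maximal ideal, and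
  \<open>m\<close> is the only one.\<close>

lemma local_ring_unit:
  assumes "noetherian_ring R" and m: "local_ring R m" and r: "r \<in> carrier R" "r \<notin> m"
  shows "\<exists>s\<in>carrier R. s \<otimes> r = \<one>"
proof -
  have "PIdl r = carrier R"
  proof (rule ccontr)
    assume "PIdl r \<noteq> carrier R"
    then obtain M where M: "maximalideal M R" "PIdl r \<subseteq> M"
      using ideal_in_maximal[OF assms(1) cgenideal_ideal[OF r(1)]] by blast
    hence "M = m" using m by (simp add: local_ring_def)
    thus False using M(2) cgenideal_self[OF r(1)] r(2) by blast
  qed
  hence "\<one> \<in> PIdl r" by simp
  thus ?thesis by (auto simp: cgenideal_def)
qed

end

text \<open>The first two steps of a comparison map from the Koszul complex on the generators to the
  resolution.\<close>

lemma (in residue_resolution) koszul_exists: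
  assumes \<delta>: "\<delta> \<in> module_hom R (tuples R n) (self_module R)" "\<delta> ` carrier (tuples R n) = m"
    "\<And>y i. \<lbrakk>y \<in> carrier (tuples R n); \<delta> y = \<zero>\<rbrakk> \<Longrightarrow> y i \<in> m"
  shows "\<exists>t \<tau>. koszul R P d m \<rho> \<omega> n \<delta> t \<tau>"
proof -
  let ?F = "tuples R n"
  have d1: "d 1 \<in> module_hom R (P 1) (P 0)" by (rule d_hom') simp
  have d2: "d 2 \<in> module_hom R (P 2) (P 1)" by (rule d_hom') simp
  have \<delta>c: "\<delta> y \<in> carrier R" if "y \<in> carrier ?F" for y using hom_closed[OF \<delta>(1) that] by simp
  have \<phi>: "(\<lambda>y. \<delta> y \<odot>\<^bsub>P 0\<^esub> \<omega>) \<in> module_hom R ?F (P 0)" by (rule hom_smult_vec[OF P_module \<delta>(1) \<omega>_closed])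
  have "\<exists>t. t \<in> module_hom R ?F (P 1) \<and> (\<forall>y\<in>carrier ?F. d 1 (t y) = \<delta> y \<odot>\<^bsub>P 0\<^esub> \<omega>)"
  proof (rule tuples_lift[OF P_module P_module d1 \<phi>])
    fix y assume y: "y \<in> carrier ?F"
    have "\<rho> (\<delta> y \<odot>\<^bsub>P 0\<^esub> \<omega>) = \<delta> y"
      using hom_smult[OF \<rho>_hom \<delta>c[OF y] \<omega>_closed] \<rho>_\<omega> \<delta>c[OF y] by simp
    moreover have "\<delta> y \<in> m" using y \<delta>(2) by blast
    ultimately show "\<delta> y \<odot>\<^bsub>P 0\<^esub> \<omega> \<in> d 1 ` carrier (P 1)"
      using exact0[OF hom_closed[OF \<phi> y]] by force
  qed
  then obtain t where t: "t \<in> module_hom R ?F (P 1)" "\<And>y. y \<in> carrier ?F \<Longrightarrow> d 1 (t y) = \<delta> y \<odot>\<^bsub>P 0\<^esub> \<omega>"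
    by (elim exE conjE) blast
  let ?w = "\<lambda>y z. (\<delta> y \<odot>\<^bsub>P 1\<^esub> t z) \<ominus>\<^bsub>P 1\<^esub> (\<delta> z \<odot>\<^bsub>P 1\<^esub> t y)"
  have w: "alternating ?F (P 1) ?w" by (rule alternating_wedge[OF tuples_module P_module \<delta>(1) t(1)])
  have "\<exists>\<tau>. alternating ?F (P 2) \<tau> \<and> (\<forall>y\<in>carrier ?F. \<forall>z\<in>carrier ?F. d 2 (\<tau> y z) = ?w y z)"
  proof (rule alternating_lift[OF P_module P_module d2 w])
    fix y z assume y: "y \<in> carrier ?F" and z: "z \<in> carrier ?F"
    note c = hom_closed[OF t(1) y] hom_closed[OF t(1) z] \<delta>c[OF y] \<delta>c[OF z]
    have "d 1 (?w y z) = (\<delta> y \<odot>\<^bsub>P 0\<^esub> (\<delta> z \<odot>\<^bsub>P 0\<^esub> \<omega>)) \<ominus>\<^bsub>P 0\<^esub> (\<delta> z \<odot>\<^bsub>P 0\<^esub> (\<delta> y \<odot>\<^bsub>P 0\<^esub> \<omega>))"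
      using c t(2)[OF y] t(2)[OF z] by (simp add: hom_P_minus[OF d1] hom_smult[OF d1])
    also have "\<dots> = \<zero>\<^bsub>P 0\<^esub>" using c(3,4) \<omega>_closed by algebra
    finally have "\<exists>x\<in>carrier (P (1 + 1)). d (1 + 1) x = ?w y z"
      using alternating_closed[OF w y z] by (intro exact) simp_all
    thus "?w y z \<in> d 2 ` carrier (P 2)" by force
  qed
  then obtain \<tau> where \<tau>: "alternating ?F (P 2) \<tau>"
    "\<And>y z. \<lbrakk>y \<in> carrier ?F; z \<in> carrier ?F\<rbrakk> \<Longrightarrow> d 2 (\<tau> y z) = ?w y z"
    by (elim exE conjE) blast
  have "koszul R P d m \<rho> \<omega> n \<delta> t \<tau>"
    by unfold_locales (use \<delta> t \<tau> in auto)
  thus ?thesis by blast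
qed

text \<open>Since P_0 is free, the augmentation lifts along the projection of R to its residue
  field; the kernel condition becomes membership of \<open>\<rho> x\<close> in
  \<open>m\<close>.\<close>

lemma residue_resolution_exists:
  assumes noeth: "noetherian_ring R" and local_ring: "local_ring R m"
    and res: "free_resolution R (residue_module R m) P d \<epsilon>"
  shows "\<exists>\<rho> \<omega>. residue_resolution R P d m \<rho> \<omega>"
proof -
  interpret cring R using local_ring by (simp add: local_ring_def)
  interpret m: maximalideal m R using local_ring by (simp add: local_ring_def)
  note unit = local_ring_unit[OF noeth local_ring]
  have one: "\<one>\<^bsub>R\<^esub> \<notin> m" using m.I_notcarr m.one_imp_carrier by blast
  have P_free: "free_module R (P i)" for i using res by (simp add: free_resolution_def)
  have P_mod: "module R (P i)" for i using P_free by (simp add: free_module_def)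
  interpret P: module R "P i" for i by (rule P_mod)
  interpret S: module R "self_module R" by (rule self_module)
  have P_neg: "carrier (P i) = {\<zero>\<^bsub>P i\<^esub>}" if "i < 0" for i using res that by (simp add: free_resolution_def)
  have d: "d i \<in> module_hom R (P i) (P (i - 1))" for i using res by (simp add: free_resolution_def)
  have ex: "{x \<in> carrier (P i). d i x = \<zero>\<^bsub>P (i - 1)\<^esub>} = d (i + 1) ` carrier (P (i + 1))" if "1 \<le> i" for i
    using res that by (simp add: free_resolution_def)
  have \<epsilon>: "\<epsilon> \<in> module_hom R (P 0) (residue_module R m)"
    and \<epsilon>_ker: "{x \<in> carrier (P 0). \<epsilon> x = \<zero>\<^bsub>residue_module R m\<^esub>} = d 1 ` carrier (P 1)"
    and \<epsilon>_surj: "\<epsilon> ` carrier (P 0) = carrier (residue_module R m)"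
    using res by (simp_all add: free_resolution_def)
  have k: "carrier (residue_module R m) = a_rcosets\<^bsub>R\<^esub> m" "\<zero>\<^bsub>residue_module R m\<^esub> = m"
    "x \<oplus>\<^bsub>residue_module R m\<^esub> y = x <+>\<^bsub>R\<^esub> y"
    "r \<odot>\<^bsub>residue_module R m\<^esub> x = rcoset_mult R m (m +>\<^bsub>R\<^esub> r) x" for x y r
    by (simp_all add: residue_module_def FactRing_def ring.defs module.defs)
  have coset_zero: "m +>\<^bsub>R\<^esub> r = m \<longleftrightarrow> r \<in> m" if "r \<in> carrier R" for r
    using a_coset_join1[OF _ that m.a_subgroup] a_coset_join2[OF that m.a_subgroup] by blast
  obtain \<rho> where \<rho>: "\<rho> \<in> module_hom R (P 0) (self_module R)" "\<And>x. x \<in> carrier (P 0) \<Longrightarrow> \<epsilon> x = m +>\<^bsub>R\<^esub> \<rho> x"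
  proof (rule free_selection[OF P_free[of 0] self_module, where S = "\<lambda>x r. \<epsilon> x = m +>\<^bsub>R\<^esub> r"])
    fix x assume "x \<in> carrier (P 0)"
    hence "\<epsilon> x \<in> a_rcosets\<^bsub>R\<^esub> m" using hom_closed[OF \<epsilon>] k(1) by blast
    thus "\<exists>r\<in>carrier (self_module R). \<epsilon> x = m +>\<^bsub>R\<^esub> r" by (auto simp: A_RCOSETS_def')
  next
    fix x x' r r' assume "x \<in> carrier (P 0)" "x' \<in> carrier (P 0)" "r \<in> carrier (self_module R)" "r' \<in> carrier (self_module R)"
      "\<epsilon> x = m +>\<^bsub>R\<^esub> r" "\<epsilon> x' = m +>\<^bsub>R\<^esub> r'"
    thus "\<epsilon> (x \<oplus>\<^bsub>P 0\<^esub> x') = m +>\<^bsub>R\<^esub> (r \<oplus>\<^bsub>self_module R\<^esub> r')"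
      using hom_add[OF \<epsilon>, of x x'] m.a_rcos_sum[of r r'] by (simp add: k)
  next
    fix q x r assume "q \<in> carrier R" "x \<in> carrier (P 0)" "r \<in> carrier (self_module R)" "\<epsilon> x = m +>\<^bsub>R\<^esub> r"
    thus "\<epsilon> (q \<odot>\<^bsub>P 0\<^esub> x) = m +>\<^bsub>R\<^esub> (q \<odot>\<^bsub>self_module R\<^esub> r)"
      using hom_smult[OF \<epsilon>, of q x] m.rcoset_mult_add[of q r] by (simp add: k)
  qed (rule that)
  have \<rho>c: "\<rho> x \<in> carrier R" if "x \<in> carrier (P 0)" for x using hom_closed[OF \<rho>(1) that] by simp
  have ker: "d 1 ` carrier (P 1) = {x \<in> carrier (P 0). \<rho> x \<in> m}"
  proof -
    have "\<epsilon> x = m \<longleftrightarrow> \<rho> x \<in> m" if "x \<in> carrier (P 0)" for x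
      unfolding \<rho>(2)[OF that] by (rule coset_zero[OF \<rho>c[OF that]])
    thus ?thesis unfolding \<epsilon>_ker[symmetric] k(2) by (intro Collect_cong conj_cong refl)
  qed
  have "m +>\<^bsub>R\<^esub> \<one>\<^bsub>R\<^esub> \<in> \<epsilon> ` carrier (P 0)" unfolding \<epsilon>_surj k(1) by (auto simp: A_RCOSETS_def')
  then obtain w where w: "w \<in> carrier (P 0)" "m +>\<^bsub>R\<^esub> \<rho> w = m +>\<^bsub>R\<^esub> \<one>\<^bsub>R\<^esub>"
    by (elim imageE) (metis \<rho>(2))
  have "\<rho> w \<notin> m"
  proof
    assume "\<rho> w \<in> m"
    hence "m +>\<^bsub>R\<^esub> \<one>\<^bsub>R\<^esub> = m" using coset_zero[OF \<rho>c[OF w(1)]] w(2) by simp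
    thus False using coset_zero[OF one_closed] one by simp
  qed
  \<comment> \<open>A preimage \<open>w\<close> of the unit coset gives \<open>\<rho> w\<close>
    equal to one only modulo \<open>m\<close>; rescaling by the inverse makes it exactly
    one.\<close>
  then obtain q where q: "q \<in> carrier R" "q \<otimes>\<^bsub>R\<^esub> \<rho> w = \<one>\<^bsub>R\<^esub>" using unit[OF \<rho>c[OF w(1)]] by blast
  have "residue_resolution R P d m \<rho> (q \<odot>\<^bsub>P 0\<^esub> w)"
  proof unfold_locales
    fix i x assume x: "x \<in> carrier (P i)"
    have dx: "d i x \<in> carrier (P (i - 1))" by (rule hom_closed[OF d x])
    show "d (i - 1) (d i x) = \<zero>\<^bsub>P (i - 2)\<^esub>"
    proof (cases "2 \<le> i")
      case True
      have "d i x \<in> d (i - 1 + 1) ` carrier (P (i - 1 + 1))" using x by simp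
      also have "\<dots> = {x \<in> carrier (P (i - 1)). d (i - 1) x = \<zero>\<^bsub>P (i - 1 - 1)\<^esub>}"
        by (rule ex[symmetric]) (use True in simp)
      finally show ?thesis by simp
    next
      \<comment> \<open>Below degree two the vanishing of d d comes from the zero modules in
        negative degree and not from exactness.\<close>
      case False
      hence "carrier (P (i - 2)) = {\<zero>\<^bsub>P (i - 2)\<^esub>}" by (intro P_neg) simp
      thus ?thesis using hom_closed[OF d dx] by simp
    qed
  next
    fix i x assume "1 \<le> i" "x \<in> carrier (P i)" "d i x = \<zero>\<^bsub>P (i - 1)\<^esub>"
    hence "x \<in> d (i + 1) ` carrier (P (i + 1))" using ex[of i] by blast
    thus "\<exists>y\<in>carrier (P (i + 1)). d (i + 1) y = x" by (metis imageE)
  next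
    fix x assume "x \<in> carrier (P 0)" "\<rho> x \<in> m"
    hence "x \<in> d 1 ` carrier (P 1)" unfolding ker by simp
    thus "\<exists>y\<in>carrier (P 1). d 1 y = x" by (metis imageE)
  next
    fix y assume "y \<in> carrier (P 1)"
    hence "d 1 y \<in> d 1 ` carrier (P 1)" by simp
    thus "\<rho> (d 1 y) \<in> m" unfolding ker by simp
  next
    show "\<rho> (q \<odot>\<^bsub>P 0\<^esub> w) = \<one>\<^bsub>R\<^esub>" using hom_smult[OF \<rho>(1) q(1) w(1)] q(2) by simp
  qed (use d m.is_ideal one unit \<rho>(1) q(1) w(1) P_free P_neg in auto)
  thus ?thesis by blast
qed

theorem corollary5p6:
  fixes R :: "('a, 'r) ring_scheme"
    and m :: "'a set"
    and P :: "int \<Rightarrow> ('a, 'b, 'm) module_scheme"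
    and d :: "int \<Rightarrow> 'b \<Rightarrow> 'b"
    and \<epsilon> :: "'b \<Rightarrow> 'a set"
  assumes "noetherian_ring R"
    and "local_ring R m"
    and "m \<noteq> {\<zero>\<^bsub>R\<^esub>}"
    and "free_resolution R (residue_module R m) P d \<epsilon>"
    and "right_submodule (ext_shriek R m P d) (ext_algebra R P d) hull
           (\<Union>n\<in>{0..2}. ext_component R P d n) = carrier (ext_algebra R P d)"
  shows "carrier (ext_algebra R P d) = ext_shriek R m P d"
proof -
  obtain \<rho> \<omega> where "residue_resolution R P d m \<rho> \<omega>"
    using residue_resolution_exists[OF assms(1,2,4)] by (elim exE)
  then interpret residue_resolution R P d m \<rho> \<omega> .
  obtain n \<delta> where \<delta>: "\<delta> \<in> module_hom R (tuples R n) (self_module R)" "\<delta> ` carrier (tuples R n) = m"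
    "\<And>y i. \<lbrakk>y \<in> carrier (tuples R n); \<delta> y = \<zero>\<^bsub>R\<^esub>\<rbrakk> \<Longrightarrow> y i \<in> m"
    by (rule minimal_generators[OF assms(1) m_ideal unit], assumption, assumption, rule that)
  have "\<exists>t \<tau>. koszul R P d m \<rho> \<omega> n \<delta> t \<tau>" by (rule koszul_exists) (fact \<delta>)+
  then obtain t \<tau> where "koszul R P d m \<rho> \<omega> n \<delta> t \<tau>"
    by (elim exE)
  then interpret koszul R P d m \<rho> \<omega> n \<delta> t \<tau> .
  show ?thesis by (rule generated_in_degree_one) (rule assms(5))
qed

end
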